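(* Let $f_n$ be the number of unicircuit digraphs on the labeled vertex set $\{1,\dots,n\}$ and $k_n$ the number of those which have at least one kernel (equivalently, admit a well-coloring). Then $$\lim_{n\to\infty}\frac{k_n}{f_n}=\frac{3\lambda^3+\lambda^2-\lambda-1}{(1+\lambda)^2(\lambda-1)}\approx 0.9265,$$ where $\lambda\approx0.351733$ is the unique real root of $2\lambda=\exp(-\lambda)$.
   Context: All digraphs are finite, without loops and without multiple arcs (two opposite arcs $(u,v)$ and $(v,u)$ may both be present, forming a circuit of length 2). A unicircuit digraph is a connected digraph whose underlying undirected multigraph (a pair of opposite arcs counting as a cycle of length 2) has at most one cycle, and such that this cycle, if present, is a directed circuit. A kernel of a digraph $(V,E)$ is a nonempty set $K\subseteq V$ with no arc between vertices of $K$ such that every vertex outside $K$ has an arc to a vertex of $K$; a well-coloring colors vertices red/green so that every green vertex has a red out-neighbour and no red vertex has a red out-neighbour (the red set being a kernel). *)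

theory Defs
  imports Complex_Main "Graph_Theory.Graph_Theory"
begin

text \<open>
  A cycle of the underlying undirected multigraph: its edges are the arcs with their directions
  forgotten, so a pair of opposite arcs consists of two distinct parallel edges and is a cycle of
  length 2.  The edge \<open>es ! i\<close> joins \<open>vs ! i\<close> to the cyclically next vertex.
\<close>

definition underlying_cycle :: "'a pair_pre_digraph \<Rightarrow> 'a list \<Rightarrow> ('a \<times> 'a) list \<Rightarrow> bool" where
  "underlying_cycle G vs es \<longleftrightarrow>
     es \<noteq> [] \<and> length vs = length es \<and> distinct vs \<and> distinct es \<and>
     set vs \<subseteq> pverts G \<and> set es \<subseteq> parcs G \<and>
     (\<forall>i<length es. {fst (es ! i), snd (es ! i)} = {vs ! i, vs ! (Suc i mod length es)})"

text \<open>
  Cycles are identified by their edge sets, so that rotations and reversals of the same cycle are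
  not counted separately.
\<close>

definition underlying_cycles :: "'a pair_pre_digraph \<Rightarrow> ('a \<times> 'a) set set" where
  "underlying_cycles G = {set es | vs es. underlying_cycle G vs es}"

definition directed_circuits :: "'a pair_pre_digraph \<Rightarrow> ('a \<times> 'a) set set" where
  "directed_circuits G = {set p | p. pre_digraph.cycle (with_proj G) p}"

text \<open>
  The qualified \<open>Digraph_Component.connected\<close> is weak connectivity, as opposed to the topological
  notion of the same name; it entails that the vertex set is nonempty.
\<close>

definition unicircuit :: "'a pair_pre_digraph \<Rightarrow> bool" where
  "unicircuit G \<longleftrightarrow>
     pair_digraph G \<and> Digraph_Component.connected (with_proj G) \<and>
     (\<forall>C \<in> underlying_cycles G. \<forall>D \<in> underlying_cycles G. C = D) \<and>
     underlying_cycles G \<subseteq> directed_circuits G"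

definition digraph_kernel :: "'a pair_pre_digraph \<Rightarrow> 'a set \<Rightarrow> bool" where
  "digraph_kernel G K \<longleftrightarrow>
     K \<noteq> {} \<and> K \<subseteq> pverts G \<and>
     (\<forall>u\<in>K. \<forall>v\<in>K. (u, v) \<notin> parcs G) \<and>
     (\<forall>u \<in> pverts G - K. \<exists>v\<in>K. (u, v) \<in> parcs G)"

datatype colour = Red | Green

definition well_colouring :: "'a pair_pre_digraph \<Rightarrow> ('a \<Rightarrow> colour) \<Rightarrow> bool" where
  "well_colouring G c \<longleftrightarrow>
     (\<forall>u \<in> pverts G. c u = Green \<longrightarrow> (\<exists>v \<in> pverts G. (u, v) \<in> parcs G \<and> c v = Red)) \<and>
     (\<forall>u \<in> pverts G. c u = Red \<longrightarrow> \<not> (\<exists>v \<in> pverts G. (u, v) \<in> parcs G \<and> c v = Red))"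

definition unicircuits :: "nat \<Rightarrow> nat pair_pre_digraph set" where
  "unicircuits n = {G. pverts G = {1..n} \<and> unicircuit G}"

definition num_unicircuit :: "nat \<Rightarrow> nat" where
  "num_unicircuit n = card (unicircuits n)"

definition num_unicircuit_kernel :: "nat \<Rightarrow> nat" where
  "num_unicircuit_kernel n = card {G \<in> unicircuits n. \<exists>K. digraph_kernel G K}"

end

theory Submission
  imports Defs "HOL-Analysis.Analysis"
begin

text \<open>
  A unicircuit digraph with a circuit consists of a circuit and, at each of its vertices, a rooted
  tree with arbitrarily oriented edges.  A tree has a unique kernel, and the colours in the trees
  depend on the circuit only through arcs that lead towards the root.  Going backwards along the
  circuit, a colouring exists as soon as some root is green in its own tree; so there is no kernel
  if and only if the circuit is odd and all roots are red in their trees.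

  With \<open>T = x exp (2 T)\<close> counting trees and \<open>R exp R = T\<close> counting trees with a red root, all
  digraphs with a circuit have the generating function \<open>\<Sum>k\<ge>2. T ^ k / k\<close>, those without a kernel
  \<open>\<Sum>k\<ge>3 odd. R ^ k / k\<close>, and digraphs without a circuit are negligible.  Applying \<open>x d/dx\<close> turns both
  into \<open>x T'\<close> times a power series in \<open>T\<close> or \<open>R\<close>.  The coefficients of \<open>x T'\<close> at the radius of
  convergence \<open>1 / (2 e)\<close> decay so slowly, and those of the second factor so fast, that the
  coefficients of the product are asymptotically those of \<open>x T'\<close> times the value of the second
  factor at \<open>1 / (2 e)\<close>.  There \<open>T = 1/2\<close> and therefore \<open>R = \<lambda>\<close>.
\<close>

unbundle no vec_syntax
unbundle fps_syntax

section \<open>Generating functions of oriented trees\<close>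

text \<open>Neither Stirling's formula nor singularity analysis enters. Scaled by the radius, the
  coefficients of \<open>x T'\<close> are n^n / (2 n! e^n), and only two elementary facts about them
  matter: consecutive ratios tend to 1, and the terms divided by n are summable.

  Counts are normalised by n! [x^n] T = (2 n)^(n-1), the number of rooted trees. The second factor
  for all circuits is T / (1 - T), which is 1 at T = 1/2; so this normaliser is asymptotic to f_n,
  and the limit is 1 minus the value belonging to R, where 2 \<lambda> = exp (- \<lambda>) removes
  the exponential.

  A circuit needs the colours of several roots jointly. Forests are therefore counted with an
  arbitrary set of roots prescribed to be red. The same count yields the coefficientwise bounds 0
  \<le> R \<le> T, which the estimates require but which R exp R = T does not show, since R as a
  series in T has alternating signs. Digraphs become forests because an arc that is not a bridge
  lies on a cycle.\<close>

lemma fps_exp_compose_cmult: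
  fixes a :: "real fps"
  assumes "a $ 0 = 0"
  shows "fps_exp c oo a = fps_exp 1 oo (fps_const c * a)"
proof -
  have *: "fps_exp c = fps_exp 1 oo (fps_const c * fps_X)"
    by (simp add: fps_exp_compose_linear)
  have "fps_exp c oo a = (fps_exp 1 oo (fps_const c * fps_X)) oo a"
    using * by simp
  also have "\<dots> = fps_exp 1 oo ((fps_const c * fps_X) oo a)"
    using assms by (subst fps_compose_assoc) auto
  also have "(fps_const c * fps_X) oo a = fps_const c * a"
    using assms by (subst fps_compose_mult_distrib) auto
  finally show ?thesis .
qed

lemma fps_exp_compose_minus_inverse:
  fixes a :: "real fps"
  assumes "a $ 0 = 0"
  shows "(fps_exp 1 oo a) * (fps_exp 1 oo (- a)) = 1"
proof -
  have "(fps_exp 1 oo (- a)) = fps_exp (-1) oo a"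
    using fps_exp_compose_cmult[OF assms, of "-1"] by (simp flip: fps_const_neg)
  then have "(fps_exp 1 oo a) * (fps_exp 1 oo (- a)) = (fps_exp 1 * fps_exp (-1)) oo a"
    using assms by (simp add: fps_compose_mult_distrib)
  also have "\<dots> = 1"
    using fps_exp_add_mult[of "1::real" "-1"] by simp
  finally show ?thesis .
qed

text \<open>The quotient of the two sides has derivative 0 and constant term 1. It is written with
  \<open>exp (- a)\<close> and \<open>exp (- b)\<close> in place of division.\<close>

lemma fps_exp_compose_add:
  fixes a b :: "real fps"
  assumes a: "a $ 0 = 0" and b: "b $ 0 = 0"
  shows "fps_exp 1 oo (a + b) = (fps_exp 1 oo a) * (fps_exp 1 oo b)"
proof -
  let ?E = "\<lambda>a. fps_exp (1::real) oo a"
  have D: "fps_deriv (?E c) = ?E c * fps_deriv c" if "c $ 0 = 0" for c :: "real fps"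
    using that by (simp add: fps_compose_deriv)
  define F where "F = ?E (a + b) * (?E (-a) * ?E (-b))"
  have "fps_deriv F = 0"
    using a b by (simp add: F_def D algebra_simps)
  then have "F = fps_const (F $ 0)"
    by (simp add: fps_deriv_eq_0_iff)
  also have "F $ 0 = 1"
    by (simp add: F_def)
  finally have F: "F = 1" by simp
  have "?E a * ?E b = ?E a * ?E b * F" using F by simp
  also have "\<dots> = ?E (a + b) * (?E a * ?E (-a)) * (?E b * ?E (-b))"
    by (simp add: F_def algebra_simps)
  also have "\<dots> = ?E (a + b)"
    using a b by (simp add: fps_exp_compose_minus_inverse)
  finally show ?thesis ..
qed

lemma fps_exp_compose_of_nat_mult:
  fixes a :: "real fps"
  assumes a: "a $ 0 = 0"
  shows "fps_exp 1 oo (of_nat k * a) = (fps_exp 1 oo a) ^ k"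
proof (induction k)
  case (Suc k)
  have "of_nat (Suc k) * a = a + of_nat k * a" by (simp add: algebra_simps)
  then show ?case using Suc a by (simp add: fps_exp_compose_add fps_mult_nth_0)
qed (simp add: fps_compose_0_right)

text \<open>
  The exponential generating function of labelled rooted trees with freely oriented edges, the
  solution of \<open>T = x exp (2 T)\<close>.
\<close>

definition tree_egf :: "real fps" where
  "tree_egf = fps_inv (fps_X * fps_exp (- 2))"

text \<open>
  The exponential generating function of those trees whose root is red, that is, lies in the kernel
  of the tree.  A subtree may hang on a red root by an arc towards the root, or by an arc from the
  root if its own root is green; hence \<open>R = x exp (T + (T - R))\<close>, which amounts to \<open>R exp R = T\<close>.
\<close>

definition red_egf :: "real fps" where
  "red_egf = fps_inv (fps_X * fps_exp 1) oo tree_egf"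

lemma tree_egf_0 [simp]: "tree_egf $ 0 = 0"
  by (simp add: tree_egf_def fps_inv_def)

lemma red_egf_0 [simp]: "red_egf $ 0 = 0"
  by (simp add: red_egf_def fps_inv_def)

lemma tree_egf_eq: "tree_egf = fps_X * (fps_exp 2 oo tree_egf)"
proof -
  let ?a = "fps_X * fps_exp (- 2) :: real fps"
  have "?a oo tree_egf = fps_X"
    unfolding tree_egf_def by (rule fps_inv_right) (auto simp: fps_mult_nth_1)
  then have "fps_X = tree_egf * (fps_exp (-2) oo tree_egf)"
    by (simp add: fps_compose_mult_distrib)
  then have "fps_X * (fps_exp 2 oo tree_egf) = tree_egf * ((fps_exp (-2) * fps_exp 2) oo tree_egf)"
    by (simp add: fps_compose_mult_distrib algebra_simps)
  also have "fps_exp (-2) * fps_exp 2 = (1 :: real fps)"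
    using fps_exp_add_mult[of "-2" "2::real"] by simp
  finally show ?thesis by simp
qed

lemma red_egf_eq: "red_egf * (fps_exp 1 oo red_egf) = tree_egf"
proof -
  let ?a = "fps_X * fps_exp 1 :: real fps"
  have "?a oo fps_inv ?a = fps_X"
    by (rule fps_inv_right) (auto simp: fps_mult_nth_1)
  then have "(?a oo fps_inv ?a) oo tree_egf = tree_egf" by simp
  then have "?a oo red_egf = tree_egf"
    unfolding red_egf_def by (subst fps_compose_assoc) (auto simp: fps_inv_def)
  then show ?thesis by (simp add: fps_compose_mult_distrib)
qed

text \<open>This is T / x: the root has a prescribed label, and the exponent counts the remaining
  vertices only. Likewise, \<open>red_egf'\<close> is R / x.\<close>

definition tree_egf' :: "real fps" where
  "tree_egf' = fps_exp 2 oo tree_egf"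

definition red_egf' :: "real fps" where
  "red_egf' = tree_egf' * (fps_exp (-1) oo red_egf)"

lemma tree_egf_shift: "tree_egf = fps_X * tree_egf'"
  using tree_egf_eq by (simp add: tree_egf'_def)

lemma exp_red_egf: "(fps_exp 1 oo red_egf) * (fps_exp (-1) oo red_egf) = 1"
  using fps_exp_compose_minus_inverse[of red_egf] fps_exp_compose_cmult[of red_egf "-1"]
  by (simp flip: fps_const_neg)

lemma red_egf_eq': "red_egf = tree_egf * (fps_exp (-1) oo red_egf)"
proof -
  have "tree_egf * (fps_exp (-1) oo red_egf) =
      red_egf * ((fps_exp 1 oo red_egf) * (fps_exp (-1) oo red_egf))"
    by (subst red_egf_eq[symmetric]) (simp add: algebra_simps)
  then show ?thesis by (simp add: exp_red_egf)
qed

lemma red_egf_shift: "red_egf = fps_X * red_egf'"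
  by (metis mult.assoc red_egf'_def red_egf_eq' tree_egf_shift)

text \<open>A vertex can hang on k roots in 2 k ways; if it is red in its own tree, the arcs to it
  from the x roots prescribed red are forbidden. So the argument of the exponential counts single
  branches with their attachment, and the exponential counts sets of branches.\<close>

lemma exp_layer_egf:
  assumes "x \<le> k"
  shows "fps_exp 1 oo (of_nat (2 * k) * tree_egf - of_nat x * red_egf)
           = red_egf' ^ x * tree_egf' ^ (k - x)"
proof -
  have *: "of_nat (2 * k) * tree_egf - of_nat x * red_egf
      = of_nat k * (fps_const 2 * tree_egf) + of_nat x * (fps_const (-1) * red_egf)"
    by (simp add: algebra_simps numeral_fps_const flip: fps_const_neg)
  have "fps_exp 1 oo (of_nat (2 * k) * tree_egf - of_nat x * red_egf)
      = (fps_exp 1 oo (of_nat k * (fps_const 2 * tree_egf))) *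
        (fps_exp 1 oo (of_nat x * (fps_const (-1) * red_egf)))"
    unfolding * by (rule fps_exp_compose_add) auto
  also have "\<dots> = tree_egf' ^ k * (fps_exp (-1) oo red_egf) ^ x"
    by (simp add: fps_exp_compose_of_nat_mult tree_egf'_def fps_exp_compose_cmult[of _ 2] fps_exp_compose_cmult[of _ "-1"])
  also have "\<dots> = red_egf' ^ x * tree_egf' ^ (k - x)"
    using assms by (simp add: red_egf'_def power_mult_distrib algebra_simps flip: power_add)
  finally show ?thesis .
qed

text \<open>Differentiation of T = x exp (2 T). The factor 1 - 2 T vanishes at T = 1/2, where the
  singularity lies.\<close>

lemma tree_egf_deriv: "fps_X * fps_deriv tree_egf * (1 - 2 * tree_egf) = tree_egf"
proof -
  have "fps_deriv tree_egf = tree_egf' + fps_X * (2 * tree_egf' * fps_deriv tree_egf)"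
    by (subst tree_egf_shift) (simp add: tree_egf'_def fps_compose_deriv numeral_fps_const fps_compose_mult_distrib algebra_simps)
  then have "fps_X * fps_deriv tree_egf = tree_egf + fps_X * (2 * tree_egf * fps_deriv tree_egf)"
    using tree_egf_shift by (metis (no_types, lifting) distrib_left mult.assoc mult.left_commute)
  moreover have "fps_X * fps_deriv tree_egf * (1 - 2 * tree_egf)
      = fps_X * fps_deriv tree_egf - fps_X * (2 * tree_egf * fps_deriv tree_egf)"
    by (simp add: algebra_simps)
  ultimately show ?thesis by simp
qed

lemma fps_X_deriv_nth: "(fps_X * fps_deriv a) $ n = of_nat n * (a $ n)"
  for a :: "real fps"
  by (cases n) auto

text \<open>This identity, read coefficientwise, relates \<open>T ^ k\<close> to \<open>T ^ (k + 1)\<close> and replaces Lagrange inversion.\<close>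

lemma tree_egf_power_deriv:
  "of_nat (k + 1) * (fps_X * fps_deriv (tree_egf ^ k))
     - 2 * of_nat k * (fps_X * fps_deriv (tree_egf ^ (k + 1)))
     = of_nat k * of_nat (k + 1) * tree_egf ^ k"
proof (cases k)
  case (Suc m)
  have d: "fps_deriv (tree_egf ^ Suc j) = of_nat (Suc j) * tree_egf ^ j * fps_deriv tree_egf" for j
    using fps_deriv_power[of tree_egf "Suc j"] by (simp only: fps_of_nat diff_Suc_1 mult_ac)
  have "of_nat (k + 1) * (fps_X * fps_deriv (tree_egf ^ k))
     - 2 * of_nat k * (fps_X * fps_deriv (tree_egf ^ (k + 1)))
    = of_nat k * of_nat (k + 1) * tree_egf ^ m * (fps_X * fps_deriv tree_egf * (1 - 2 * tree_egf))"
    unfolding Suc Suc_eq_plus1[symmetric] d by (simp add: algebra_simps del: of_nat_Suc)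
  then show ?thesis
    unfolding tree_egf_deriv using Suc by (simp add: algebra_simps)
qed simp

lemma fps_power_nth_eq_0:
  fixes a :: "'a::idom fps"
  assumes "a $ 0 = 0" "n < k"
  shows "(a ^ k) $ n = 0"
  using assms by (metis startsby_zero_power_prefix)

lemma tree_egf_1: "tree_egf $ 1 = 1"
  by (subst tree_egf_eq) (simp add: fps_mult_nth_1)

text \<open>Downward induction from k = n, where the coefficient is 1: the differential identity
  expresses the coefficient for k by the one for k + 1.\<close>

lemma tree_egf_power_nth:
  assumes "1 \<le> k" "k \<le> n"
  shows "(tree_egf ^ k) $ n = real k / real n * (2 * real n) ^ (n - k) / fact (n - k)"
  using assms(2,1)
proof (induction k rule: inc_induct)
  case base
  have "(tree_egf ^ n) $ n = (tree_egf $ 1) ^ n"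
    by (rule startsby_zero_power_nth_same) simp
  then show ?case using base by (simp add: tree_egf_1[simplified])
next
  case (step k)
  have "(of_nat (k + 1) * (fps_X * fps_deriv (tree_egf ^ k))
     - 2 * of_nat k * (fps_X * fps_deriv (tree_egf ^ (k + 1)))) $ n
     = (of_nat k * of_nat (k + 1) * tree_egf ^ k) $ n"
    by (simp only: tree_egf_power_deriv)
  then have "real (k + 1) * (real n * (tree_egf ^ k) $ n) - 2 * real k * (real n * (tree_egf ^ (k+1)) $ n)
     = real k * real (k + 1) * (tree_egf ^ k) $ n"
    unfolding fps_sub_nth mult.assoc numeral_fps_const fps_of_nat[symmetric] fps_mult_left_const_nth fps_X_deriv_nth
    by (simp add: algebra_simps)
  then have "real (k + 1) * real (n - k) * (tree_egf ^ k) $ n = 2 * real k * real n * (tree_egf ^ (k+1)) $ n"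
    using step.hyps by (simp add: of_nat_diff algebra_simps)
  moreover have "real (k + 1) * real (n - k) \<noteq> 0" using step.hyps by simp
  ultimately have "(tree_egf ^ k) $ n
      = 2 * real k * real n * (tree_egf ^ (k+1)) $ n / (real (k + 1) * real (n - k))"
    by (simp add: nonzero_eq_divide_eq mult.commute)
  also have "(tree_egf ^ (k+1)) $ n = real (k + 1) / real n * (2 * real n) ^ (n - (k + 1)) / fact (n - (k + 1))"
    using step.IH by simp
  also have "2 * real k * real n * (real (k + 1) / real n * (2 * real n) ^ (n - (k + 1)) / fact (n - (k + 1)))
      / (real (k + 1) * real (n - k)) = real k / real n * (2 * real n) ^ (n - k) / fact (n - k)"
  proof -
    obtain d where d: "n - k = Suc d" "n - (k + 1) = d"
      using step.hyps by (metis Suc_diff_Suc Suc_eq_plus1)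
    show ?thesis unfolding d using step.hyps by (simp add: field_simps del: of_nat_Suc)
  qed
  finally show ?case .
qed

lemma tree_egf_nth: "n \<ge> 1 \<Longrightarrow> tree_egf $ n = (2 * real n) ^ (n - 1) / fact n"
  using tree_egf_power_nth[of 1 n] by (cases n) (auto simp: field_simps)

section \<open>Coefficient asymptotics\<close>

lemma tree_egf_nonneg: "tree_egf $ n \<ge> 0"
  by (cases "n = 0") (auto simp: tree_egf_nth)

lemma tree_egf_pos: "n \<ge> 1 \<Longrightarrow> tree_egf $ n > 0"
  by (auto simp: tree_egf_nth)

text \<open>The factor is the derivative i t^(i-1) at t = 1/2. It arises because the falling
  factorial n! / (n - i)! is at most n^i.\<close>

lemma tree_egf_power_nth_le:
  assumes "n \<ge> 1" "i \<ge> 1"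
  shows "(tree_egf ^ i) $ n \<le> 2 * (real i * (1/2) ^ i) * tree_egf $ n"
proof (cases "i \<le> n")
  case True
  have "fact n div fact (n - i) \<le> n ^ i"
    using True by (rule fact_div_fact_le_pow)
  then have "real (fact n div fact (n - i)) \<le> real (n ^ i)"
    by (simp only: of_nat_le_iff)
  moreover have "real (fact n div fact (n - i)) = fact n / fact (n - i)"
    by (subst real_of_nat_div) (auto simp: fact_dvd)
  ultimately have *: "fact n / fact (n - i) \<le> real n ^ i" by simp
  have "(2 * real n) ^ n = (2 * real n) ^ (n - i) * (2 * real n) ^ i"
    by (metis True le_add_diff_inverse2 power_add)
  then have "(1/2) ^ i * (2 * real n) ^ n = (2 * real n) ^ (n - i) * ((1/2) ^ i * (2 * real n) ^ i)"
    by (simp only: mult_ac)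
  also have "(1/2) ^ i * (2 * real n) ^ i = real n ^ i"
    unfolding power_mult_distrib[symmetric] by simp
  finally have "(2 * real n) ^ (n - i) / fact (n - i) = (1/2) ^ i * (2 * real n) ^ n / fact n * (fact n / fact (n - i) / real n ^ i)"
    using assms(1) by simp
  also have "\<dots> \<le> (1/2) ^ i * (2 * real n) ^ n / fact n * 1"
    using * assms by (intro mult_left_mono) (simp_all add: divide_le_eq_1 del: divide_divide_eq_left)
  finally have "real i / real n * ((2 * real n) ^ (n - i) / fact (n - i))
      \<le> real i / real n * ((1/2) ^ i * (2 * real n) ^ n / fact n * 1)"
    by (intro mult_left_mono) auto
  moreover have "real i / real n * ((1/2) ^ i * (2 * real n) ^ n / fact n * 1)
      = 2 * (real i * (1/2) ^ i) * tree_egf $ n"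
  proof -
    obtain k where k: "n = Suc k" using assms by (cases n) auto
    have "(2 * real n) ^ n = 2 * real n * (2 * real n) ^ (n - 1)" using k by simp
    then show ?thesis using assms by (simp add: tree_egf_nth)
  qed
  ultimately show ?thesis
    using assms True by (simp add: tree_egf_power_nth)
next
  case False
  then have "(tree_egf ^ i) $ n = 0" by (intro fps_power_nth_eq_0) auto
  then show ?thesis using tree_egf_nonneg[of n] by simp
qed

lemma fps_power_nth_mono:
  fixes U V :: "real fps"
  assumes "\<And>n. 0 \<le> U $ n" "\<And>n. U $ n \<le> V $ n"
  shows "0 \<le> (U ^ i) $ n \<and> (U ^ i) $ n \<le> (V ^ i) $ n"
proof (induction i arbitrary: n)
  case (Suc i)
  have V: "0 \<le> V $ n" for n using assms order_trans by blast
  have V': "0 \<le> (V ^ i) $ n" for n using Suc order_trans by blast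
  show ?case
    using assms Suc V V'
    by (auto simp: fps_mult_nth intro!: sum_nonneg sum_mono mult_mono mult_nonneg_nonneg)
qed auto

text \<open>
  Comparing \<open>U\<close> with \<open>T\<close> suffices: powers of \<open>T\<close> have explicit coefficients, and the value \<open>1/2\<close> of
  \<open>T\<close> at its singularity lies inside the disc of convergence of \<open>A\<close>.
\<close>

lemma fps_compose_nth_bound:
  fixes A U :: "real fps"
  assumes U: "\<And>n. 0 \<le> U $ n" "\<And>n. U $ n \<le> tree_egf $ n"
    and A: "summable (\<lambda>i. \<bar>A $ i\<bar> * (real i * (1/2) ^ i))" and n: "n \<ge> 1"
  shows "\<bar>(A oo U) $ n\<bar> \<le> 2 * (\<Sum>i. \<bar>A $ i\<bar> * (real i * (1/2) ^ i)) * tree_egf $ n"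
proof -
  have "\<bar>(A oo U) $ n\<bar> \<le> (\<Sum>i=0..n. \<bar>A $ i * (U ^ i) $ n\<bar>)"
    unfolding fps_compose_nth by (rule sum_abs)
  also have "\<dots> \<le> (\<Sum>i=0..n. \<bar>A $ i\<bar> * (2 * (real i * (1/2) ^ i) * tree_egf $ n))"
  proof (rule sum_mono)
    fix i assume "i \<in> {0..n}"
    have "\<bar>(U ^ i) $ n\<bar> \<le> 2 * (real i * (1/2) ^ i) * tree_egf $ n"
    proof (cases "i = 0")
      case True then show ?thesis using n by simp
    next
      case False
      then show ?thesis
        using fps_power_nth_mono[OF U, of i n] tree_egf_power_nth_le[OF n, of i] by auto
    qed
    then show "\<bar>A $ i * (U ^ i) $ n\<bar> \<le> \<bar>A $ i\<bar> * (2 * (real i * (1/2) ^ i) * tree_egf $ n)"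
      by (simp add: abs_mult mult_left_mono)
  qed
  also have "\<dots> = 2 * (\<Sum>i=0..n. \<bar>A $ i\<bar> * (real i * (1/2) ^ i)) * tree_egf $ n"
    by (simp add: sum_distrib_left sum_distrib_right mult_ac)
  also have "\<dots> \<le> 2 * (\<Sum>i. \<bar>A $ i\<bar> * (real i * (1/2) ^ i)) * tree_egf $ n"
    using tree_egf_nonneg by (intro mult_right_mono mult_left_mono sum_le_suminf A) auto
  finally show ?thesis .
qed

section \<open>Scaled coefficients at the radius of convergence\<close>

definition tree_rad :: real where "tree_rad = exp (-1) / 2"

text \<open>Coefficients of \<open>x T'\<close> scaled by the radius, so that the ratio of
  successive terms is (1 + 1/n)^n / e.\<close>

definition tree_wt :: "nat \<Rightarrow> real" where
  "tree_wt n = real n * tree_egf $ n * tree_rad ^ n"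

lemma tree_rad_pos: "tree_rad > 0"
  by (simp add: tree_rad_def)

lemma tree_wt_0 [simp]: "tree_wt 0 = 0"
  by (simp add: tree_wt_def)

lemma tree_wt_pos: "n \<ge> 1 \<Longrightarrow> tree_wt n > 0"
  using tree_egf_pos tree_rad_pos by (simp add: tree_wt_def)

lemma tree_wt_nonneg: "tree_wt n \<ge> 0"
  by (cases "n = 0") (auto intro: less_imp_le[OF tree_wt_pos])

lemma tree_wt_Suc:
  assumes "n \<ge> 1"
  shows "tree_wt (Suc n) = tree_wt n * ((1 + 1 / real n) ^ n * exp (-1))"
proof -
  have a: "tree_wt m = (real m * exp (-1)) ^ m / (2 * fact m)" if m: "m \<ge> 1" for m
  proof -
    obtain k where k: "m = Suc k" using m by (cases m) auto
    have "(2 * real m) ^ m = 2 * real m * (2 * real m) ^ (m - 1)" using k by simp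
    then have "tree_wt m = (2 * real m) ^ m * tree_rad ^ m / (2 * fact m)"
      using m by (simp add: tree_wt_def tree_egf_nth)
    also have "(2 * real m) ^ m * tree_rad ^ m = (real m * exp (-1)) ^ m"
      unfolding power_mult_distrib[symmetric] by (simp add: tree_rad_def)
    finally show ?thesis .
  qed
  have "1 + 1 / real n = real (Suc n) / real n" using assms by (simp add: field_simps)
  then have "(real n * exp (-1)) ^ n * (1 + 1 / real n) ^ n = (real (Suc n) * exp (-1)) ^ n"
    unfolding power_mult_distrib[symmetric] using assms by (simp add: mult.commute del: of_nat_Suc)
  then have "tree_wt n * ((1 + 1 / real n) ^ n * exp (-1)) = (real (Suc n) * exp (-1)) ^ n * exp (-1) / (2 * fact n)"
    using assms by (simp add: a del: of_nat_Suc)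
  also have "\<dots> = tree_wt (Suc n)"
    by (subst a) (simp_all add: mult_ac del: of_nat_Suc)
  finally show ?thesis ..
qed

text \<open>Equivalent to (1 + 1/n)^(n+1) \<ge> e; it makes \<open>n * tree_wt n\<close>
  nondecreasing.\<close>

lemma euler_power_lower:
  fixes n :: nat
  assumes "n \<ge> 1"
  shows "real n \<le> real (Suc n) * ((1 + 1 / real n) ^ n * exp (-1))"
proof -
  have "exp (1 / real (Suc n)) \<le> 1 + 1 / real n"
  proof -
    have "1 - 1 / real (Suc n) \<le> exp (- (1 / real (Suc n)))"
      using exp_ge_add_one_self[of "- (1 / real (Suc n))"] by simp
    moreover have "1 - 1 / real (Suc n) = real n / real (Suc n)"
      by (simp add: field_simps)
    ultimately have "exp (1 / real (Suc n)) * (real n / real (Suc n)) \<le> exp (1 / real (Suc n)) * exp (- (1 / real (Suc n)))"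
      by (intro mult_left_mono) auto
    also have "\<dots> = 1" by (simp flip: exp_add)
    finally show ?thesis using assms by (simp add: field_simps)
  qed
  then have "exp (1 / real (Suc n)) ^ Suc n \<le> (1 + 1 / real n) ^ Suc n"
    by (intro power_mono) auto
  moreover have "exp (1 / real (Suc n)) ^ Suc n = exp 1"
    by (simp add: flip: exp_of_nat_mult del: of_nat_Suc power_Suc)
  ultimately have "exp 1 \<le> (1 + 1 / real n) ^ Suc n" by simp
  then have "exp 1 * exp (-1) \<le> (1 + 1 / real n) ^ Suc n * exp (-1 :: real)"
    by (intro mult_right_mono) auto
  then have "1 \<le> (1 + 1 / real n) * ((1 + 1 / real n) ^ n * exp (-1))"
    by (simp flip: exp_add add: mult_ac)
  then have "real n * 1 \<le> real n * ((1 + 1 / real n) * ((1 + 1 / real n) ^ n * exp (-1)))"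
    by (intro mult_left_mono) auto
  also have "\<dots> = (real n * (1 + 1 / real n)) * ((1 + 1 / real n) ^ n * exp (-1))"
    by (simp only: mult.assoc)
  also have "real n * (1 + 1 / real n) = real (Suc n)"
    using assms by (simp add: distrib_left)
  finally show ?thesis by simp
qed

text \<open>The true gain over (1 + 1/n)^n \<le> e is asymptotically 1 / (2 n). The constant 1/6 has
  the same order in n, and any positive constant makes the later telescoping work.\<close>

lemma euler_power_upper:
  fixes n :: nat
  assumes "n \<ge> 1"
  shows "(1 + 1 / real n) ^ n * exp (-1) * (1 + 1 / (6 * real n)) \<le> 1"
proof -
  define x where "x = 1 / real n"
  have x: "0 < x" "x \<le> 1" "real n * x = 1" using assms by (auto simp: x_def)
  \<comment> \<open>Chosen so that n y = 1 - x/6 leaves the desired gain, while y + y^2/2 still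
    reaches x because 25/72 \<ge> 1/6.\<close>
  define y where "y = x - x^2 / 6"
  have sq: "x^2 \<le> x" using x by (simp add: power2_eq_square mult_left_le)
  have y: "0 \<le> y" using x sq by (simp add: y_def)
  have "1 + x \<le> 1 + y + y^2 / 2"
  proof -
    have "5/6 * x \<le> y" using sq by (simp add: y_def)
    then have "(5/6 * x)^2 \<le> y^2" using x by (intro power_mono) auto
    then have "25/36 * x^2 \<le> y^2" by (simp add: power_mult_distrib power_divide)
    moreover have "x^2 \<ge> 0" by simp
    ultimately show ?thesis using y_def by linarith
  qed
  also have "\<dots> \<le> exp y" using exp_lower_Taylor_quadratic[OF y] .
  finally have "(1 + x) ^ n \<le> exp y ^ n" using x by (intro power_mono) auto
  also have "exp y ^ n = exp (1 - x / 6)"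
  proof -
    have "real n * y = 1 - x / 6"
      using x(3) unfolding y_def by (simp add: algebra_simps power2_eq_square)
    then show ?thesis by (simp flip: exp_of_nat_mult)
  qed
  finally have "(1 + x) ^ n * exp (-1) * (1 + x / 6) \<le> exp (1 - x / 6) * exp (-1) * exp (x / 6)"
    using x exp_ge_add_one_self[of "x/6"] by (intro mult_mono) auto
  also have "\<dots> = 1" by (simp flip: exp_add)
  finally show ?thesis by (simp add: x_def mult.commute)
qed

lemma tree_wt_decreasing:
  assumes "n \<ge> 1"
  shows "tree_wt (Suc n) * (1 + 1 / (6 * real n)) \<le> tree_wt n"
proof -
  have "tree_wt (Suc n) * (1 + 1 / (6 * real n))
      = tree_wt n * ((1 + 1 / real n) ^ n * exp (-1) * (1 + 1 / (6 * real n)))"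
    by (simp add: tree_wt_Suc[OF assms] mult_ac)
  also have "\<dots> \<le> tree_wt n * 1"
    using euler_power_upper[OF assms] tree_wt_nonneg by (intro mult_left_mono) auto
  finally show ?thesis by simp
qed

text \<open>This bounds \<open>tree_wt m / tree_wt n\<close> by n / m, hence by 2 whenever m is at
  least n / 2.\<close>

lemma tree_wt_mult_mono:
  assumes "m \<le> n"
  shows "real m * tree_wt m \<le> real n * tree_wt n"
proof -
  have "real n * tree_wt n \<le> real (Suc n) * tree_wt (Suc n)" for n
  proof (cases "n = 0")
    case False
    then have n: "n \<ge> 1" by simp
    have "real n * tree_wt n \<le> (real (Suc n) * ((1 + 1 / real n) ^ n * exp (-1))) * tree_wt n"
      using euler_power_lower[OF n] tree_wt_nonneg by (intro mult_right_mono) auto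
    then show ?thesis by (simp add: tree_wt_Suc[OF n] mult_ac)
  qed (simp add: tree_wt_nonneg)
  then show ?thesis using assms by (rule lift_Suc_mono_le)
qed

lemma tree_wt_div: "tree_wt n / real n = tree_egf $ n * tree_rad ^ n"
  by (cases "n = 0") (auto simp: tree_wt_def)

text \<open>The decrement of \<open>tree_wt\<close> at n is at least
  \<open>tree_wt (Suc n) / (6 * n)\<close>, so the series of \<open>tree_wt n / n\<close> is
  dominated by a telescoping one.\<close>

lemma summable_tree_egf: "summable (\<lambda>n. tree_egf $ n * tree_rad ^ n)"
proof -
  define f where "f n = tree_wt (Suc n)" for n
  have dec: "tree_wt (Suc n) \<le> tree_wt n" if "n \<ge> 1" for n
  proof -
    have "tree_wt (Suc n) * 1 \<le> tree_wt (Suc n) * (1 + 1 / (6 * real n))"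
      using tree_wt_nonneg by (intro mult_left_mono) auto
    then show ?thesis using tree_wt_decreasing[OF that] by simp
  qed
  have "decseq f" by (intro decseq_SucI) (auto simp: f_def dec)
  moreover have "\<forall>i. 0 \<le> f i" by (simp add: f_def tree_wt_nonneg)
  ultimately obtain l where "f \<longlonglongrightarrow> l"
    using decseq_convergent[of f 0] by blast
  then have "summable (\<lambda>n. f n - f (Suc n))"
    using telescope_sums'[of f l] sums_summable by blast
  then have s: "summable (\<lambda>n. 6 * (f n - f (Suc n)))" by (rule summable_mult)
  have "summable (\<lambda>n. tree_wt (Suc (Suc n)) / real (Suc (Suc n)))"
  proof (rule summable_comparison_test'[OF s])
    fix n :: nat
    have "tree_wt (Suc (Suc n)) / real (Suc (Suc n)) \<le> tree_wt (Suc (Suc n)) / real (Suc n)"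
      using tree_wt_nonneg by (intro divide_left_mono) auto
    also have "\<dots> \<le> 6 * (f n - f (Suc n))"
      using tree_wt_decreasing[of "Suc n"] by (simp add: f_def field_simps del: of_nat_Suc)
    finally show "norm (tree_wt (Suc (Suc n)) / real (Suc (Suc n))) \<le> 6 * (f n - f (Suc n))"
      using tree_wt_nonneg[of "Suc (Suc n)"] by simp
  qed
  then show ?thesis
    unfolding tree_wt_div
    using summable_iff_shift[of "\<lambda>n. tree_egf $ n * tree_rad ^ n" 2] by simp
qed

lemma tree_wt_ratio_tendsto: "(\<lambda>n. tree_wt (n - j) / tree_wt n) \<longlonglongrightarrow> 1"
proof (induction j)
  case 0
  have "eventually (\<lambda>n. tree_wt (n - 0) / tree_wt n = 1) sequentially"
    using eventually_ge_at_top[of 1] by eventually_elim (use tree_wt_pos in force)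
  then show ?case by (rule tendsto_eventually)
next
  case (Suc j)
  have "(\<lambda>n. inverse ((1 + 1 / real n) ^ n * exp (-1))) \<longlonglongrightarrow> inverse (exp 1 * exp (-1))"
    by (intro tendsto_intros tendsto_exp_limit_sequentially) auto
  then have "(\<lambda>n. inverse ((1 + 1 / real n) ^ n * exp (-1))) \<longlonglongrightarrow> 1"
    by (simp flip: exp_add)
  then have l: "(\<lambda>n. inverse ((1 + 1 / real (n - Suc j)) ^ (n - Suc j) * exp (-1))) \<longlonglongrightarrow> 1"
    by (rule filterlim_compose) (rule filterlim_minus_const_nat_at_top)
  have m1: "(\<lambda>n. (tree_wt (n - j) / tree_wt n) * inverse ((1 + 1 / real (n - Suc j)) ^ (n - Suc j) * exp (-1))) \<longlonglongrightarrow> 1 * 1"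
    by (intro tendsto_mult Suc.IH l)
  have m2: "eventually (\<lambda>n. (tree_wt (n - j) / tree_wt n) * inverse ((1 + 1 / real (n - Suc j)) ^ (n - Suc j) * exp (-1)) = tree_wt (n - Suc j) / tree_wt n) sequentially"
    using eventually_ge_at_top[of "j + 2"]
  proof eventually_elim
    case (elim n)
    define m where "m = n - Suc j"
    have m: "n - j = Suc m" "m \<ge> 1" using elim by (auto simp: m_def)
    define q where "q = (1 + 1 / real m) ^ m * exp (-1)"
    have "0 < q"
      unfolding q_def by (intro mult_pos_pos zero_less_power add_pos_nonneg) auto
    moreover have "tree_wt (n - j) = tree_wt m * q"
      unfolding m(1) q_def by (rule tree_wt_Suc[OF m(2)])
    ultimately show ?case
      unfolding m_def[symmetric] q_def[symmetric] by simp
  qed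
  show ?case using Lim_transform_eventually[OF m1 m2] by simp
qed

section \<open>Dominated convergence and convolutions with slowly varying weights\<close>

lemma tannery_nat:
  fixes a :: "nat \<Rightarrow> nat \<Rightarrow> real"
  assumes "\<And>k. (\<lambda>n. a k n) \<longlonglongrightarrow> b k" "\<And>k n. n \<ge> 1 \<Longrightarrow> \<bar>a k n\<bar> \<le> M k" "summable M"
    and z: "\<And>k n. k > n \<Longrightarrow> a k n = 0"
  shows "(\<lambda>n. \<Sum>k\<le>n. a k n) \<longlonglongrightarrow> suminf b"
proof -
  have "eventually (\<lambda>(k,n). norm (a k n) \<le> M k) (at_top \<times>\<^sub>F sequentially)"
    unfolding eventually_prod_filter
    by (rule exI[of _ "\<lambda>_. True"], rule exI[of _ "\<lambda>n. n \<ge> 1"])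
      (use assms(2) eventually_ge_at_top in auto)
  then have "(\<lambda>n. suminf (\<lambda>k. a k n)) \<longlonglongrightarrow> suminf b"
    using tannerys_theorem[OF assms(1) _ assms(3)] by simp
  moreover have "suminf (\<lambda>k. a k n) = (\<Sum>k\<le>n. a k n)" for n
    by (rule suminf_finite) (auto intro: z)
  ultimately show ?thesis by simp
qed

text \<open>The sum is split at j = n / 2. In the lower half
  \<open>tree_wt (n - j) / tree_wt n\<close> is at most 2 and tends to 1, so dominated convergence
  applies. In the upper half \<open>tree_wt j\<close> is the factor comparable with
  \<open>tree_wt n\<close>, and the remaining 1 / j \<le> 2 / n forces the contribution to
  0.\<close>

lemma tree_wt_convolution_tendsto:
  fixes w :: "nat \<Rightarrow> real"
  assumes w: "\<And>j. j \<ge> 1 \<Longrightarrow> \<bar>w j\<bar> \<le> C * (tree_wt j / real j)"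
  shows "(\<lambda>n. (\<Sum>j\<le>n. w j * tree_wt (n - j)) / tree_wt n) \<longlonglongrightarrow> (\<Sum>j. w j)" and "summable (\<lambda>j. \<bar>w j\<bar>)"
proof -
  have "summable (\<lambda>j. C * (tree_wt j / real j))"
    unfolding tree_wt_div by (intro summable_mult summable_tree_egf)
  then show sw: "summable (\<lambda>j. \<bar>w j\<bar>)"
    by (rule summable_comparison_test'[where N = 1]) (use w in auto)
  have C: "C \<ge> 0"
  proof -
    have "0 \<le> C * (tree_wt 1 / real 1)" using w[of 1] by simp
    then show ?thesis using tree_wt_pos[of 1] by (simp add: zero_le_mult_iff)
  qed
  define a where "a j n = (if 2 * j \<le> n then w j * (tree_wt (n - j) / tree_wt n) else 0)" for j n
  have 1: "(\<lambda>n. \<Sum>j\<le>n. a j n) \<longlonglongrightarrow> suminf w"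
  proof (rule tannery_nat[where M = "\<lambda>j. 2 * \<bar>w j\<bar>"])
    fix j
    have "(\<lambda>n. w j * (tree_wt (n - j) / tree_wt n)) \<longlonglongrightarrow> w j * 1"
      by (intro tendsto_intros tree_wt_ratio_tendsto)
    moreover have "eventually (\<lambda>n. w j * (tree_wt (n - j) / tree_wt n) = a j n) sequentially"
      using eventually_ge_at_top[of "2 * j"] by eventually_elim (auto simp: a_def)
    ultimately show "(\<lambda>n. a j n) \<longlonglongrightarrow> w j" by (simp add: tendsto_cong)
  next
    fix j n :: nat assume n: "n \<ge> 1"
    show "\<bar>a j n\<bar> \<le> 2 * \<bar>w j\<bar>"
    proof (cases "2 * j \<le> n")
      case True
      have "real (n - j) * tree_wt (n - j) \<le> real n * tree_wt n"
        by (rule tree_wt_mult_mono) simp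
      also have "\<dots> \<le> (2 * real (n - j)) * tree_wt n"
        using True tree_wt_nonneg by (intro mult_right_mono) (auto simp: of_nat_diff)
      finally have "real (n - j) * tree_wt (n - j) \<le> real (n - j) * (2 * tree_wt n)" by (simp add: mult_ac)
      then have "tree_wt (n - j) \<le> 2 * tree_wt n"
        using True n by (subst (asm) mult_le_cancel_left) auto
      then have "tree_wt (n - j) / tree_wt n \<le> 2"
        using tree_wt_pos[OF n] by (simp add: field_simps)
      then have "\<bar>w j\<bar> * (tree_wt (n - j) / tree_wt n) \<le> \<bar>w j\<bar> * 2"
        by (intro mult_left_mono) auto
      then show ?thesis using True tree_wt_nonneg by (simp add: a_def abs_mult)
    qed (simp add: a_def)
  qed (auto simp: a_def intro: summable_mult sw)
  \<comment> \<open>The sum of \<open>tree_wt i\<close> over i \<le> n, divided by n, tends to 0,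
    again by dominated convergence with the summable majorant \<open>tree_wt i / i\<close>. It
    bounds the upper half of the convolution.\<close>
  define c where "c i n = (if i \<le> n then tree_wt i / real n else 0)" for i n :: nat
  have "(\<lambda>n. \<Sum>i\<le>n. c i n) \<longlonglongrightarrow> (\<Sum>i. 0)"
  proof (rule tannery_nat[where M = "\<lambda>i. tree_wt i / real i"])
    fix i
    have "(\<lambda>n. tree_wt i / real n) \<longlonglongrightarrow> 0" by real_asymp
    moreover have "eventually (\<lambda>n. tree_wt i / real n = c i n) sequentially"
      using eventually_ge_at_top[of i] by eventually_elim (auto simp: c_def)
    ultimately show "(\<lambda>n. c i n) \<longlonglongrightarrow> 0" by (simp add: tendsto_cong)
  next
    fix i n :: nat
    show "\<bar>c i n\<bar> \<le> tree_wt i / real i"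
      using tree_wt_nonneg[of i] by (cases "i = 0") (auto simp: c_def intro!: divide_left_mono)
  next
    show "summable (\<lambda>i. tree_wt i / real i)"
      unfolding tree_wt_div by (rule summable_tree_egf)
  qed (auto simp: c_def)
  then have c0: "(\<lambda>n. \<Sum>i\<le>n. c i n) \<longlonglongrightarrow> 0" by simp
  have 2: "(\<lambda>n. (\<Sum>j\<le>n. w j * tree_wt (n - j)) / tree_wt n - (\<Sum>j\<le>n. a j n)) \<longlonglongrightarrow> 0"
  proof (rule Lim_null_comparison)
    show "(\<lambda>n. 4 * C * (\<Sum>i\<le>n. c i n)) \<longlonglongrightarrow> 0"
      using tendsto_mult[OF tendsto_const c0, of "4 * C"] by simp
    show "eventually (\<lambda>n. norm ((\<Sum>j\<le>n. w j * tree_wt (n - j)) / tree_wt n - (\<Sum>j\<le>n. a j n)) \<le> 4 * C * (\<Sum>i\<le>n. c i n)) sequentially"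
      using eventually_ge_at_top[of 1]
    proof eventually_elim
      case (elim n)
      have "(\<Sum>j\<le>n. w j * tree_wt (n - j)) / tree_wt n - (\<Sum>j\<le>n. a j n)
          = (\<Sum>j\<le>n. w j * (tree_wt (n - j) / tree_wt n) - a j n)"
        by (simp add: sum_divide_distrib sum_subtractf)
      also have "norm \<dots> \<le> (\<Sum>j\<le>n. \<bar>w j * (tree_wt (n - j) / tree_wt n) - a j n\<bar>)"
        using sum_abs by simp
      also have "\<dots> \<le> (\<Sum>j\<le>n. 4 * C * c (n - j) n)"
      proof (rule sum_mono)
        fix j assume j: "j \<in> {..n}"
        show "\<bar>w j * (tree_wt (n - j) / tree_wt n) - a j n\<bar> \<le> 4 * C * c (n - j) n"
        proof (cases "2 * j \<le> n")
          case True
          then show ?thesis using C tree_wt_nonneg by (simp add: a_def c_def)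
        next
          case False
          then have j': "n < 2 * j" "1 \<le> j" "j \<le> n" using j by auto
          have "real j * tree_wt j \<le> real n * tree_wt n" using j' by (intro tree_wt_mult_mono)
          then have "tree_wt j / tree_wt n \<le> real n / real j"
            using j' tree_wt_pos[OF elim] by (simp add: field_simps)
          also have "\<dots> \<le> 2" using j' by (simp add: field_simps)
          finally have r: "tree_wt j / tree_wt n \<le> 2" .
          have "\<bar>w j * (tree_wt (n - j) / tree_wt n) - a j n\<bar> = \<bar>w j\<bar> * (tree_wt (n - j) / tree_wt n)"
            using False tree_wt_nonneg by (simp add: a_def abs_mult)
          also have "\<dots> \<le> (C * (tree_wt j / real j)) * (tree_wt (n - j) / tree_wt n)"
            using w[OF j'(2)] tree_wt_nonneg by (intro mult_right_mono) auto
          \<comment> \<open>The two weights exchange roles: \<open>tree_wt j\<close> is now compared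
            with \<open>tree_wt n\<close>.\<close>
          also have "\<dots> = C * (tree_wt (n - j) / real j) * (tree_wt j / tree_wt n)" by simp
          also have "\<dots> \<le> C * (tree_wt (n - j) / real j) * 2"
            using C tree_wt_nonneg by (intro mult_left_mono r) auto
          also have "\<dots> \<le> C * (tree_wt (n - j) / (real n / 2)) * 2"
            using C tree_wt_nonneg j' by (intro mult_right_mono mult_left_mono divide_left_mono) auto
          also have "\<dots> = 4 * C * c (n - j) n" by (simp add: c_def)
          finally show ?thesis .
        qed
      qed
      also have "\<dots> = (\<Sum>i\<le>n. 4 * C * c i n)"
        by (rule sum.reindex_bij_witness[of _ "\<lambda>i. n - i" "\<lambda>i. n - i"]) auto
      finally show ?case by (simp add: sum_distrib_left)
    qed
  qed
  show "(\<lambda>n. (\<Sum>j\<le>n. w j * tree_wt (n - j)) / tree_wt n) \<longlonglongrightarrow> (\<Sum>j. w j)"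
    using tendsto_add[OF 2 1] by simp
qed

section \<open>Values of powers and compositions at a nonnegative point\<close>

lemma fps_power_sums:
  fixes U :: "real fps"
  assumes U: "\<And>n. 0 \<le> U $ n" and s: "(\<lambda>n. U $ n * r ^ n) sums u" and r: "r \<ge> 0"
  shows "(\<lambda>n. (U ^ i) $ n * r ^ n) sums (u ^ i)"
proof (induction i)
  case 0
  have "(\<lambda>n. (U ^ 0) $ n * r ^ n) = (\<lambda>n. if n = 0 then 1 else 0)" by auto
  then show ?case using sums_single[of 0 "\<lambda>_. 1::real"] by (simp add: eq_commute)
next
  case (Suc i)
  have nn: "0 \<le> (U ^ i) $ n" for n
    using fps_power_nth_mono[of U U i n] U by simp
  have "(\<lambda>k. \<Sum>j\<le>k. (U $ j * r ^ j) * ((U ^ i) $ (k - j) * r ^ (k - j))) sums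
      ((\<Sum>n. U $ n * r ^ n) * (\<Sum>n. (U ^ i) $ n * r ^ n))"
    using U nn r s Suc by (intro Cauchy_product_sums) (auto simp: abs_mult sums_iff)
  moreover have "(\<Sum>j\<le>k. (U $ j * r ^ j) * ((U ^ i) $ (k - j) * r ^ (k - j))) = (U ^ Suc i) $ k * r ^ k" for k
    unfolding power_Suc fps_mult_nth sum_distrib_right atLeast0AtMost
  proof (rule sum.cong)
    fix j assume "j \<in> {..k}"
    then have "r ^ k = r ^ j * r ^ (k - j)" by (simp flip: power_add)
    then show "(U $ j * r ^ j) * ((U ^ i) $ (k - j) * r ^ (k - j)) = U $ j * (U ^ i) $ (k - j) * r ^ k"
      by simp
  qed simp
  ultimately show ?case using s Suc by (simp add: sums_iff)
qed

text \<open>Since U has nonnegative coefficients, summing the norms over n gives |A_i| u^i. So the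
  double series is absolutely summable, which permits exchanging the order of summation.\<close>

lemma fps_compose_sums:
  fixes A U :: "real fps"
  assumes U: "\<And>n. 0 \<le> U $ n" "U $ 0 = 0" and s: "(\<lambda>n. U $ n * r ^ n) sums u" and r: "r \<ge> 0"
    and A: "summable (\<lambda>i. \<bar>A $ i\<bar> * u ^ i)"
  shows "(\<lambda>n. (A oo U) $ n * r ^ n) sums (\<Sum>i. A $ i * u ^ i)"
proof -
  define f where "f = (\<lambda>(i, n). A $ i * ((U ^ i) $ n * r ^ n))"
  have u: "u \<ge> 0" using s U r by (auto simp: sums_iff intro!: suminf_nonneg)
  have nn: "0 \<le> (U ^ i) $ n" for i n
    using fps_power_nth_mono[of U U i n] U by simp
  have hs: "((\<lambda>n. (U ^ i) $ n * r ^ n) has_sum u ^ i) UNIV" for i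
    using fps_power_sums[OF U(1) s r] nn r by (intro sums_nonneg_imp_has_sum) auto
  have hf: "((\<lambda>n. f (i, n)) has_sum (A $ i * u ^ i)) UNIV" for i
    unfolding f_def prod.case by (intro has_sum_cmult_right hs)
  have hn: "((\<lambda>n. norm (f (i, n))) has_sum (\<bar>A $ i\<bar> * u ^ i)) UNIV" for i
  proof -
    have "norm (f (i, n)) = \<bar>A $ i\<bar> * ((U ^ i) $ n * r ^ n)" for n
      using nn r by (simp add: f_def abs_mult)
    then show ?thesis by (simp only: has_sum_cmult_right hs)
  qed
  have "(\<lambda>x. norm (f x)) summable_on (UNIV \<times> UNIV)"
    unfolding Infinite_Sum.abs_summable_on_Sigma_iff
  proof (intro conjI ballI)
    show "(\<lambda>y. norm (f (i, y))) summable_on UNIV" for i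
      using hn[of i] by (auto simp: summable_on_def)
    have eq: "(\<Sum>\<^sub>\<infinity>n. norm (f (i, n))) = \<bar>A $ i\<bar> * u ^ i" for i
      using hn by (rule infsumI)
    show "(\<lambda>i. norm (\<Sum>\<^sub>\<infinity>n. norm (f (i, n)))) summable_on UNIV"
      unfolding eq using A u by (auto intro!: norm_summable_imp_summable_on simp: abs_mult)
  qed
  then have sm: "f summable_on (UNIV \<times> UNIV)" by (rule abs_summable_summable)
  have "((\<lambda>i. A $ i * u ^ i) has_sum (\<Sum>i. A $ i * u ^ i)) UNIV"
  proof (rule norm_summable_imp_has_sum)
    show 1: "summable (\<lambda>n. norm (A $ n * u ^ n))" using A u by (simp add: abs_mult)
    show "(\<lambda>i. A $ i * u ^ i) sums (\<Sum>i. A $ i * u ^ i)"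
      using summable_norm_cancel[OF 1] by (rule summable_sums)
  qed
  then have "(f has_sum (\<Sum>i. A $ i * u ^ i)) (UNIV \<times> UNIV)"
    by (intro has_sum_SigmaI[OF _ _ sm]) (auto intro: hf)
  then have sw: "((\<lambda>(n, i). f (i, n)) has_sum (\<Sum>i. A $ i * u ^ i)) (UNIV \<times> UNIV)"
    by (subst (asm) has_sum_swap)
  have "((\<lambda>n. (A oo U) $ n * r ^ n) has_sum (\<Sum>i. A $ i * u ^ i)) UNIV"
  proof (rule has_sum_SigmaD[OF sw])
    fix n
    have "((\<lambda>i. f (i, n)) has_sum (\<Sum>i\<in>{0..n}. f (i, n))) UNIV"
      by (rule has_sum_finite_neutralI) (auto simp: f_def fps_power_nth_eq_0[OF U(2)])
    also have "(\<Sum>i\<in>{0..n}. f (i, n)) = (A oo U) $ n * r ^ n"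
      by (simp add: f_def fps_compose_nth sum_distrib_left mult_ac)
    finally show "((\<lambda>i. case (n, i) of (n, i) \<Rightarrow> f (i, n)) has_sum (A oo U) $ n * r ^ n) UNIV" by simp
  qed
  then show ?thesis by (rule has_sum_imp_sums)
qed

lemma summable_exp_coeffs: "summable (\<lambda>i. \<bar>fps_exp c $ i\<bar> * u ^ i)" if "u \<ge> 0" for c u :: real
proof -
  have "summable (\<lambda>i. inverse (fact i) * (\<bar>c\<bar> * u) ^ i)"
    by (rule summable_exp)
  then show ?thesis by (simp add: power_mult_distrib field_simps power_abs)
qed

lemma suminf_exp_coeffs: "(\<Sum>i. fps_exp c $ i * u ^ i) = exp (c * u)" for c u :: real
  by (simp add: exp_def scaleR_conv_of_real power_mult_distrib field_simps)

lemma tree_egf_sums: "(\<lambda>n. tree_egf $ n * tree_rad ^ n) sums (1 / 2)"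
proof -
  define t where "t = (\<Sum>n. tree_egf $ n * tree_rad ^ n)"
  have t: "(\<lambda>n. tree_egf $ n * tree_rad ^ n) sums t"
    using summable_tree_egf by (simp add: t_def summable_sums)
  have t0: "t \<ge> 0" using summable_tree_egf tree_egf_nonneg tree_rad_pos
    unfolding t_def by (intro suminf_nonneg) auto
  have "(\<lambda>n. (fps_exp 2 oo tree_egf) $ n * tree_rad ^ n) sums exp (2 * t)"
    unfolding suminf_exp_coeffs[symmetric]
    using t tree_egf_nonneg tree_rad_pos t0 by (intro fps_compose_sums summable_exp_coeffs) auto
  then have "(\<lambda>n. tree_rad * ((fps_exp 2 oo tree_egf) $ n * tree_rad ^ n)) sums (tree_rad * exp (2 * t))"
    by (rule sums_mult)
  moreover have "tree_rad * ((fps_exp 2 oo tree_egf) $ n * tree_rad ^ n) = tree_egf $ Suc n * tree_rad ^ Suc n" for n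
    by (subst (2) tree_egf_eq) simp
  ultimately have "(\<lambda>n. tree_egf $ Suc n * tree_rad ^ Suc n) sums (tree_rad * exp (2 * t))"
    by (simp only:)
  then have "(\<lambda>n. tree_egf $ n * tree_rad ^ n) sums (tree_rad * exp (2 * t))"
    by (subst (asm) sums_Suc_iff) simp
  then have "t = tree_rad * exp (2 * t)" using t sums_unique2 by blast
  then have "1 + (2 * t - 1) = exp (2 * t - 1)"
    by (simp add: tree_rad_def exp_diff exp_minus field_simps)
  then have e: "exp (2 * t - 1) = 2 * t" by simp
  then have "ln (2 * t) = 2 * t - 1" using ln_exp[of "2 * t - 1"] by simp
  then have "2 * t - 1 = 0"
    using ln_eq_minus_one[of "2 * t"] exp_gt_zero[of "2 * t - 1"] e by simp
  then have "t = 1 / 2" by simp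
  then show ?thesis using t by (simp only:)
qed

lemma red_egf_sums:
  assumes R: "\<And>n. 0 \<le> red_egf $ n" "\<And>n. red_egf $ n \<le> tree_egf $ n"
  obtains l where "(\<lambda>n. red_egf $ n * tree_rad ^ n) sums l" "2 * l = exp (- l)"
proof -
  have s: "summable (\<lambda>n. red_egf $ n * tree_rad ^ n)"
    by (rule summable_comparison_test'[OF summable_tree_egf])
       (use R tree_rad_pos in \<open>auto simp: abs_mult intro!: mult_right_mono\<close>)
  define l where "l = (\<Sum>n. red_egf $ n * tree_rad ^ n)"
  have l: "(\<lambda>n. red_egf $ n * tree_rad ^ n) sums l" using s by (simp add: l_def summable_sums)
  have l0: "l \<ge> 0" unfolding l_def using s R tree_rad_pos by (intro suminf_nonneg) auto
  have e: "(\<lambda>n. (fps_exp 1 oo red_egf) $ n * tree_rad ^ n) sums exp (1 * l)"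
    unfolding suminf_exp_coeffs[symmetric]
    using l R tree_rad_pos l0 by (intro fps_compose_sums summable_exp_coeffs) auto
  have en: "0 \<le> (fps_exp 1 oo red_egf) $ n" for n
    unfolding fps_compose_nth using fps_power_nth_mono[of red_egf red_egf _ n] R
    by (intro sum_nonneg mult_nonneg_nonneg) auto
  have "(\<lambda>k. \<Sum>j\<le>k. (red_egf $ j * tree_rad ^ j) * ((fps_exp 1 oo red_egf) $ (k - j) * tree_rad ^ (k - j))) sums
      ((\<Sum>n. red_egf $ n * tree_rad ^ n) * (\<Sum>n. (fps_exp 1 oo red_egf) $ n * tree_rad ^ n))"
    using R en tree_rad_pos l e by (intro Cauchy_product_sums) (auto simp: abs_mult sums_iff)
  moreover have "(\<Sum>j\<le>k. (red_egf $ j * tree_rad ^ j) * ((fps_exp 1 oo red_egf) $ (k - j) * tree_rad ^ (k - j))) = tree_egf $ k * tree_rad ^ k" for k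
    unfolding red_egf_eq[symmetric] fps_mult_nth sum_distrib_right atLeast0AtMost
  proof (rule sum.cong)
    fix j assume "j \<in> {..k}"
    then have "tree_rad ^ k = tree_rad ^ j * tree_rad ^ (k - j)" by (simp flip: power_add)
    then show "(red_egf $ j * tree_rad ^ j) * ((fps_exp 1 oo red_egf) $ (k - j) * tree_rad ^ (k - j)) = red_egf $ j * (fps_exp 1 oo red_egf) $ (k - j) * tree_rad ^ k"
      by simp
  qed simp
  ultimately have "(\<lambda>k. tree_egf $ k * tree_rad ^ k) sums (l * exp l)"
    using l e by (simp add: sums_iff)
  then have "l * exp l = 1 / 2" using tree_egf_sums sums_unique2 by blast
  then have "2 * l = exp (- l)" by (simp add: exp_minus field_simps)
  then show ?thesis using that l by blast
qed

text \<open>The convolution lemma for \<open>w n\<close>, the scaled coefficients of A(U): their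
  bound by a multiple of the scaled coefficients of T is exactly its hypothesis, and their total is
  A(u).\<close>

lemma convolution_compose_tendsto:
  fixes A U :: "real fps"
  assumes U: "\<And>n. 0 \<le> U $ n" "\<And>n. U $ n \<le> tree_egf $ n"
    and s: "(\<lambda>n. U $ n * tree_rad ^ n) sums u"
    and A: "summable (\<lambda>i. \<bar>A $ i\<bar> * (real i * (1/2) ^ i))"
  shows "(\<lambda>n. (fps_X * fps_deriv tree_egf * (A oo U)) $ n / (real n * tree_egf $ n)) \<longlonglongrightarrow> (\<Sum>i. A $ i * u ^ i)"
proof -
  have U0: "U $ 0 = 0" using U[of 0] by simp
  have "0 \<le> u"
    by (rule sums_le[OF _ sums_zero s]) (use U tree_rad_pos in auto)
  moreover have "u \<le> 1/2"
    by (rule sums_le[OF _ s tree_egf_sums]) (use U tree_rad_pos in \<open>auto intro!: mult_right_mono\<close>)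
  ultimately have u: "0 \<le> u" "u \<le> 1/2" by auto
  define C where "C = 2 * (\<Sum>i. \<bar>A $ i\<bar> * (real i * (1/2) ^ i))"
  define w where "w n = (A oo U) $ n * tree_rad ^ n" for n
  have w: "\<bar>w j\<bar> \<le> C * (tree_wt j / real j)" if "j \<ge> 1" for j
  proof -
    have "\<bar>w j\<bar> = \<bar>(A oo U) $ j\<bar> * tree_rad ^ j" using tree_rad_pos by (simp add: w_def abs_mult)
    also have "\<dots> \<le> (C * tree_egf $ j) * tree_rad ^ j"
      using fps_compose_nth_bound[OF U A that] tree_rad_pos unfolding C_def
      by (intro mult_right_mono) auto
    finally show ?thesis by (simp add: tree_wt_div)
  qed
  have As: "summable (\<lambda>i. \<bar>A $ i\<bar> * u ^ i)"
  proof (rule summable_comparison_test'[OF A, where N = 1])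
    fix i :: nat assume i: "i \<ge> 1"
    have "u ^ i \<le> (1/2) ^ i" using u by (intro power_mono)
    also have "\<dots> \<le> real i * (1/2) ^ i" using i by simp
    finally show "norm (\<bar>A $ i\<bar> * u ^ i) \<le> \<bar>A $ i\<bar> * (real i * (1/2) ^ i)"
      using u by (simp add: mult_left_mono abs_mult)
  qed
  have "w sums (\<Sum>i. A $ i * u ^ i)"
    unfolding w_def using U U0 s As tree_rad_pos by (intro fps_compose_sums) auto
  then have l: "(\<lambda>n. (\<Sum>j\<le>n. w j * tree_wt (n - j)) / tree_wt n) \<longlonglongrightarrow> (\<Sum>i. A $ i * u ^ i)"
    using tree_wt_convolution_tendsto(1)[OF w] by (simp add: sums_iff)
  have "(\<Sum>j\<le>n. w j * tree_wt (n - j)) / tree_wt n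
      = (fps_X * fps_deriv tree_egf * (A oo U)) $ n / (real n * tree_egf $ n)" for n
  proof -
    have "(\<Sum>j\<le>n. w j * tree_wt (n - j)) = (\<Sum>j\<le>n. (A oo U) $ j * (real (n - j) * tree_egf $ (n - j)) * tree_rad ^ n)"
    proof (rule sum.cong)
      fix j assume "j \<in> {..n}"
      then have "tree_rad ^ n = tree_rad ^ j * tree_rad ^ (n - j)" by (simp flip: power_add)
      then show "w j * tree_wt (n - j) = (A oo U) $ j * (real (n - j) * tree_egf $ (n - j)) * tree_rad ^ n"
        by (simp add: w_def tree_wt_def)
    qed simp
    also have "\<dots> = ((A oo U) * (fps_X * fps_deriv tree_egf)) $ n * tree_rad ^ n"
      unfolding fps_mult_nth[of "A oo U"] fps_X_deriv_nth sum_distrib_right atLeast0AtMost ..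
    finally show ?thesis using tree_rad_pos by (simp add: tree_wt_def mult.commute)
  qed
  then show ?thesis using l by simp
qed

section \<open>Sums over circuit lengths\<close>

lemma weighted_power_sum_nth:
  fixes U B :: "real fps"
  assumes "U $ 0 = 0"
  shows "(fps_X * fps_deriv U * (B oo U)) $ n = (\<Sum>i\<le>n. B $ i * (real n * (U ^ Suc i) $ n / real (Suc i)))"
proof -
  have "(fps_X * fps_deriv U * (B oo U)) $ n
      = (\<Sum>j\<le>n. (\<Sum>i\<le>n. B $ i * (U ^ i) $ j) * (fps_X * fps_deriv U) $ (n - j))"
  proof -
    have "(B oo U) $ j = (\<Sum>i\<le>n. B $ i * (U ^ i) $ j)" if "j \<le> n" for j
      unfolding fps_compose_nth using that
      by (intro sum.mono_neutral_left) (auto simp: fps_power_nth_eq_0[OF assms])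
    then show ?thesis
      by (subst mult.commute) (simp add: fps_mult_nth[of "B oo U"] atLeast0AtMost)
  qed
  also have "\<dots> = (\<Sum>i\<le>n. B $ i * (U ^ i * (fps_X * fps_deriv U)) $ n)"
    unfolding fps_mult_nth[of "U ^ _"] sum_distrib_left sum_distrib_right atLeast0AtMost
    by (subst sum.swap) (simp add: mult_ac)
  also have "\<dots> = (\<Sum>i\<le>n. B $ i * (real n * (U ^ Suc i) $ n / real (Suc i)))"
  proof (rule sum.cong)
    fix i
    \<comment> \<open>The derivative of U^(i+1) is what brings in the division by the circuit length
      i + 1.\<close>
    have "fps_X * fps_deriv (U ^ Suc i) = fps_const (real (Suc i)) * (U ^ i * (fps_X * fps_deriv U))"
      using fps_deriv_power[of U "Suc i"] by (simp only: diff_Suc_1 mult_ac)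
    then have "(fps_X * fps_deriv (U ^ Suc i)) $ n = real (Suc i) * (U ^ i * (fps_X * fps_deriv U)) $ n"
      by (simp only: fps_mult_left_const_nth)
    then have "(U ^ i * (fps_X * fps_deriv U)) $ n = real n * (U ^ Suc i) $ n / real (Suc i)"
      unfolding fps_X_deriv_nth by (simp add: field_simps del: of_nat_Suc power_Suc)
    then show "B $ i * (U ^ i * (fps_X * fps_deriv U)) $ n = B $ i * (real n * (U ^ Suc i) $ n / real (Suc i))"
      by simp
  qed simp
  finally show ?thesis .
qed

lemma fps_conv_radius_bounded:
  fixes A :: "real fps"
  assumes "\<And>i. \<bar>A $ i\<bar> \<le> 1"
  shows "fps_conv_radius A \<ge> 1"
  unfolding fps_conv_radius_def
proof (rule conv_radius_geI_ex')
  fix r :: real assume r: "0 < r" "ereal r < 1"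
  then have "summable (\<lambda>n. r ^ n)" by (intro summable_geometric) auto
  then show "summable (\<lambda>n. A $ n * of_real r ^ n)"
    by (rule summable_comparison_test'[where N = 0])
       (use r assms in \<open>auto simp: abs_mult intro!: mult_left_le_one_le\<close>)
qed

text \<open>Up to a shift and the factor 1/2, this is the series of A' at the point 1/2, which lies
  inside the disc of convergence.\<close>

lemma summable_half_deriv:
  fixes A :: "real fps"
  assumes "fps_conv_radius A \<ge> 1"
  shows "summable (\<lambda>i. \<bar>A $ i\<bar> * (real i * (1/2) ^ i))"
proof -
  have "ereal (norm (1/2 :: real)) < 1" by simp
  also have "1 \<le> fps_conv_radius (fps_deriv A)"
    using assms fps_conv_radius_deriv[of A] by (rule order_trans)
  finally have "summable (\<lambda>n. norm (fps_deriv A $ n * (1/2) ^ n))"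
    by (rule norm_summable_fps)
  then have "summable (\<lambda>n. (1/2) * norm (fps_deriv A $ n * (1/2) ^ n))"
    by (rule summable_mult)
  then have "summable (\<lambda>n. \<bar>A $ Suc n\<bar> * (real (Suc n) * (1/2) ^ Suc n))"
    by (simp add: abs_mult mult_ac)
  then show ?thesis by (subst (asm) summable_Suc_iff)
qed

text \<open>Index i stands for the circuit length i + 1. This is the derivative in t of the sum of
  t^k / k over k \<ge> 2; \<open>even_fps\<close> is the one for odd k \<ge> 3.\<close>

definition geometric_fps :: "real fps" where
  "geometric_fps = Abs_fps (\<lambda>i. if i = 0 then 0 else 1)"

definition even_fps :: "real fps" where
  "even_fps = Abs_fps (\<lambda>i. if even i \<and> i \<ge> 2 then 1 else 0)"

text \<open>The series 1 / (1 + t), needed for dR/dT = exp (- R) / (1 + R).\<close>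

definition alternating_fps :: "real fps" where
  "alternating_fps = Abs_fps (\<lambda>i. (-1) ^ i)"

lemma geometric_fps_radius: "fps_conv_radius geometric_fps \<ge> 1"
  by (rule fps_conv_radius_bounded) (simp add: geometric_fps_def)

lemma even_fps_radius: "fps_conv_radius even_fps \<ge> 1"
  by (rule fps_conv_radius_bounded) (simp add: even_fps_def)

lemma alternating_fps_radius: "fps_conv_radius alternating_fps \<ge> 1"
  by (rule fps_conv_radius_bounded) (simp add: alternating_fps_def)

lemma geometric_fps_mult: "geometric_fps * (1 - fps_X) = fps_X"
  by (rule fps_ext) (auto simp: geometric_fps_def right_diff_distrib)

lemma alternating_fps_mult: "alternating_fps * (1 + fps_X) = 1"
proof (rule fps_ext)
  fix n show "(alternating_fps * (1 + fps_X)) $ n = 1 $ n"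
    by (cases n) (auto simp: alternating_fps_def distrib_left)
qed

lemma even_fps_mult: "even_fps * (1 - fps_X ^ 2) = fps_X ^ 2"
  by (rule fps_ext) (auto simp: even_fps_def right_diff_distrib fps_X_power_mult_right_nth fps_X_power_nth)

lemma eval_fps_eq_divide:
  fixes A B C :: "real fps"
  assumes "A * B = C" "fps_conv_radius A \<ge> 1" "fps_conv_radius B = \<infinity>" "\<bar>z\<bar> < 1" "eval_fps B z \<noteq> 0"
  shows "eval_fps A z = eval_fps C z / eval_fps B z"
proof -
  have "ereal \<bar>z\<bar> < fps_conv_radius A"
    using assms(2,4) by (meson ereal_less(3) less_le_trans)
  then have "eval_fps (A * B) z = eval_fps A z * eval_fps B z"
    using assms by (intro eval_fps_mult) auto
  then show ?thesis using assms by simp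
qed

lemma eval_geometric_fps: "\<bar>z\<bar> < 1 \<Longrightarrow> eval_fps geometric_fps z = z / (1 - z)"
  using fps_conv_radius_diff[of 1 "fps_X :: real fps"]
  by (subst eval_fps_eq_divide[OF geometric_fps_mult geometric_fps_radius]) (simp_all add: eval_fps_diff)

lemma eval_alternating_fps: "\<bar>z\<bar> < 1 \<Longrightarrow> eval_fps alternating_fps z = 1 / (1 + z)"
  using fps_conv_radius_add[of 1 "fps_X :: real fps"]
  by (subst eval_fps_eq_divide[OF alternating_fps_mult alternating_fps_radius]) (simp_all add: eval_fps_add)

lemma eval_even_fps:
  assumes "\<bar>z\<bar> < 1"
  shows "eval_fps even_fps z = z ^ 2 / (1 - z ^ 2)"
proof -
  have "z ^ 2 < 1" using assms by (simp add: abs_square_less_1)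
  then show ?thesis
    using assms fps_conv_radius_diff[of 1 "fps_X ^ 2 :: real fps"]
    by (subst eval_fps_eq_divide[OF even_fps_mult even_fps_radius]) (simp_all add: eval_fps_diff)
qed

lemma tree_cycles_tendsto:
  "(\<lambda>n. (\<Sum>i\<le>n. geometric_fps $ i * (real n * (tree_egf ^ Suc i) $ n / real (Suc i))) / (real n * tree_egf $ n))
      \<longlonglongrightarrow> 1"
proof -
  have "(\<lambda>n. (fps_X * fps_deriv tree_egf * (geometric_fps oo tree_egf)) $ n / (real n * tree_egf $ n))
      \<longlonglongrightarrow> (\<Sum>i. geometric_fps $ i * (1/2) ^ i)"
    by (intro convolution_compose_tendsto tree_egf_nonneg tree_egf_sums summable_half_deriv geometric_fps_radius) auto
  also have "(\<Sum>i. geometric_fps $ i * (1/2) ^ i) = 1"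
    using eval_geometric_fps[of "1/2"] by (simp add: eval_fps_def)
  finally show ?thesis by (simp only: weighted_power_sum_nth[OF tree_egf_0])
qed

text \<open>Differentiating R exp R = T expresses \<open>x R'\<close> through \<open>x T'\<close>,
  the factor whose coefficients are known to vary slowly.\<close>

lemma red_egf_deriv:
  "fps_X * fps_deriv red_egf = fps_X * fps_deriv tree_egf * ((fps_exp (-1) * alternating_fps) oo red_egf)"
proof -
  let ?E = "fps_exp 1 oo red_egf" and ?E' = "fps_exp (-1) oo red_egf" and ?g = "alternating_fps oo red_egf"
  have "?g * (1 + red_egf) = (alternating_fps * (1 + fps_X)) oo red_egf"
    by (simp add: fps_compose_mult_distrib fps_compose_add_distrib)
  then have g: "?g * (1 + red_egf) = 1" by (simp add: alternating_fps_mult)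
  have "fps_deriv tree_egf = fps_deriv red_egf * ?E + red_egf * (?E * fps_deriv red_egf)"
    unfolding red_egf_eq[symmetric] by (simp add: fps_compose_deriv algebra_simps)
  then have "fps_deriv tree_egf * (?E' * ?g) = fps_deriv red_egf * (?E * ?E') * (?g * (1 + red_egf))"
    by (simp add: algebra_simps)
  then have "fps_deriv red_egf = fps_deriv tree_egf * (?E' * ?g)"
    by (simp add: g exp_red_egf)
  then show ?thesis by (simp add: fps_compose_mult_distrib mult_ac)
qed

lemma red_cycles_tendsto:
  assumes R: "\<And>n. 0 \<le> red_egf $ n" "\<And>n. red_egf $ n \<le> tree_egf $ n"
    and l: "2 * l = exp (- l)" "\<And>x. 2 * x = exp (- x) \<Longrightarrow> x = l" "0 < l" "l < 1"
  shows "(\<lambda>n. (\<Sum>i\<le>n. even_fps $ i * (real n * (red_egf ^ Suc i) $ n / real (Suc i))) / (real n * tree_egf $ n))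
      \<longlonglongrightarrow> 2 * l ^ 3 / ((1 + l) ^ 2 * (1 - l))"
proof -
  let ?A = "fps_exp (-1) * alternating_fps * even_fps"
  have s: "(\<lambda>n. red_egf $ n * tree_rad ^ n) sums l"
    using red_egf_sums[OF R] l(2) by metis
  have rQ: "fps_conv_radius (fps_exp (-1) * alternating_fps) \<ge> 1"
    by (rule order_trans[OF _ fps_conv_radius_mult]) (simp add: alternating_fps_radius)
  have rA: "fps_conv_radius ?A \<ge> 1"
    by (rule order_trans[OF _ fps_conv_radius_mult]) (simp add: even_fps_radius rQ)
  have l1: "ereal (norm l) < r" if "r \<ge> 1" for r
    using that l(3,4) by (metis abs_of_pos ereal_less(3) less_le_trans real_norm_def)
  have "(\<lambda>n. (fps_X * fps_deriv tree_egf * (?A oo red_egf)) $ n / (real n * tree_egf $ n))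
      \<longlonglongrightarrow> (\<Sum>i. ?A $ i * l ^ i)"
    by (intro convolution_compose_tendsto R s summable_half_deriv rA)
  also have "(\<Sum>i. ?A $ i * l ^ i) = eval_fps ?A l" by (simp add: eval_fps_def)
  also have "\<dots> = exp (- l) * (1 / (1 + l)) * (l ^ 2 / (1 - l ^ 2))"
    using l(3,4) l1[OF rQ] l1[OF even_fps_radius] l1[OF alternating_fps_radius]
    by (simp add: eval_fps_mult eval_alternating_fps eval_even_fps)
  also have "\<dots> = 2 * l ^ 3 / ((1 + l) ^ 2 * (1 - l))"
  proof -
    have "1 - l ^ 2 = (1 + l) * (1 - l)" by (simp add: power2_eq_square algebra_simps)
    then show ?thesis by (simp add: l(1)[symmetric] power2_eq_square power3_eq_cube mult_ac)
  qed
  also have "fps_X * fps_deriv tree_egf * (?A oo red_egf) = fps_X * fps_deriv red_egf * (even_fps oo red_egf)"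
    unfolding red_egf_deriv by (simp add: fps_compose_mult_distrib mult_ac)
  finally show ?thesis by (simp only: weighted_power_sum_nth[OF red_egf_0])
qed

section \<open>The root of the limit equation\<close>

text \<open>Taylor expansion with the remainder estimated by exp 1 \<le> 3. For x near 0.35 the
  remainder is below 2 / 10^8, which is small enough to decide the signs at both ends of the bracket
  for the root.\<close>

lemma exp_minus_bounds:
  fixes x :: real
  assumes "\<bar>x\<bar> \<le> 1"
  defines "S \<equiv> 1 - x + x^2/2 - x^3/6 + x^4/24 - x^5/120 + x^6/720 - x^7/5040"
  shows "S \<le> exp (- x)" "exp (- x) \<le> S + 3 / 40320 * x ^ 8"
proof -
  obtain t where t: "\<bar>t\<bar> \<le> \<bar>-x\<bar>" "exp (-x) = (\<Sum>m<8. (-x) ^ m / fact m) + exp t / fact 8 * (-x) ^ 8"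
    using Maclaurin_exp_le[of "-x" 8] by blast
  have S: "(\<Sum>m<8. (-x) ^ m / fact m) = S"
    by (simp add: S_def lessThan_nat_numeral fact_numeral)
  have "exp t \<le> exp 1" using t assms by simp
  also have "\<dots> \<le> 3" by (rule exp_le)
  finally have "exp t / fact 8 * x ^ 8 \<le> 3 / fact 8 * x ^ 8"
    by (intro mult_right_mono divide_right_mono) auto
  then show "exp (- x) \<le> S + 3 / 40320 * x ^ 8" using t S by (simp add: fact_numeral)
  show "S \<le> exp (- x)" using t S by simp
qed

lemma lambda_exists:
  obtains l :: real where "2 * l = exp (- l)" "\<And>x. 2 * x = exp (- x) \<Longrightarrow> x = l"
    "351732/1000000 < l" "l < 351734/1000000"
proof -
  define f where "f x = 2 * x - exp (- x)" for x :: real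
  have mono: "f x < f y" if "x < y" for x y
    using that by (simp add: f_def add_strict_mono diff_strict_mono)
  \<comment> \<open>The end points lie at distance 10^(-6) on either side of 0.351733, the accuracy
    claimed for the root.\<close>
  have a: "f (351732/1000000) < 0"
    using exp_minus_bounds(1)[of "351732/1000000"] by (simp add: f_def power_divide)
  have b: "f (351734/1000000) > 0"
    using exp_minus_bounds(2)[of "351734/1000000"] by (simp add: f_def power_divide)
  have "\<exists>x\<ge>351732/1000000. x \<le> 351734/1000000 \<and> f x = 0"
    using a b by (intro IVT') (auto simp: f_def intro!: continuous_intros)
  then obtain l where l: "351732/1000000 \<le> l" "l \<le> 351734/1000000" "f l = 0" by blast
  show ?thesis
  proof (rule that)
    show "2 * l = exp (- l)" using l by (simp add: f_def)
    show "x = l" if "2 * x = exp (- x)" for x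
      using mono[of x l] mono[of l x] l that by (cases x l rule: linorder_cases) (auto simp: f_def)
    have "l \<noteq> 351732/1000000" "l \<noteq> 351734/1000000" using l(3) a b by (metis less_irrefl)+
    then show "351732/1000000 < l" "l < 351734/1000000" using l(1,2) by linarith+
  qed
qed

lemma limit_value_bounds:
  fixes l :: real
  assumes l: "351732/1000000 < l" "l < 351734/1000000"
  shows "(3 * l ^ 3 + l ^ 2 - l - 1) / ((1 + l) ^ 2 * (l - 1)) = 1 - 2 * l ^ 3 / ((1 + l) ^ 2 * (1 - l))"
    and "\<bar>(3 * l ^ 3 + l ^ 2 - l - 1) / ((1 + l) ^ 2 * (l - 1)) - 0.9265\<bar> < 5 / 10 ^ 5"
proof -
  define d where "d = (1 + l) ^ 2 * (1 - l)"
  have d: "d > 0" using l by (simp add: d_def)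
  have dd: "d = 1 + l - l ^ 2 - l ^ 3"
    by (simp add: d_def power2_eq_square power3_eq_cube algebra_simps)
  have "(3 * l ^ 3 + l ^ 2 - l - 1) / ((1 + l) ^ 2 * (l - 1)) = (2 * l ^ 3 - d) / (- d)"
    by (simp add: dd power2_eq_square power3_eq_cube algebra_simps)
  also have "\<dots> = 1 - 2 * l ^ 3 / d" using d by (simp add: field_simps)
  finally show e: "(3 * l ^ 3 + l ^ 2 - l - 1) / ((1 + l) ^ 2 * (l - 1)) = 1 - 2 * l ^ 3 / ((1 + l) ^ 2 * (1 - l))"
    by (simp add: d_def)
  have "(351732/1000000) ^ 3 \<le> l ^ 3" "l ^ 3 \<le> (351734/1000000) ^ 3" using l by (intro power_mono; simp)+
  moreover have "((4351/100000) :: real) < (351732/1000000) ^ 3" "(351734/1000000) ^ 3 < ((4352/100000) :: real)"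
    by (simp_all add: power3_eq_cube)
  ultimately have l3: "4351/100000 < l ^ 3" "l ^ 3 < 4352/100000" by linarith+
  have "(351732/1000000) ^ 2 \<le> l ^ 2" "l ^ 2 \<le> (351734/1000000) ^ 2" using l by (intro power_mono; simp)+
  moreover have "((12371/100000) :: real) < (351732/1000000) ^ 2" "(351734/1000000) ^ 2 < ((12372/100000) :: real)"
    by (simp_all add: power2_eq_square)
  ultimately have l2: "12371/100000 < l ^ 2" "l ^ 2 < 12372/100000" by linarith+
  \<comment> \<open>These place the quotient within 4 / 10^5 of 0.0735 = 1 - 0.9265, inside the
    claimed tolerance.\<close>
  have *: "2 * l ^ 3 < (7354/100000) * d" "(7346/100000) * d < 2 * l ^ 3"
    subgoal unfolding dd using l l2 l3 by (simp add: field_simps)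
    subgoal unfolding dd using l l2 l3 by (simp add: field_simps)
    done
  define q where "q = 2 * l ^ 3 / d"
  have "q < 7354/100000" "7346/100000 < q"
    unfolding q_def using d * by (simp_all add: pos_divide_less_eq pos_less_divide_eq)
  then show "\<bar>(3 * l ^ 3 + l ^ 2 - l - 1) / ((1 + l) ^ 2 * (l - 1)) - 0.9265\<bar> < 5 / 10 ^ 5"
    unfolding e d_def[symmetric] q_def[symmetric] by (simp add: abs_if)
qed

section \<open>Rooted forests with their red roots\<close>

text \<open>
  A forest with root set \<open>A\<close> and remaining vertices \<open>V\<close> is peeled off by layers: \<open>B\<close> consists of
  the neighbours of the roots, and \<open>e b = (a, d)\<close> says that \<open>b\<close> hangs on the root \<open>a\<close> by the arc
  \<open>(a, b)\<close> if \<open>d\<close> holds and by \<open>(b, a)\<close> otherwise.  In \<open>rooted_forest A V F Y\<close>, the set \<open>F\<close> contains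
  the arcs, and \<open>Y\<close> the roots that are red in their own tree.  Thus the colour of \<open>b\<close> enters only
  when the arc leads from the root to \<open>b\<close>; otherwise it cannot influence the root.
\<close>

definition layer_arc :: "'a \<Rightarrow> 'a \<times> bool \<Rightarrow> 'a \<times> 'a" where
  "layer_arc b p = (if snd p then (fst p, b) else (b, fst p))"

inductive rooted_forest :: "'a set \<Rightarrow> 'a set \<Rightarrow> 'a rel \<Rightarrow> 'a set \<Rightarrow> bool" where
  forest_empty: "rooted_forest A {} {} A"
| forest_layer: "\<lbrakk>B \<noteq> {}; B \<subseteq> V; A \<inter> V = {}; e \<in> B \<rightarrow>\<^sub>E A \<times> UNIV; rooted_forest B (V - B) F Y\<rbrakk>
    \<Longrightarrow> rooted_forest A V ((\<lambda>b. layer_arc b (e b)) ` B \<union> F) {a \<in> A. \<forall>b\<in>Y. e b \<noteq> (a, True)}"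

lemma forest_red_subset: "rooted_forest A V F Y \<Longrightarrow> Y \<subseteq> A"
  by (induction rule: rooted_forest.induct) auto

lemma forest_disjoint: "rooted_forest A V F Y \<Longrightarrow> A \<inter> V = {}"
  by (induction rule: rooted_forest.induct) auto

lemma layer_arc_cases:
  assumes "e \<in> B \<rightarrow>\<^sub>E A \<times> UNIV" "b \<in> B"
  obtains a where "a \<in> A" "e b = (a, True)" "layer_arc b (e b) = (a, b)"
    | a where "a \<in> A" "e b = (a, False)" "layer_arc b (e b) = (b, a)"
proof -
  have "e b \<in> A \<times> UNIV" using assms by auto
  then obtain a d where ad: "e b = (a, d)" "a \<in> A" by auto
  show ?thesis
  proof (cases d)
    case True
    show ?thesis by (rule that(1)[OF ad(2)]) (simp_all add: ad True layer_arc_def)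
  next
    case False
    show ?thesis by (rule that(2)[OF ad(2)]) (simp_all add: ad False layer_arc_def)
  qed
qed

lemma forest_arcs: "rooted_forest A V F Y \<Longrightarrow> F \<subseteq> (A \<union> V) \<times> (A \<union> V) - A \<times> A"
proof (induction rule: rooted_forest.induct)
  case (forest_layer B V A e F Y)
  show ?case
  proof (intro Un_least subsetI)
    fix x assume "x \<in> (\<lambda>b. layer_arc b (e b)) ` B"
    then obtain b where b: "b \<in> B" "x = layer_arc b (e b)" by auto
    show "x \<in> (A \<union> V) \<times> (A \<union> V) - A \<times> A"
      by (rule layer_arc_cases[OF forest_layer.hyps(4) b(1)]) (use b forest_layer.hyps in auto)
  next
    fix x assume "x \<in> F"
    then show "x \<in> (A \<union> V) \<times> (A \<union> V) - A \<times> A"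
      using forest_layer.IH forest_layer.hyps(2,3) by blast
  qed
qed auto

lemma forest_arcs_inner:
  assumes "rooted_forest B (V - B) F Y" "B \<subseteq> V"
  shows "F \<subseteq> V \<times> V"
  using forest_arcs[OF assms(1)] assms(2) by blast

lemma forest_irrefl: "rooted_forest A V F Y \<Longrightarrow> (x, x) \<notin> F"
proof (induction rule: rooted_forest.induct)
  case (forest_layer B V A e F Y)
  have "(x, x) \<noteq> layer_arc b (e b)" if "b \<in> B" for b
    by (rule layer_arc_cases[OF forest_layer.hyps(4) that]) (use that forest_layer.hyps in auto)
  then show ?case using forest_layer by auto
qed auto

lemma layer_subset:
  assumes AV: "A \<inter> V = {}" and B: "B \<subseteq> V" "B' \<subseteq> V"
    and e: "e \<in> B \<rightarrow>\<^sub>E A \<times> UNIV" "e' \<in> B' \<rightarrow>\<^sub>E A \<times> UNIV"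
    and sub: "(\<lambda>b. layer_arc b (e b)) ` B \<subseteq> (\<lambda>b. layer_arc b (e' b)) ` B'" and b: "b \<in> B"
  shows "b \<in> B' \<and> e b = e' b"
proof -
  obtain c where c: "c \<in> B'" "layer_arc b (e b) = layer_arc c (e' c)" using sub b by blast
  show ?thesis
    by (rule layer_arc_cases[OF e(1) b]; rule layer_arc_cases[OF e(2) c(1)])
       (use AV B b c in auto)
qed

lemma Un_split_eq:
  assumes "L \<union> F = L' \<union> F'" "F \<subseteq> W" "F' \<subseteq> W" "\<And>x. x \<in> L \<Longrightarrow> x \<notin> W" "\<And>x. x \<in> L' \<Longrightarrow> x \<notin> W"
  shows "L = L'" "F = F'"
  using assms by blast+

text \<open>Exactly the layer arcs have an end outside V, namely the root, so the arc set separates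
  the layer from the rest. The other end of a layer arc identifies its vertex b.\<close>

lemma layer_inject:
  assumes AV: "A \<inter> V = {}" and B: "B \<subseteq> V" "B' \<subseteq> V"
    and e: "e \<in> B \<rightarrow>\<^sub>E A \<times> UNIV" "e' \<in> B' \<rightarrow>\<^sub>E A \<times> UNIV" and F: "F \<subseteq> V \<times> V" "F' \<subseteq> V \<times> V"
    and eq: "(\<lambda>b. layer_arc b (e b)) ` B \<union> F = (\<lambda>b. layer_arc b (e' b)) ` B' \<union> F'"
  shows "B = B' \<and> e = e' \<and> F = F'"
proof -
  have out: "layer_arc b (f b) \<notin> V \<times> V" if "f \<in> C \<rightarrow>\<^sub>E A \<times> UNIV" "b \<in> C" for f C b
    by (rule layer_arc_cases[OF that]) (use AV in auto)
  let ?L = "(\<lambda>b. layer_arc b (e b)) ` B" and ?L' = "(\<lambda>b. layer_arc b (e' b)) ` B'"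
  have o: "x \<notin> V \<times> V" if "x \<in> ?L" for x
    using that by (elim imageE) (simp only: out[OF e(1)] not_False_eq_True)
  have o': "x \<notin> V \<times> V" if "x \<in> ?L'" for x
    using that by (elim imageE) (simp only: out[OF e(2)] not_False_eq_True)
  note L = Un_split_eq(1)[OF eq F o o'] and F' = Un_split_eq(2)[OF eq F o o']
  have 1: "b \<in> B' \<and> e b = e' b" if "b \<in> B" for b
    using layer_subset[OF AV B e _ that] L by simp
  have 2: "b \<in> B \<and> e' b = e b" if "b \<in> B'" for b
    using layer_subset[OF AV B(2,1) e(2,1) _ that] L by simp
  have BB: "B = B'"
    by (intro equalityI subsetI) (simp_all add: 1[THEN conjunct1] 2[THEN conjunct1])
  moreover have "e = e'"
  proof (rule PiE_ext[OF e(1)])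
    show "e' \<in> B \<rightarrow>\<^sub>E A \<times> UNIV" using e(2) BB by simp
    show "e b = e' b" if "b \<in> B" for b using 1[OF that] ..
  qed
  ultimately show ?thesis using F' by simp
qed

lemma forest_layerE:
  assumes "rooted_forest A V F Y" "V \<noteq> {}"
  obtains B e F' Y' where "B \<noteq> {}" "B \<subseteq> V" "e \<in> B \<rightarrow>\<^sub>E A \<times> UNIV" "rooted_forest B (V - B) F' Y'"
    "F = (\<lambda>b. layer_arc b (e b)) ` B \<union> F'" "Y = {a \<in> A. \<forall>b\<in>Y'. e b \<noteq> (a, True)}"
  using assms(1)
proof (cases rule: rooted_forest.cases)
  case forest_empty
  then show ?thesis using assms(2) by simp
next
  case (forest_layer B e F' Y')
  show ?thesis by (rule that[of B e F' Y']) (use forest_layer in simp_all)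
qed

lemma forest_emptyE: "rooted_forest A {} F Y \<Longrightarrow> F = {} \<and> Y = A"
  by (auto elim: rooted_forest.cases)

text \<open>Peeling is deterministic: the arc set determines the first layer and its attachment map.
  Hence Y is a function of F, and counting pairs amounts to counting arc sets.\<close>

lemma forest_unique: "rooted_forest A V F Y \<Longrightarrow> rooted_forest A V F Y' \<Longrightarrow> Y' = Y"
proof (induction arbitrary: Y' rule: rooted_forest.induct)
  case (forest_layer B V A e F Y)
  have "V \<noteq> {}" using forest_layer.hyps by auto
  from forest_layerE[OF forest_layer.prems this] obtain C e' F' Y'' where
    C: "C \<noteq> {}" "C \<subseteq> V" "e' \<in> C \<rightarrow>\<^sub>E A \<times> UNIV" "rooted_forest C (V - C) F' Y''"
    "(\<lambda>b. layer_arc b (e b)) ` B \<union> F = (\<lambda>b. layer_arc b (e' b)) ` C \<union> F'"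
    "Y' = {a \<in> A. \<forall>b\<in>Y''. e' b \<noteq> (a, True)}" .
  have "B = C \<and> e = e' \<and> F = F'"
    by (rule layer_inject[OF forest_layer.hyps(3,2) C(2) forest_layer.hyps(4) C(3)
          forest_arcs_inner[OF forest_layer.hyps(5,2)] forest_arcs_inner[OF C(4,2)] C(5)])
  then show ?case using forest_layer.IH C by auto
qed (use forest_emptyE in blast)

section \<open>Counting forests with prescribed red roots\<close>

definition forests :: "'a set \<Rightarrow> 'a set \<Rightarrow> ('a rel \<times> 'a set) set" where
  "forests A V = {(F, Y). rooted_forest A V F Y}"

lemma finite_forests:
  assumes "finite A" "finite V"
  shows "finite (forests A V)"
proof (rule finite_subset)
  show "forests A V \<subseteq> Pow ((A \<union> V) \<times> (A \<union> V)) \<times> Pow A"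
    using forest_arcs[of A V] forest_red_subset[of A V] unfolding forests_def by blast
qed (use assms in auto)

text \<open>Prescribing red roots while leaving the other roots free gives a product of powers of R
  / x and T / x as the count, and it is the condition that the subset expansion below
  produces.\<close>

definition forests_red :: "'a set \<Rightarrow> 'a set \<Rightarrow> 'a set \<Rightarrow> ('a rel \<times> 'a set) set" where
  "forests_red X A V = {p \<in> forests A V. X \<subseteq> snd p}"

text \<open>For a fixed layer B and inner forest, every b in B chooses its attachment independently
  among 2 |A| possibilities. Keeping X red excludes the arcs from X to b precisely when b is red in
  its own tree.\<close>

lemma card_forests_red_layer:
  assumes fin: "finite A" "finite V" and AV: "A \<inter> V = {}" and V: "V \<noteq> {}" and X: "X \<subseteq> A"
  shows "card (forests_red X A V) =
    (\<Sum>B\<in>Pow V - {{}}. \<Sum>p\<in>forests B (V - B). \<Prod>b\<in>B. 2 * card A - (if b \<in> snd p then card X else 0))"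
proof -
  define E where "E B Y = (\<Pi>\<^sub>E b\<in>B. A \<times> UNIV - (if b \<in> Y then X \<times> {True} else {}))" for B Y :: "'a set"
  define D where "D = (SIGMA B:Pow V - {{}}. SIGMA p:forests B (V - B). E B (snd p))"
  define \<Phi> where "\<Phi> = (\<lambda>(B, (F, Y :: 'a set), e). ((\<lambda>b. layer_arc b (e b)) ` B \<union> F, {a \<in> A. \<forall>b\<in>Y. e b \<noteq> (a, True)}))"
  have E: "E B Y \<subseteq> (B \<rightarrow>\<^sub>E A \<times> UNIV)" for B Y
    unfolding E_def by (intro PiE_mono) auto
  have cardE: "card (E B Y) = (\<Prod>b\<in>B. 2 * card A - (if b \<in> Y then card X else 0))" if "B \<subseteq> V" for B Y
  proof -
    have "card (A \<times> (UNIV :: bool set) - (if b \<in> Y then X \<times> {True} else {})) = 2 * card A - (if b \<in> Y then card X else 0)" for b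
    proof -
      have "X \<times> {True} \<subseteq> A \<times> (UNIV :: bool set)" "finite (X \<times> {True})"
        using X finite_subset[OF X fin(1)] by auto
      then show ?thesis by (simp add: card_Diff_subset card_cartesian_product mult.commute)
    qed
    then show ?thesis
      using that fin by (simp add: E_def card_PiE finite_subset)
  qed
  have "bij_betw \<Phi> D (forests_red X A V)"
    unfolding bij_betw_def
  proof
    show "inj_on \<Phi> D"
    proof (rule inj_onI)
      fix p q assume p: "p \<in> D" and q: "q \<in> D" and pq: "\<Phi> p = \<Phi> q"
      obtain B F Y e where P: "p = (B, (F, Y), e)" by (metis prod.exhaust)
      obtain B' F' Y' e' where Q: "q = (B', (F', Y'), e')" by (metis prod.exhaust)
      have pD: "B \<subseteq> V" "rooted_forest B (V - B) F Y" "e \<in> B \<rightarrow>\<^sub>E A \<times> UNIV"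
        using p E unfolding P D_def forests_def by auto
      have qD: "B' \<subseteq> V" "rooted_forest B' (V - B') F' Y'" "e' \<in> B' \<rightarrow>\<^sub>E A \<times> UNIV"
        using q E unfolding Q D_def forests_def by auto
      have "(\<lambda>b. layer_arc b (e b)) ` B \<union> F = (\<lambda>b. layer_arc b (e' b)) ` B' \<union> F'"
        using pq by (simp add: \<Phi>_def P Q)
      then have eqs: "B = B' \<and> e = e' \<and> F = F'"
        by (rule layer_inject[OF AV pD(1) qD(1) pD(3) qD(3)
            forest_arcs_inner[OF pD(2,1)] forest_arcs_inner[OF qD(2,1)]])
      then have "Y = Y'" using forest_unique[of B "V - B" F] pD(2) qD(2) by metis
      then show "p = q" using eqs by (simp add: P Q)
    qed
    show "\<Phi> ` D = forests_red X A V"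
    proof (intro equalityI subsetI)
      fix t assume "t \<in> \<Phi> ` D"
      then obtain B F Y e where t: "t = \<Phi> (B, (F, Y), e)" and d: "(B, (F, Y), e) \<in> D"
        by (metis (no_types, lifting) imageE prod.exhaust)
      have pD: "B \<subseteq> V" "B \<noteq> {}" "rooted_forest B (V - B) F Y" "e \<in> B \<rightarrow>\<^sub>E A \<times> UNIV" "e \<in> E B Y"
        using d E unfolding D_def forests_def by auto
      have "e b \<noteq> (a, True)" if "a \<in> X" "b \<in> Y" for a b
      proof -
        have "b \<in> B" using forest_red_subset[OF pD(3)] that by auto
        then have "e b \<in> A \<times> UNIV - X \<times> {True}"
          using PiE_mem[OF pD(5)[unfolded E_def], of b] that by simp
        then show ?thesis using that by auto
      qed
      then show "t \<in> forests_red X A V"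
        using forest_layer[OF pD(2,1) AV pD(4,3)] X unfolding t \<Phi>_def forests_red_def forests_def by auto
    next
      fix t assume "t \<in> forests_red X A V"
      then have t: "rooted_forest A V (fst t) (snd t)" "X \<subseteq> snd t" by (auto simp: forests_red_def forests_def)
      from forest_layerE[OF t(1) V] obtain B e F' Y' where
        C: "B \<noteq> {}" "B \<subseteq> V" "e \<in> B \<rightarrow>\<^sub>E A \<times> UNIV" "rooted_forest B (V - B) F' Y'"
        "fst t = (\<lambda>b. layer_arc b (e b)) ` B \<union> F'" "snd t = {a \<in> A. \<forall>b\<in>Y'. e b \<noteq> (a, True)}" .
      have "e \<in> E B Y'"
        using C(3,6) t(2) unfolding E_def by (auto simp: PiE_iff)
      then have "(B, (F', Y'), e) \<in> D" using C by (auto simp: D_def forests_def)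
      moreover have "t = \<Phi> (B, (F', Y'), e)" using C(5,6) by (auto simp: \<Phi>_def prod_eq_iff)
      ultimately show "t \<in> \<Phi> ` D" by blast
    qed
  qed
  then have "card (forests_red X A V) = card D" by (metis bij_betw_same_card)
  also have "\<dots> = (\<Sum>B\<in>Pow V - {{}}. \<Sum>p\<in>forests B (V - B). card (E B (snd p)))"
  proof -
    have ff: "finite (forests B (V - B))" if "B \<in> Pow V - {{}}" for B
      using that fin by (intro finite_forests) (auto intro: finite_subset)
    have fE: "finite (E B Y)" if "B \<in> Pow V - {{}}" for B Y
      using that fin unfolding E_def by (intro finite_PiE) (auto intro: finite_subset)
    show ?thesis unfolding D_def using ff fE fin by (simp add: finite_SigmaI)
  qed
  also have "\<dots> = (\<Sum>B\<in>Pow V - {{}}. \<Sum>p\<in>forests B (V - B). \<Prod>b\<in>B. 2 * card A - (if b \<in> snd p then card X else 0))"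
    by (intro sum.cong refl cardE) auto
  finally show ?thesis .
qed

lemma sum_Pow_card:
  fixes g :: "nat \<Rightarrow> real"
  assumes "finite V"
  shows "(\<Sum>B\<in>Pow V. g (card B)) = (\<Sum>j\<le>card V. of_nat (card V choose j) * g j)"
proof -
  have "(\<Sum>j\<le>card V. \<Sum>B\<in>{B \<in> Pow V. card B = j}. g (card B)) = (\<Sum>B\<in>Pow V. g (card B))"
    by (rule sum.group) (use assms in \<open>auto intro: card_mono\<close>)
  moreover have "(\<Sum>B\<in>{B \<in> Pow V. card B = j}. g (card B)) = of_nat (card V choose j) * g j" for j
  proof -
    have "(\<Sum>B\<in>{B \<in> Pow V. card B = j}. g (card B)) = (\<Sum>B\<in>{B. B \<subseteq> V \<and> card B = j}. g j)"
      by (intro sum.cong) auto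
    then show ?thesis by (simp add: n_subsets[OF assms])
  qed
  ultimately show ?thesis by (simp only:)
qed

lemma tree_egf'_0 [simp]: "tree_egf' $ 0 = 1"
  by (simp add: tree_egf'_def)

lemma red_egf'_0 [simp]: "red_egf' $ 0 = 1"
  by (simp add: red_egf'_def)

text \<open>Expanding over subsets Z leaves the dependence on Y in the condition
  \<open>Z \<subseteq> Y\<close> alone, which becomes a count of \<open>forests_red\<close> once
  summed over forests.\<close>

lemma prod_minus_indicator:
  assumes fin: "finite B" and xk: "x \<le> n"
  shows "real (\<Prod>b\<in>B. n - (if b \<in> Y then x else 0))
    = (\<Sum>Z\<in>Pow B. if Z \<subseteq> Y then (- real x) ^ card Z * real n ^ card (B - Z) else 0)"
proof -
  have "real (\<Prod>b\<in>B. n - (if b \<in> Y then x else 0)) = (\<Prod>b\<in>B. (if b \<in> Y then - real x else 0) + real n)"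
    unfolding of_nat_prod using xk by (intro prod.cong refl) (simp add: of_nat_diff)
  also have "\<dots> = (\<Sum>Z\<in>Pow B. (\<Prod>b\<in>Z. if b \<in> Y then - real x else 0) * (\<Prod>b\<in>B - Z. real n))"
    by (rule prod_add[OF fin])
  also have "\<dots> = (\<Sum>Z\<in>Pow B. if Z \<subseteq> Y then (- real x) ^ card Z * real n ^ card (B - Z) else 0)"
  proof (rule sum.cong)
    fix Z assume Z: "Z \<in> Pow B"
    then have fZ: "finite Z" using fin by (auto intro: finite_subset)
    have "(\<Prod>b\<in>Z. if b \<in> Y then - real x else 0) = (if Z \<subseteq> Y then (- real x) ^ card Z else 0)"
    proof (cases "Z \<subseteq> Y")
      case True
      then have "(\<Prod>b\<in>Z. if b \<in> Y then - real x else 0) = (\<Prod>b\<in>Z. - real x)"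
        by (intro prod.cong) auto
      then show ?thesis using True by simp
    next
      case False
      then obtain b where "b \<in> Z" "b \<notin> Y" by auto
      then show ?thesis using fZ False by (auto intro!: prod_zero)
    qed
    then show "(\<Prod>b\<in>Z. if b \<in> Y then - real x else 0) * (\<Prod>b\<in>B - Z. real n)
      = (if Z \<subseteq> Y then (- real x) ^ card Z * real n ^ card (B - Z) else 0)" by simp
  qed simp
  finally show ?thesis .
qed

text \<open>Summing over forests first replaces each condition \<open>Z \<subseteq> Y\<close> by the
  count that the hypothesis supplies; the sum over Z then folds back into a power.\<close>

lemma sum_forests_layer_weight:
  assumes fin: "finite B" "finite V" and xn: "x \<le> n"
    and IH: "\<And>Z. Z \<subseteq> B \<Longrightarrow> real (card (forests_red Z B V))
            = fact m * (red_egf' ^ card Z * tree_egf' ^ (card B - card Z)) $ m"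
  shows "(\<Sum>p\<in>forests B V. real (\<Prod>b\<in>B. n - (if b \<in> snd p then x else 0)))
     = fact m * ((fps_const (- real x) * red_egf' + fps_const (real n) * tree_egf') ^ card B) $ m"
proof -
  define f where "f Z = (- real x) ^ card Z * real n ^ card (B - Z)" for Z
  have ff: "finite (forests B V)" using fin by (simp add: finite_forests)
  have "(\<Sum>p\<in>forests B V. real (\<Prod>b\<in>B. n - (if b \<in> snd p then x else 0)))
    = (\<Sum>p\<in>forests B V. \<Sum>Z\<in>Pow B. if Z \<subseteq> snd p then f Z else 0)"
    unfolding f_def by (intro sum.cong refl prod_minus_indicator fin xn)
  also have "\<dots> = (\<Sum>Z\<in>Pow B. \<Sum>p\<in>forests B V. if Z \<subseteq> snd p then f Z else 0)"
    by (rule sum.swap)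
  also have "\<dots> = (\<Sum>Z\<in>Pow B. f Z * real (card (forests_red Z B V)))"
  proof (rule sum.cong)
    fix Z
    have "(\<Sum>p\<in>forests B V. if Z \<subseteq> snd p then f Z else 0) = (\<Sum>p\<in>forests_red Z B V. f Z)"
      unfolding forests_red_def by (rule sum.inter_filter[symmetric, OF ff])
    then show "(\<Sum>p\<in>forests B V. if Z \<subseteq> snd p then f Z else 0) = f Z * real (card (forests_red Z B V))"
      by simp
  qed simp
  also have "\<dots> = (\<Sum>Z\<in>Pow B. fact m * ((\<Prod>b\<in>Z. fps_const (- real x) * red_egf') * (\<Prod>b\<in>B - Z. fps_const (real n) * tree_egf')) $ m)"
  proof (rule sum.cong)
    fix Z assume Z: "Z \<in> Pow B"
    have cZ: "card (B - Z) = card B - card Z" using Z fin by (auto intro: card_Diff_subset finite_subset)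
    have "(\<Prod>b\<in>Z. fps_const (- real x) * red_egf') * (\<Prod>b\<in>B - Z. fps_const (real n) * tree_egf')
        = (fps_const (- real x) ^ card Z * fps_const (real n) ^ card (B - Z)) * (red_egf' ^ card Z * tree_egf' ^ card (B - Z))"
      unfolding prod_constant power_mult_distrib by (simp only: mult_ac)
    also have "fps_const (- real x) ^ card Z * fps_const (real n) ^ card (B - Z) = fps_const (f Z)"
      by (simp only: f_def fps_const_power fps_const_mult)
    finally have "((\<Prod>b\<in>Z. fps_const (- real x) * red_egf') * (\<Prod>b\<in>B - Z. fps_const (real n) * tree_egf')) $ m
        = f Z * (red_egf' ^ card Z * tree_egf' ^ (card B - card Z)) $ m"
      by (simp only: cZ fps_mult_left_const_nth)
    then show "f Z * real (card (forests_red Z B V))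
      = fact m * ((\<Prod>b\<in>Z. fps_const (- real x) * red_egf') * (\<Prod>b\<in>B - Z. fps_const (real n) * tree_egf')) $ m"
      using IH[of Z] Z by simp
  qed simp
  also have "\<dots> = fact m * (\<Sum>Z\<in>Pow B. ((\<Prod>b\<in>Z. fps_const (- real x) * red_egf') * (\<Prod>b\<in>B - Z. fps_const (real n) * tree_egf'))) $ m"
    unfolding fps_sum_nth sum_distrib_left ..
  also have "(\<Sum>Z\<in>Pow B. ((\<Prod>b\<in>Z. fps_const (- real x) * red_egf') * (\<Prod>b\<in>B - Z. fps_const (real n) * tree_egf')))
      = (fps_const (- real x) * red_egf' + fps_const (real n) * tree_egf') ^ card B"
    unfolding prod_add[OF fin(1), symmetric] by (rule prod_constant)
  finally show ?thesis .
qed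

text \<open>
  Expanding the number of ways to attach a layer over the subsets of its red vertices gives both
  sides the same recursion; so no decomposition into single trees is needed.
\<close>

theorem card_forests_red:
  assumes "finite V" "finite A" "A \<inter> V = {}" "X \<subseteq> A"
  shows "real (card (forests_red X A V))
    = fact (card V) * (red_egf' ^ card X * tree_egf' ^ (card A - card X)) $ card V"
  using assms
proof (induction V arbitrary: A X rule: finite_psubset_induct)
  case (psubset V)
  show ?case
  proof (cases "V = {}")
    case True
    have "forests_red X A {} = {({}, A)}"
    proof (intro equalityI subsetI)
      fix p assume "p \<in> forests_red X A {}"
      then have "rooted_forest A {} (fst p) (snd p)" by (auto simp: forests_red_def forests_def)
      from forest_emptyE[OF this] show "p \<in> {({}, A)}" by (simp add: prod_eq_iff)
    next
      fix p assume "p \<in> {({} :: ('a \<times> 'a) set, A)}"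
      then show "p \<in> forests_red X A {}"
        using forest_empty[of A] psubset.prems by (simp add: forests_red_def forests_def)
    qed
    then show ?thesis by (simp add: True startsby_one_power)
  next
    case False
    define k x m where "k = card A" and "x = card X" and "m = card V"
    have xk: "x \<le> k" using psubset.prems by (simp add: k_def x_def card_mono)
    have m: "m > 0" using False psubset.hyps by (simp add: m_def card_gt_0_iff)
    define W where "W = of_nat (2 * k) * tree_egf - of_nat x * red_egf"
    define W' where "W' = fps_const (- real x) * red_egf' + fps_const (real (2 * k)) * tree_egf'"
    have WW: "W = fps_X * W'"
    proof -
      have "W = fps_const (real (2 * k)) * tree_egf + fps_const (- real x) * red_egf"
        by (simp only: W_def fps_of_nat fps_const_neg[symmetric] mult_minus_left diff_conv_add_uminus)
      then show ?thesis unfolding W'_def tree_egf_shift red_egf_shift by (simp only: algebra_simps)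
    qed
    \<comment> \<open>As W = x W', coefficient m of W^j is coefficient m - j of W'^j: the j vertices
      of the layer are accounted for by the exponent.\<close>
    define g where "g j = fact (m - j) * (W ^ j) $ m" for j
    have *: "(\<Sum>p\<in>forests B (V - B). real (\<Prod>b\<in>B. 2 * k - (if b \<in> snd p then x else 0))) = g (card B)"
      if B: "B \<in> Pow V - {{}}" for B
    proof -
      have Bfin: "finite B" using B psubset.hyps by (auto intro: finite_subset)
      have cB: "card B \<le> m" using B psubset.hyps by (auto simp: m_def card_mono)
      have cVB: "card (V - B) = m - card B" using B Bfin by (auto simp: m_def card_Diff_subset)
      have "(\<Sum>p\<in>forests B (V - B). real (\<Prod>b\<in>B. 2 * k - (if b \<in> snd p then x else 0)))
          = fact (m - card B) * (W' ^ card B) $ (m - card B)"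
        unfolding W'_def
      proof (rule sum_forests_layer_weight)
        show "real (card (forests_red Z B (V - B)))
            = fact (m - card B) * (red_egf' ^ card Z * tree_egf' ^ (card B - card Z)) $ (m - card B)"
          if "Z \<subseteq> B" for Z
          unfolding cVB[symmetric] by (rule psubset.IH) (use B that Bfin in auto)
      qed (use Bfin psubset.hyps xk in auto)
      also have "(W' ^ card B) $ (m - card B) = (W ^ card B) $ m"
        using cB unfolding WW power_mult_distrib fps_X_power_mult_nth by simp
      finally show ?thesis by (simp add: g_def)
    qed
    have "real (card (forests_red X A V)) = (\<Sum>B\<in>Pow V - {{}}. g (card B))"
      unfolding card_forests_red_layer[OF psubset.prems(1) psubset.hyps psubset.prems(2) False psubset.prems(3)] of_nat_sum
      by (intro sum.cong refl) (use * in \<open>simp only: k_def x_def\<close>)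
    \<comment> \<open>The empty layer may be added: since m > 0, the coefficient of W^0 at m
      vanishes.\<close>
    also have "\<dots> = (\<Sum>B\<in>Pow V. g (card B))"
      using psubset.hyps m by (intro sum.mono_neutral_left) (auto simp: g_def)
    also have "\<dots> = (\<Sum>j\<le>m. of_nat (m choose j) * g j)"
      using sum_Pow_card[OF psubset.hyps] by (simp add: m_def)
    also have "\<dots> = (\<Sum>j\<le>m. fact m * (1 / fact j * (W ^ j) $ m))"
      by (intro sum.cong refl) (simp add: g_def binomial_fact)
    also have "\<dots> = fact m * (fps_exp 1 oo W) $ m"
      by (simp add: fps_compose_nth sum_distrib_left atLeast0AtMost)
    also have "fps_exp 1 oo W = red_egf' ^ x * tree_egf' ^ (k - x)"
      unfolding W_def by (rule exp_layer_egf[OF xk])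
    finally show ?thesis by (simp add: k_def x_def m_def)
  qed
qed

text \<open>Both bounds come from the count for the single root 0, as the forests with a red root
  are among all forests.\<close>

lemma red_egf'_bounds: "0 \<le> red_egf' $ m" "red_egf' $ m \<le> tree_egf' $ m"
proof -
  define V :: "nat set" where "V = {1..m}"
  have V: "finite V" "card V = m" "{0} \<inter> V = {}" by (auto simp: V_def)
  have r: "real (card (forests_red {0} {0} V)) = fact m * red_egf' $ m"
    using card_forests_red[OF V(1) _ V(3), of "{0}"] V by simp
  have t: "real (card (forests_red {} {0} V)) = fact m * tree_egf' $ m"
    using card_forests_red[OF V(1) _ V(3), of "{}"] V by simp
  have "0 \<le> fact m * red_egf' $ m" by (simp flip: r)
  then show "0 \<le> red_egf' $ m"
    using fact_gt_zero[of m, where 'a = real] by (auto simp: zero_le_mult_iff)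
  have "card (forests_red {0} {0} V) \<le> card (forests_red {} {0} V)"
    using V finite_forests[of "{0}" V] by (intro card_mono) (auto simp: forests_red_def)
  then have "fact m * red_egf' $ m \<le> fact m * tree_egf' $ m" by (simp flip: r t)
  then show "red_egf' $ m \<le> tree_egf' $ m" by simp
qed

lemma red_egf_bounds: "0 \<le> red_egf $ n" "red_egf $ n \<le> tree_egf $ n"
  using red_egf'_bounds[of "n - 1"] by (simp_all add: red_egf_shift tree_egf_shift)

section \<open>Kernels and bridges of forests\<close>

text \<open>A root is influenced only by the heads of arcs leaving it, and such a vertex has no arc
  to any root. So its membership in K is decided within its own tree, whatever K does on A.\<close>

lemma forest_kernel_red:
  assumes "rooted_forest A V F Y" "\<forall>v\<in>V. v \<in> K \<longleftrightarrow> (\<forall>w\<in>K. (v, w) \<notin> F)" "a \<in> A"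
  shows "(\<forall>w\<in>K. (a, w) \<notin> F) \<longleftrightarrow> a \<in> Y"
  using assms
proof (induction arbitrary: a rule: rooted_forest.induct)
  case (forest_layer B V A e F Y)
  define L where "L = (\<lambda>b. layer_arc b (e b)) ` B"
  note hyps = forest_layer.hyps and prems = forest_layer.prems[folded L_def]
  have Fa: "F \<subseteq> V \<times> V" by (rule forest_arcs_inner[OF hyps(5,2)])
  have Lout: "(v, w) \<in> L \<Longrightarrow> v \<in> B \<and> w \<in> A \<or> v \<in> A \<and> w \<in> B \<and> e w = (v, True)" for v w
  proof -
    assume "(v, w) \<in> L"
    then obtain b where b: "b \<in> B" "(v, w) = layer_arc b (e b)" by (auto simp: L_def)
    show "v \<in> B \<and> w \<in> A \<or> v \<in> A \<and> w \<in> B \<and> e w = (v, True)"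
      by (rule layer_arc_cases[OF hyps(4) b(1)]) (use b in auto)
  qed
  have Lin: "b \<in> B \<Longrightarrow> e b = (a, True) \<Longrightarrow> (a, b) \<in> L" for a b
    by (force simp: layer_arc_def L_def)
  have disj: "A \<inter> V = {}" "B \<subseteq> V" by (rule hyps)+
  have inner: "\<forall>v\<in>V - B. v \<in> K \<longleftrightarrow> (\<forall>w\<in>K. (v, w) \<notin> F)"
    using prems(1) Lout disj by blast
  \<comment> \<open>The vertex b has just one layer arc. As that arc enters b, all arcs leaving b
    belong to the inner forest.\<close>
  have red: "b \<in> K \<longleftrightarrow> b \<in> Y" if b: "b \<in> B" and e: "e b = (a', True)" for b a'
  proof -
    have "(b, w) \<notin> L" for w
    proof
      assume "(b, w) \<in> L"
      then obtain c where c: "c \<in> B" "(b, w) = layer_arc c (e c)" by (auto simp: L_def)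
      show False
        by (rule layer_arc_cases[OF hyps(4) c(1)]) (use b e c disj in auto)
    qed
    then have "b \<in> K \<longleftrightarrow> (\<forall>w\<in>K. (b, w) \<notin> F)"
      using prems(1) b disj by blast
    then show ?thesis using forest_layer.IH[OF inner b] by simp
  qed
  have YB: "Y \<subseteq> B" by (rule forest_red_subset[OF hyps(5)])
  have aV: "a \<notin> V" using disj prems(2) by blast
  show ?case
    unfolding L_def[symmetric]
  proof
    assume l: "\<forall>w\<in>K. (a, w) \<notin> L \<union> F"
    have "e b \<noteq> (a, True)" if b: "b \<in> Y" for b
    proof
      assume eb: "e b = (a, True)"
      have "b \<in> B" using YB b by blast
      then have "(a, b) \<in> L" "b \<in> K" using Lin eb red b by auto
      then show False using l by blast
    qed
    then show "a \<in> {a \<in> A. \<forall>b\<in>Y. e b \<noteq> (a, True)}" using prems(2) by simp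
  next
    assume r: "a \<in> {a \<in> A. \<forall>b\<in>Y. e b \<noteq> (a, True)}"
    show "\<forall>w\<in>K. (a, w) \<notin> L \<union> F"
    proof (intro ballI notI)
      fix w assume w: "w \<in> K" "(a, w) \<in> L \<union> F"
      then have "(a, w) \<in> L" using Fa aV by blast
      then have "w \<in> B" "e w = (a, True)" using Lout[of a w] aV disj by auto
      then show False using red w r by auto
    qed
  qed
qed auto

lemma forest_kernel_extend:
  assumes "rooted_forest A V F Y" "R \<subseteq> A"
  shows "\<exists>K \<subseteq> A \<union> V. K \<inter> A = R \<and> (\<forall>v\<in>V. v \<in> K \<longleftrightarrow> (\<forall>w\<in>K. (v, w) \<notin> F))"
  using assms
proof (induction arbitrary: R rule: rooted_forest.induct)
  case (forest_empty A)
  then show ?case by auto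
next
  case (forest_layer B V A e F Y)
  define L where "L = (\<lambda>b. layer_arc b (e b)) ` B"
  note hyps = forest_layer.hyps
  have Fa: "F \<subseteq> V \<times> V" by (rule forest_arcs_inner[OF hyps(5,2)])
  have La: "(v, w) \<in> L \<Longrightarrow> v \<in> B \<and> w \<in> A \<or> v \<in> A \<and> w \<in> B" for v w
  proof -
    assume "(v, w) \<in> L"
    then obtain b where b: "b \<in> B" "(v, w) = layer_arc b (e b)" by (auto simp: L_def)
    show "v \<in> B \<and> w \<in> A \<or> v \<in> A \<and> w \<in> B"
      by (rule layer_arc_cases[OF hyps(4) b(1)]) (use b in auto)
  qed
  have disj: "A \<inter> V = {}" "B \<subseteq> V" by (rule hyps)+
  \<comment> \<open>A layer vertex that is red in its own tree turns green exactly when its arc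
    leads to a root in R; one that is green in its own tree stays green.\<close>
  define RB where "RB = {b \<in> Y. \<forall>a\<in>R. (b, a) \<notin> L}"
  have YB: "Y \<subseteq> B" by (rule forest_red_subset[OF hyps(5)])
  then have "RB \<subseteq> B" by (auto simp: RB_def)
  from forest_layer.IH[OF this] obtain K where
    K: "K \<subseteq> B \<union> (V - B)" "K \<inter> B = RB" "\<forall>v\<in>V - B. v \<in> K \<longleftrightarrow> (\<forall>w\<in>K. (v, w) \<notin> F)" by blast
  have KV: "K \<subseteq> V" using K(1) disj by blast
  have "v \<in> K \<union> R \<longleftrightarrow> (\<forall>w\<in>K \<union> R. (v, w) \<notin> L \<union> F)" if v: "v \<in> V" for v
  proof -
    have vR: "v \<notin> R" using v disj forest_layer.prems by blast
    have RF: "(v, w) \<notin> F" if "w \<in> R" for w using Fa disj forest_layer.prems that by blast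
    show ?thesis
    proof (cases "v \<in> B")
      case True
      have 1: "(v, w) \<notin> L" if "w \<in> K" for w
        using La[of v w] that KV disj v by blast
      have 2: "(\<forall>w\<in>K. (v, w) \<notin> F) \<longleftrightarrow> v \<in> Y"
        by (rule forest_kernel_red[OF hyps(5) K(3) True])
      have "v \<in> K \<longleftrightarrow> v \<in> Y \<and> (\<forall>a\<in>R. (v, a) \<notin> L)" using K(2) True by (auto simp: RB_def)
      then show ?thesis using 1 2 RF vR by auto
    next
      case False
      have "(v, w) \<notin> L" for w using La[of v w] False v disj by blast
      then show ?thesis using K(3) False v vR RF by auto
    qed
  qed
  moreover have "(K \<union> R) \<inter> A = R" using KV disj forest_layer.prems by blast
  moreover have "K \<union> R \<subseteq> A \<union> V" using KV forest_layer.prems by blast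
  ultimately show ?case unfolding L_def[symmetric] by (intro exI[of _ "K \<union> R"]) simp
qed

text \<open>The inner arcs of M inherit the absence of leaves, so by induction there are none; then
  each layer vertex meets only its single layer arc. Cycles have no leaf, so this excludes
  them.\<close>

lemma forest_acyclic:
  assumes "rooted_forest A V F Y" "M \<subseteq> F"
    "\<And>x v. x \<in> M \<Longrightarrow> v \<in> {fst x, snd x} \<Longrightarrow> v \<in> V \<Longrightarrow> \<exists>y\<in>M. y \<noteq> x \<and> v \<in> {fst y, snd y}"
  shows "M = {}"
  using assms
proof (induction arbitrary: M rule: rooted_forest.induct)
  case (forest_layer B V A e F Y)
  define L where "L = (\<lambda>b. layer_arc b (e b)) ` B"
  note hyps = forest_layer.hyps and prems = forest_layer.prems[folded L_def]
  have Fa: "F \<subseteq> V \<times> V" by (rule forest_arcs_inner[OF hyps(5,2)])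
  have disj: "A \<inter> V = {}" "B \<subseteq> V" by (rule hyps)+
  have L: "x = layer_arc v (e v)" if x: "x \<in> L" "v \<in> {fst x, snd x}" and v: "v \<in> V" for x v
  proof -
    obtain b where b: "b \<in> B" "x = layer_arc b (e b)" using x by (auto simp: L_def)
    show ?thesis
      by (rule layer_arc_cases[OF hyps(4) b(1)]) (use b x v disj in auto)
  qed
  have Lb: "v \<in> B" if x: "x \<in> L" "v \<in> {fst x, snd x}" and v: "v \<in> V" for x v
  proof -
    obtain b where b: "b \<in> B" "x = layer_arc b (e b)" using x by (auto simp: L_def)
    show ?thesis
      by (rule layer_arc_cases[OF hyps(4) b(1)]) (use b x v disj in auto)
  qed
  have "M \<inter> F = {}"
  proof (rule forest_layer.IH)
    fix x v assume x: "x \<in> M \<inter> F" "v \<in> {fst x, snd x}" "v \<in> V - B"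
    then obtain y where y: "y \<in> M" "y \<noteq> x" "v \<in> {fst y, snd y}"
      using prems(2)[of x v] by auto
    then have "y \<in> F" using Lb[of y v] x prems(1) by blast
    then show "\<exists>y\<in>M \<inter> F. y \<noteq> x \<and> v \<in> {fst y, snd y}" using y by blast
  qed simp
  then have subL: "M \<subseteq> L" using prems(1) by blast
  show "M = {}"
  proof (rule ccontr)
    assume "M \<noteq> {}"
    then obtain x where x: "x \<in> M" by blast
    then obtain b where b: "b \<in> B" "x = layer_arc b (e b)" using subL by (auto simp: L_def)
    have bx: "b \<in> {fst x, snd x}" by (simp add: b layer_arc_def)
    have bV: "b \<in> V" using b disj by blast
    obtain y where y: "y \<in> M" "y \<noteq> x" "b \<in> {fst y, snd y}"
      using prems(2)[OF x bx bV] by blast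
    then show False using L[of y b] subL b bV by auto
  qed
qed auto

lemma forest_connected:
  assumes "rooted_forest A V F Y" "v \<in> V"
  shows "\<exists>a\<in>A. (v, a) \<in> (F \<union> F\<inverse>)\<^sup>*"
  using assms
proof (induction arbitrary: v rule: rooted_forest.induct)
  case (forest_layer B V A e F Y)
  define L where "L = (\<lambda>b. layer_arc b (e b)) ` B"
  note hyps = forest_layer.hyps
  obtain b where b: "b \<in> B" "(v, b) \<in> (F \<union> F\<inverse>)\<^sup>*"
    using forest_layer.IH[of v] forest_layer.prems by (cases "v \<in> B") auto
  have "\<exists>a\<in>A. (b, a) \<in> L \<union> L\<inverse>"
    by (rule layer_arc_cases[OF hyps(4) b(1)]) (use b in \<open>force simp: L_def\<close>)+
  then obtain a where a: "a \<in> A" "(b, a) \<in> L \<union> L\<inverse>" by blast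
  have "(v, b) \<in> (L \<union> F \<union> (L \<union> F)\<inverse>)\<^sup>*"
    using b(2) by (rule rtrancl_mono[THEN subsetD, rotated]) auto
  then have "(v, a) \<in> (L \<union> F \<union> (L \<union> F)\<inverse>)\<^sup>*"
    by (rule rtrancl_into_rtrancl) (use a in auto)
  then show ?case using a(1) unfolding L_def[symmetric] by blast
qed auto

text \<open>Adding \<open>A \<times> A\<close> treats all roots as joined. This form of the bridge
  condition passes to the inner forest: any two vertices of B are already connected through their
  layer arcs and \<open>A \<times> A\<close>, so joining B creates no new connections.\<close>

lemma forestI_bridges:
  assumes "finite V" "A \<inter> V = {}" "E \<subseteq> (A \<union> V) \<times> (A \<union> V)"
    and "\<And>v. v \<in> V \<Longrightarrow> \<exists>a\<in>A. (v, a) \<in> (E \<union> E\<inverse>)\<^sup>*"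
    and "\<And>u v. (u, v) \<in> E \<Longrightarrow> (u, v) \<notin> ((E - {(u, v)}) \<union> (E - {(u, v)})\<inverse> \<union> A \<times> A)\<^sup>*"
  shows "\<exists>Y. rooted_forest A V E Y"
  using assms
proof (induction V arbitrary: A E rule: finite_psubset_induct)
  case (psubset V)
  note AV = psubset.prems(1) and EAV = psubset.prems(2) and conn = psubset.prems(3) and bridge = psubset.prems(4)
  have EA: "(u, v) \<notin> E" if "u \<in> A" "v \<in> A" for u v
    using bridge[of u v] that by blast
  show ?case
  proof (cases "V = {}")
    case True
    then have "E = {}" using EAV EA by auto
    then show ?thesis using True forest_empty by blast
  next
    case False
    define B where "B = {b \<in> V. \<exists>a\<in>A. (a, b) \<in> E \<or> (b, a) \<in> E}"
    define E' where "E' = E \<inter> V \<times> V"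
    have BV: "B \<subseteq> V" by (auto simp: B_def)
    have reach: "\<exists>b\<in>B. (x, b) \<in> (E' \<union> E'\<inverse>)\<^sup>*" if "(x, a) \<in> (E \<union> E\<inverse>)\<^sup>*" "a \<in> A" "x \<in> V" for x a
      using that
    proof (induction rule: converse_rtrancl_induct)
      case base
      then show ?case using AV by blast
    next
      case (step x y)
      show ?case
      proof (cases "y \<in> A")
        case True
        then have "x \<in> B" using step by (auto simp: B_def)
        then show ?thesis by blast
      next
        case False
        then have y: "y \<in> V" using step.hyps(1) EAV by blast
        then obtain b where "b \<in> B" "(y, b) \<in> (E' \<union> E'\<inverse>)\<^sup>*" using step by blast
        moreover have "(x, y) \<in> E' \<union> E'\<inverse>" using step y by (auto simp: E'_def)
        ultimately show ?thesis by (meson converse_rtrancl_into_rtrancl)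
      qed
    qed
    have Bne: "B \<noteq> {}" using False conn reach by blast
    \<comment> \<open>The choice turns out to be unique: a second arc between b and a root could be
      bypassed through the chosen arc and \<open>A \<times> A\<close>, against the bridge
      condition.\<close>
    define e where "e = restrict (\<lambda>b. SOME p. fst p \<in> A \<and> layer_arc b p \<in> E) B"
    have eE: "fst (e b) \<in> A \<and> layer_arc b (e b) \<in> E" if b: "b \<in> B" for b
    proof -
      obtain a where a: "a \<in> A" "(a, b) \<in> E \<or> (b, a) \<in> E" using b by (auto simp: B_def)
      then have "fst (a, (a, b) \<in> E) \<in> A \<and> layer_arc b (a, (a, b) \<in> E) \<in> E"
        by (auto simp: layer_arc_def)
      then have "fst (SOME p. fst p \<in> A \<and> layer_arc b p \<in> E) \<in> A \<and> layer_arc b (SOME p. fst p \<in> A \<and> layer_arc b p \<in> E) \<in> E"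
        by (rule someI)
      then show ?thesis using b by (simp add: e_def)
    qed
    define L where "L = (\<lambda>b. layer_arc b (e b)) ` B"
    have ePi: "e \<in> B \<rightarrow>\<^sub>E A \<times> UNIV"
      using eE by (auto simp: PiE_iff e_def mem_Times_iff)
    have LE: "L \<subseteq> E" using eE by (auto simp: L_def)
    have Ldir: "(a, b) \<in> L" if ab: "(a, b) \<in> E" "a \<in> A" "b \<in> V" for a b
    proof (rule ccontr)
      assume n: "(a, b) \<notin> L"
      have bB: "b \<in> B" using ab by (auto simp: B_def)
      let ?R = "(E - {(a, b)}) \<union> (E - {(a, b)})\<inverse> \<union> A \<times> A"
      have ne: "layer_arc b (e b) \<noteq> (a, b)"
        using n imageI[OF bB, of "\<lambda>b. layer_arc b (e b)"] unfolding L_def by auto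
      have "(a, fst (e b)) \<in> ?R" using ab eE[OF bB] by blast
      moreover have "(fst (e b), b) \<in> ?R"
        using eE[OF bB] ne by (auto simp: layer_arc_def split: if_splits)
      ultimately have "(a, b) \<in> ?R\<^sup>*" by (meson converse_rtrancl_into_rtrancl r_into_rtrancl)
      then show False using bridge ab by blast
    qed
    have Ldir': "(b, a) \<in> L" if ab: "(b, a) \<in> E" "a \<in> A" "b \<in> V" for a b
    proof (rule ccontr)
      assume n: "(b, a) \<notin> L"
      have bB: "b \<in> B" using ab by (auto simp: B_def)
      let ?R = "(E - {(b, a)}) \<union> (E - {(b, a)})\<inverse> \<union> A \<times> A"
      have ne: "layer_arc b (e b) \<noteq> (b, a)"
        using n imageI[OF bB, of "\<lambda>b. layer_arc b (e b)"] unfolding L_def by auto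
      have "(fst (e b), a) \<in> ?R" using ab eE[OF bB] by blast
      moreover have "(b, fst (e b)) \<in> ?R"
        using eE[OF bB] ne by (auto simp: layer_arc_def split: if_splits)
      ultimately have "(b, a) \<in> ?R\<^sup>*" by (meson converse_rtrancl_into_rtrancl r_into_rtrancl)
      then show False using bridge ab by blast
    qed
    have LE': "L \<inter> E' = {}"
    proof -
      have "layer_arc b (e b) \<notin> V \<times> V" if "b \<in> B" for b
        using eE[OF that] AV by (auto simp: layer_arc_def)
      then have "x \<notin> V \<times> V" if "x \<in> L" for x
        using that unfolding L_def by (elim imageE) simp
      then show ?thesis by (auto simp: E'_def)
    qed
    have EL: "E = L \<union> E'"
    proof (intro equalityI subsetI)
      fix x assume x: "x \<in> E"
      obtain u v where uv: "x = (u, v)" by (cases x)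
      have "u \<in> A \<union> V" "v \<in> A \<union> V" using EAV x uv by auto
      then show "x \<in> L \<union> E'"
        using x EA[of u v] Ldir[of u v] Ldir'[of u v] unfolding uv E'_def by blast
    qed (use LE in \<open>auto simp: E'_def\<close>)
    have "\<exists>Y. rooted_forest B (V - B) E' Y"
    proof (rule psubset.IH)
      show "V - B \<subset> V" using Bne BV by blast
      show "B \<inter> (V - B) = {}" by blast
      show "E' \<subseteq> (B \<union> (V - B)) \<times> (B \<union> (V - B))" using BV by (auto simp: E'_def)
      show "\<exists>b\<in>B. (v, b) \<in> (E' \<union> E'\<inverse>)\<^sup>*" if "v \<in> V - B" for v
        using conn[of v] reach that by blast
      show "(u, v) \<notin> ((E' - {(u, v)}) \<union> (E' - {(u, v)})\<inverse> \<union> B \<times> B)\<^sup>*" if uv: "(u, v) \<in> E'" for u v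
      proof
        let ?R = "(E - {(u, v)}) \<union> (E - {(u, v)})\<inverse> \<union> A \<times> A"
        let ?R' = "(E' - {(u, v)}) \<union> (E' - {(u, v)})\<inverse> \<union> B \<times> B"
        assume "(u, v) \<in> ?R'\<^sup>*"
        have step: "(b, fst (e b)) \<in> ?R" "(fst (e b), b) \<in> ?R" if "b \<in> B" for b
        proof -
          have "layer_arc b (e b) \<noteq> (u, v)" using LE' uv that by (auto simp: L_def)
          then show "(b, fst (e b)) \<in> ?R" "(fst (e b), b) \<in> ?R"
            using eE[OF that] by (auto simp: layer_arc_def split: if_splits)
        qed
        have "B \<times> B \<subseteq> ?R\<^sup>*"
        proof
          fix x assume "x \<in> B \<times> B"
          then obtain b c where bc: "x = (b, c)" "b \<in> B" "c \<in> B" by blast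
          have "(fst (e b), fst (e c)) \<in> ?R" using eE bc by blast
          then show "x \<in> ?R\<^sup>*" unfolding bc(1)
            using step(1)[OF bc(2)] step(2)[OF bc(3)]
            by (meson converse_rtrancl_into_rtrancl r_into_rtrancl)
        qed
        moreover have "(E' - {(u, v)}) \<union> (E' - {(u, v)})\<inverse> \<subseteq> ?R\<^sup>*" by (auto simp: E'_def)
        ultimately have "?R' \<subseteq> ?R\<^sup>*" by blast
        then have "?R'\<^sup>* \<subseteq> ?R\<^sup>*" by (rule rtrancl_subset_rtrancl)
        then have "(u, v) \<in> ?R\<^sup>*" using \<open>(u, v) \<in> ?R'\<^sup>*\<close> by blast
        then show False using bridge[of u v] uv by (auto simp: E'_def)
      qed
    qed
    then obtain Y where "rooted_forest B (V - B) E' Y" by blast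
    from forest_layer[OF Bne BV AV ePi this] show ?thesis unfolding L_def[symmetric] EL[symmetric] by blast
  qed
qed

section \<open>Underlying cycles and circuits\<close>

lemma weakly_connected_iff:
  assumes "pair_digraph G"
  shows "Digraph_Component.connected (with_proj G) \<longleftrightarrow>
    pverts G \<noteq> {} \<and> (\<forall>u\<in>pverts G. \<forall>v\<in>pverts G. (u, v) \<in> (parcs G \<union> (parcs G)\<inverse>)\<^sup>*)"
proof -
  interpret pair_digraph G by (rule assms)
  have arcs: "(\<Union>e\<in>parcs G. {e, (snd e, fst e)}) = parcs G \<union> (parcs G)\<inverse>" by force
  have "(u, v) \<in> rtrancl_on (pverts G) (parcs G \<union> (parcs G)\<inverse>) \<longleftrightarrow> (u, v) \<in> (parcs G \<union> (parcs G)\<inverse>)\<^sup>*"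
    if "u \<in> pverts G" "v \<in> pverts G" for u v
  proof
    assume "(u, v) \<in> (parcs G \<union> (parcs G)\<inverse>)\<^sup>*"
    then show "(u, v) \<in> rtrancl_on (pverts G) (parcs G \<union> (parcs G)\<inverse>)"
      using that by (rule rtrancl_consistent_rtrancl_on) (auto dest: wellformed')
  qed (rule rtrancl_on_rtranclI)
  then show ?thesis
    unfolding Digraph_Component.connected_def strongly_connected_def reachable_def
    by (simp add: parcs_mk_symmetric arcs)
qed

lemma rtrancl_simple_path:
  assumes "(u, v) \<in> R\<^sup>*"
  shows "\<exists>vs. vs \<noteq> [] \<and> hd vs = u \<and> last vs = v \<and> distinct vs \<and> successively (\<lambda>a b. (a, b) \<in> R) vs"
  using assms
proof (induction rule: converse_rtrancl_induct)
  case base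
  show ?case by (intro exI[of _ "[v]"]) simp
next
  case (step u y)
  then obtain vs where vs: "vs \<noteq> []" "hd vs = y" "last vs = v" "distinct vs" "successively (\<lambda>a b. (a, b) \<in> R) vs"
    by blast
  show ?case
  proof (cases "u \<in> set vs")
    case True
    then obtain as bs where ab: "vs = as @ u # bs" by (meson split_list)
    show ?thesis
      by (rule exI[of _ "u # bs"]) (use vs ab in \<open>auto simp: successively_append_iff\<close>)
  next
    case False
    then show ?thesis
      by (intro exI[of _ "u # vs"]) (use vs step.hyps in \<open>auto simp: successively_Cons\<close>)
  qed
qed

lemma successively_nth:
  "successively P xs \<Longrightarrow> Suc i < length xs \<Longrightarrow> P (xs ! i) (xs ! Suc i)"
proof (induction P xs arbitrary: i rule: successively.induct)
  case (3 P x y xs)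
  then show ?case by (cases i) auto
qed auto

text \<open>A simple path that avoids the arc closes up with it to a cycle. The path may consist of
  the opposite arc alone, which gives a cycle of length 2.\<close>

lemma underlying_cycle_through_arc:
  assumes G: "pair_digraph G" and e: "(u, v) \<in> parcs G"
    and conn: "(u, v) \<in> ((parcs G - {(u, v)}) \<union> (parcs G - {(u, v)})\<inverse>)\<^sup>*"
  shows "\<exists>C\<in>underlying_cycles G. (u, v) \<in> C"
proof -
  interpret pair_digraph G by (rule G)
  let ?E = "parcs G - {(u, v)}"
  obtain vs where vs: "vs \<noteq> []" "hd vs = u" "last vs = v" "distinct vs"
      "successively (\<lambda>a b. (a, b) \<in> ?E \<union> ?E\<inverse>) vs"
    using rtrancl_simple_path[OF conn] by blast
  have uv: "u \<noteq> v" using pair_no_loops[OF e] by simp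
  define m where "m = length vs - 1"
  have len: "length vs = Suc m" using vs(1) by (cases vs) (auto simp: m_def)
  have v0: "vs ! 0 = u" "vs ! m = v" using vs by (auto simp: hd_conv_nth last_conv_nth m_def)
  define f where "f i = (if (vs ! i, vs ! Suc i) \<in> ?E then (vs ! i, vs ! Suc i) else (vs ! Suc i, vs ! i))" for i
  have fE: "f i \<in> ?E" if "i < m" for i
    using successively_nth[OF vs(5), of i] that len by (auto simp: f_def)
  have fends: "{fst (f i), snd (f i)} = {vs ! i, vs ! Suc i}" for i by (auto simp: f_def)
  define es where "es = map f [0..<m] @ [(u, v)]"
  have "inj_on f {0..<m}"
  proof (rule inj_onI)
    fix i j assume ij: "i \<in> {0..<m}" "j \<in> {0..<m}" "f i = f j"
    then have "{vs ! i, vs ! Suc i} = {vs ! j, vs ! Suc j}" using fends by metis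
    then have "vs ! i = vs ! j \<or> vs ! i = vs ! Suc j \<and> vs ! Suc i = vs ! j"
      by (auto simp: doubleton_eq_iff)
    then show "i = j"
      using ij len vs(4) by (auto simp: nth_eq_iff_index_eq)
  qed
  moreover have "(u, v) \<notin> f ` {0..<m}" using fE by force
  ultimately have "distinct es" by (auto simp: es_def distinct_map)
  moreover have "set es \<subseteq> parcs G" using fE e by (auto simp: es_def)
  moreover have "set vs \<subseteq> pverts G"
  proof
    fix x assume "x \<in> set vs"
    then obtain i where i: "i < length vs" "x = vs ! i" by (auto simp: in_set_conv_nth)
    show "x \<in> pverts G"
    proof (cases "i = m")
      case True
      then show ?thesis using i v0 e wellformed' by auto
    next
      case False
      then have "f i \<in> parcs G" using fE[of i] i len by auto
      moreover have "x \<in> {fst (f i), snd (f i)}" unfolding fends using i by simp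
      ultimately show ?thesis using arc_fst_in_verts[of "f i"] arc_snd_in_verts[of "f i"] by auto
    qed
  qed
  moreover have "{fst (es ! i), snd (es ! i)} = {vs ! i, vs ! (Suc i mod length es)}" if "i < length es" for i
  proof (cases "i = m")
    case True
    then show ?thesis using v0 by (auto simp: es_def nth_append)
  next
    case False
    then have "i < m" using that by (simp add: es_def)
    then show ?thesis using fends[of i] by (simp add: es_def nth_append)
  qed
  ultimately have "underlying_cycle G vs es"
    unfolding underlying_cycle_def using vs len by (auto simp: es_def)
  then have "set es \<in> underlying_cycles G" by (auto simp: underlying_cycles_def)
  then show ?thesis by (auto simp: es_def)
qed

text \<open>Absence of leaves is the form in which cycles meet the forest: it excludes all forest
  arcs and then forces the whole circuit. Cycles of length 1 would be loops.\<close>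

lemma underlying_cycle_degree:
  assumes G: "pair_digraph G" and C: "underlying_cycle G vs es"
    and x: "x \<in> set es" and v: "v \<in> {fst x, snd x}"
  shows "\<exists>y\<in>set es. y \<noteq> x \<and> v \<in> {fst y, snd y}"
proof -
  interpret pair_digraph G by (rule G)
  define k where "k = length es"
  note C' = C[unfolded underlying_cycle_def]
  have ends: "{fst (es ! i), snd (es ! i)} = {vs ! i, vs ! (Suc i mod k)}" if "i < k" for i
    using C' that by (simp add: k_def)
  obtain i where i: "i < k" "x = es ! i" using x by (auto simp: in_set_conv_nth k_def)
  have k1: "k \<noteq> 1"
  proof
    assume k: "k = 1"
    then have "fst x = snd x" using ends[of i] i by auto
    then show False using C' x pair_no_loops[of x] by blast
  qed
  then have k2: "k \<ge> 2" using i by linarith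
  have dist: "es ! a \<noteq> es ! b" if "a < k" "b < k" "a \<noteq> b" for a b
    using C' that by (simp add: k_def nth_eq_iff_index_eq)
  have vc: "v = vs ! i \<or> v = vs ! (Suc i mod k)" using ends[OF i(1)] v i(2) by blast
  show ?thesis
  proof (cases "v = vs ! (Suc i mod k)")
    case True
    have j: "Suc i mod k < k" "Suc i mod k \<noteq> i" using k2 i(1) by (auto simp: mod_Suc)
    show ?thesis
    proof (intro bexI conjI)
      show "es ! (Suc i mod k) \<noteq> x" using dist j i by blast
      show "v \<in> {fst (es ! (Suc i mod k)), snd (es ! (Suc i mod k))}" unfolding ends[OF j(1)] using True by simp
      show "es ! (Suc i mod k) \<in> set es" using j by (simp add: k_def)
    qed
  next
    case False
    then have vi: "v = vs ! i" using vc by simp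
    define j where "j = (if i = 0 then k - 1 else i - 1)"
    have j: "j < k" "j \<noteq> i" "Suc j mod k = i" using k2 i(1) by (auto simp: j_def)
    show ?thesis
    proof (intro bexI conjI)
      show "es ! j \<noteq> x" using dist j i by blast
      show "v \<in> {fst (es ! j), snd (es ! j)}" unfolding ends[OF j(1)] using vi j by simp
      show "es ! j \<in> set es" using j by (simp add: k_def)
    qed
  qed
qed

section \<open>Directed circuits as cyclic lists\<close>

definition circuit_arcs :: "'a list \<Rightarrow> 'a rel" where
  "circuit_arcs xs = set (zip xs (rotate1 xs))"

lemma circuit_arcs_nth:
  "circuit_arcs xs = {(xs ! i, xs ! (Suc i mod length xs)) | i. i < length xs}"
  unfolding circuit_arcs_def set_zip by (auto simp: nth_rotate1)

lemma circuit_arcs_subset: "circuit_arcs xs \<subseteq> set xs \<times> set xs"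
  unfolding circuit_arcs_def by (auto dest: set_zip_leftD set_zip_rightD)

lemma Domain_circuit_arcs: "fst ` circuit_arcs xs = set xs"
proof -
  have "map fst (zip xs (rotate1 xs)) = xs" by simp
  then show ?thesis unfolding circuit_arcs_def by (metis set_map)
qed

lemma circuit_arcs_out:
  assumes "distinct xs" "i < length xs"
  shows "(xs ! i, w) \<in> circuit_arcs xs \<longleftrightarrow> w = xs ! (Suc i mod length xs)"
  using assms by (auto simp: circuit_arcs_nth nth_eq_iff_index_eq)

lemma circuit_arcs_irrefl:
  assumes "distinct xs" "length xs \<ge> 2"
  shows "(x, x) \<notin> circuit_arcs xs"
proof
  assume "(x, x) \<in> circuit_arcs xs"
  then obtain i where i: "i < length xs" "xs ! i = xs ! (Suc i mod length xs)"
    by (auto simp: circuit_arcs_nth)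
  then have "i = Suc i mod length xs"
    using assms by (subst (asm) nth_eq_iff_index_eq) (auto intro!: mod_less_divisor)
  then show False using assms i by (auto simp: mod_Suc split: if_splits)
qed

lemma circuit_arcs_rotate: "circuit_arcs (rotate n xs) = circuit_arcs xs"
proof -
  have "circuit_arcs (rotate1 xs) = circuit_arcs xs" for xs :: "'a list"
  proof (cases xs rule: list.exhaust[case_names Nil Cons])
    case (Cons x zs)
    show ?thesis
    proof (cases zs)
      case Nil then show ?thesis by (simp add: Cons circuit_arcs_def)
    next
      case (Cons y ws)
      have "zip ((y # ws) @ [x]) ((ws @ [x]) @ [y]) = zip (y # ws) (ws @ [x]) @ [(x, y)]"
        by (subst zip_append) auto
      then show ?thesis by (simp add: circuit_arcs_def \<open>xs = x # zs\<close> Cons)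
    qed
  qed simp
  then show ?thesis by (induction n) simp_all
qed

text \<open>Every vertex has a single outgoing circuit arc, so the list can be read off from its
  start.\<close>

lemma circuit_arcs_inject:
  assumes d: "distinct xs" "distinct ys" and eq: "circuit_arcs xs = circuit_arcs ys" and hd: "hd xs = hd ys"
  shows "xs = ys"
proof -
  have "set xs = set ys" using eq Domain_circuit_arcs by metis
  then have len: "length xs = length ys" using d by (metis distinct_card)
  have "xs ! i = ys ! i" if "i < length xs" for i
    using that
  proof (induction i)
    case 0
    then show ?case using hd len by (metis hd_conv_nth length_0_conv not_less_zero)
  next
    case (Suc i)
    have "(xs ! i, xs ! Suc i) \<in> circuit_arcs xs"
      using Suc.prems d circuit_arcs_out[of xs i] by simp
    then have "(ys ! i, xs ! Suc i) \<in> circuit_arcs ys" using Suc eq by simp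
    then show ?case using Suc.prems len d circuit_arcs_out[of ys i] by simp
  qed
  then show ?thesis using len by (intro nth_equalityI) auto
qed

lemma circuit_arcs_connected:
  assumes "x \<in> set xs" "y \<in> set xs"
  shows "(x, y) \<in> (circuit_arcs xs \<union> (circuit_arcs xs)\<inverse>)\<^sup>*"
proof -
  let ?R = "circuit_arcs xs \<union> (circuit_arcs xs)\<inverse>"
  have 0: "(xs ! 0, xs ! i) \<in> ?R\<^sup>*" if "i < length xs" for i
    using that
  proof (induction i)
    case (Suc i)
    have "(xs ! i, xs ! Suc i) \<in> circuit_arcs xs"
      unfolding circuit_arcs_nth using Suc.prems by (auto intro!: exI[of _ i])
    then show ?case using Suc by (meson Suc_lessD UnI1 rtrancl.rtrancl_into_rtrancl)
  qed simp
  have sym: "sym (?R\<^sup>*)" by (intro sym_rtrancl sym_Un_converse)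
  obtain i j where "i < length xs" "x = xs ! i" "j < length xs" "y = xs ! j"
    using assms by (auto simp: in_set_conv_nth)
  then have "(x, xs ! 0) \<in> ?R\<^sup>*" "(xs ! 0, y) \<in> ?R\<^sup>*" using 0 sym by (auto dest: symD)
  then show ?thesis by (rule rtrancl_trans)
qed

text \<open>Without leaves, each arc of N forces the next one along the circuit, until all arcs are
  reached.\<close>

lemma circuit_arcs_degree:
  assumes d: "distinct xs" and N: "N \<subseteq> circuit_arcs xs" "N \<noteq> {}"
    and deg: "\<And>x v. x \<in> N \<Longrightarrow> v \<in> {fst x, snd x} \<Longrightarrow> \<exists>y\<in>N. y \<noteq> x \<and> v \<in> {fst y, snd y}"
  shows "N = circuit_arcs xs"
proof -
  define k where "k = length xs"
  define a where "a i = (xs ! i, xs ! (Suc i mod k))" for i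
  have arcs: "circuit_arcs xs = a ` {..<k}" by (auto simp: circuit_arcs_nth a_def k_def)
  have k: "k > 0" using N by (auto simp: arcs)
  have step: "a (Suc i mod k) \<in> N" if i: "i < k" "a i \<in> N" for i
  proof -
    let ?v = "xs ! (Suc i mod k)"
    obtain y where y: "y \<in> N" "y \<noteq> a i" "?v \<in> {fst y, snd y}"
      using deg[OF i(2), of ?v] by (auto simp: a_def)
    obtain j where j: "j < k" "y = a j" using y N arcs by auto
    have "xs ! j = ?v \<or> xs ! (Suc j mod k) = ?v" using y j by (auto simp: a_def)
    then have "j = Suc i mod k \<or> Suc j mod k = Suc i mod k"
      using d j k by (auto simp: nth_eq_iff_index_eq k_def)
    moreover have "Suc j mod k = Suc i mod k \<Longrightarrow> j = i"
      using i j by (auto simp: mod_Suc split: if_splits)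
    ultimately show ?thesis using y j by auto
  qed
  obtain z where z: "z \<in> N" using N(2) by blast
  then obtain i0 where i0: "i0 < k" "a i0 \<in> N" using N(1) arcs by auto
  have all: "a ((i0 + n) mod k) \<in> N" for n
  proof (induction n)
    case (Suc n)
    then show ?case using step[of "(i0 + n) mod k"] k by (simp add: mod_Suc_eq)
  qed (use i0 in simp)
  have "a i \<in> N" if "i < k" for i
  proof -
    have "(i0 + (k - i0 + i)) mod k = i" using i0 that by (simp add: mod_add_self1)
    then show ?thesis using all[of "k - i0 + i"] by simp
  qed
  then show ?thesis using N(1) arcs by auto
qed

lemma pcas_zip: "pcas u (zip (u # zs) (zs @ [w])) w"
  by (induction zs arbitrary: u) auto

lemma pawalk_verts_zip: "pawalk_verts u (zip (u # zs) (zs @ [w])) = u # zs @ [w]"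
  by (induction zs arbitrary: u) auto

lemma pcas_decomp:
  "pcas u p w \<Longrightarrow> p \<noteq> [] \<Longrightarrow> pawalk_verts u p = map fst p @ [w] \<and> map snd p = tl (map fst p) @ [w] \<and> fst (hd p) = u"
proof (induction p arbitrary: u)
  case (Cons a p)
  then show ?case by (cases p) auto
qed simp

lemma cycle_iff:
  "pre_digraph.cycle (with_proj G) p \<longleftrightarrow>
    (\<exists>u. u \<in> pverts G \<and> set p \<subseteq> parcs G \<and> pcas u p u \<and> distinct (tl (pawalk_verts u p)) \<and> p \<noteq> [])"
  unfolding pre_digraph.cycle_def pre_digraph.awalk_def
  by (simp add: cas_with_proj_eq awalk_verts_with_proj_eq)

lemma circuit_arcs_directed:
  assumes "distinct xs" "xs \<noteq> []" "circuit_arcs xs \<subseteq> parcs G" "set xs \<subseteq> pverts G"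
  shows "circuit_arcs xs \<in> directed_circuits G"
proof -
  obtain u zs where xs: "xs = u # zs" using assms(2) by (cases xs) auto
  define p where "p = zip (u # zs) (zs @ [u])"
  have "set p = circuit_arcs xs" by (simp add: p_def circuit_arcs_def xs)
  moreover have "pre_digraph.cycle (with_proj G) p"
    unfolding cycle_iff
  proof (intro exI[of _ u] conjI)
    show "distinct (tl (pawalk_verts u p))" using assms(1) unfolding p_def pawalk_verts_zip by (simp add: xs)
    show "pcas u p u" unfolding p_def by (rule pcas_zip)
    show "p \<noteq> []" by (cases zs) (auto simp: p_def)
  qed (use assms xs \<open>set p = _\<close> in auto)
  ultimately show ?thesis by (auto simp: directed_circuits_def)
qed

lemma directed_circuitE:
  assumes G: "pair_digraph G" and C: "C \<in> directed_circuits G"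
  obtains xs where "distinct xs" "length xs \<ge> 2" "set xs \<subseteq> pverts G" "C = circuit_arcs xs" "C \<subseteq> parcs G"
proof -
  interpret pair_digraph G by (rule G)
  obtain p u where p: "C = set p" "u \<in> pverts G" "set p \<subseteq> parcs G" "pcas u p u" "distinct (tl (pawalk_verts u p))" "p \<noteq> []"
    using C unfolding directed_circuits_def cycle_iff by auto
  note dec = pcas_decomp[OF p(4,6)]
  define xs where "xs = map fst p"
  have ne: "xs \<noteq> []" "hd xs = u" using p(6) dec by (auto simp: xs_def hd_map)
  have rot: "map snd p = rotate1 xs" using dec ne by (simp add: xs_def rotate1_hd_tl)
  have "p = zip xs (map snd p)" by (simp add: xs_def zip_map_fst_snd)
  then have "p = zip xs (rotate1 xs)" unfolding rot .
  then have "C = circuit_arcs xs" using p(1) by (simp add: circuit_arcs_def)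
  moreover have "distinct (rotate1 xs)" using p(5) dec ne by (simp add: xs_def rotate1_hd_tl)
  then have dxs: "distinct xs" by simp
  moreover have "length xs \<ge> 2"
  proof (rule ccontr)
    assume "\<not> 2 \<le> length xs"
    then obtain x where "xs = [x]" using ne by (cases xs; cases "tl xs") auto
    then have "(x, x) \<in> parcs G" using \<open>C = circuit_arcs xs\<close> p by (auto simp: circuit_arcs_def)
    then show False using pair_no_loops by force
  qed
  moreover have "set xs \<subseteq> pverts G" unfolding xs_def set_map using p(3) arc_fst_in_verts by blast
  ultimately show ?thesis using that p by blast
qed

section \<open>Structure of unicircuit digraphs\<close>

text \<open>Used with the circuit as C, or with a single vertex and C empty. As C connects A, an arc
  outside C that violates the bridge condition would lie on a cycle not contained in C.\<close>

lemma unicircuit_remove_core: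
  assumes G: "unicircuit G" and A: "A \<subseteq> pverts G" "A \<noteq> {}"
    and C: "C \<subseteq> parcs G" "C \<subseteq> A \<times> A" "A \<times> A \<subseteq> (C \<union> C\<inverse>)\<^sup>*"
    and cyc: "\<And>D. D \<in> underlying_cycles G \<Longrightarrow> D \<subseteq> C"
  shows "\<exists>Y. rooted_forest A (pverts G - A) (parcs G - C) Y"
proof (rule forestI_bridges)
  have pd: "pair_digraph G" using G by (simp add: unicircuit_def)
  then interpret pair_digraph G .
  have conn: "(u, v) \<in> (parcs G \<union> (parcs G)\<inverse>)\<^sup>*" if "u \<in> pverts G" "v \<in> pverts G" for u v
    using G that weakly_connected_iff[OF pd] unfolding unicircuit_def by blast
  let ?E = "parcs G - C"
  show "finite (pverts G - A)" using pair_finite_verts by simp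
  show "A \<inter> (pverts G - A) = {}" by blast
  show "?E \<subseteq> (A \<union> (pverts G - A)) \<times> (A \<union> (pverts G - A))"
    using wellformed' by auto
  have reach: "\<exists>a\<in>A. (x, a) \<in> (?E \<union> ?E\<inverse>)\<^sup>*" if "(x, a0) \<in> (parcs G \<union> (parcs G)\<inverse>)\<^sup>*" "a0 \<in> A" for x a0
    using that
  proof (induction rule: converse_rtrancl_induct)
    case (step x y)
    show ?case
    proof (cases "x \<in> A")
      case False
      then have "(x, y) \<in> ?E \<union> ?E\<inverse>" using step.hyps(1) C(2) by blast
      then show ?thesis using step.IH[OF step.prems] by (meson converse_rtrancl_into_rtrancl)
    qed blast
  qed blast
  show "\<exists>a\<in>A. (v, a) \<in> (?E \<union> ?E\<inverse>)\<^sup>*" if "v \<in> pverts G - A" for v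
    using that A conn reach by blast
  show "(u, v) \<notin> ((?E - {(u, v)}) \<union> (?E - {(u, v)})\<inverse> \<union> A \<times> A)\<^sup>*" if uv: "(u, v) \<in> ?E" for u v
  proof
    let ?P = "parcs G - {(u, v)}"
    let ?R = "(?E - {(u, v)}) \<union> (?E - {(u, v)})\<inverse> \<union> A \<times> A"
    assume r: "(u, v) \<in> ?R\<^sup>*"
    have "C \<union> C\<inverse> \<subseteq> ?P \<union> ?P\<inverse>" using uv C(1) by blast
    then have "A \<times> A \<subseteq> (?P \<union> ?P\<inverse>)\<^sup>*" using C(3) rtrancl_mono by blast
    then have "?R \<subseteq> (?P \<union> ?P\<inverse>)\<^sup>*" by blast
    then have "?R\<^sup>* \<subseteq> (?P \<union> ?P\<inverse>)\<^sup>*" by (rule rtrancl_subset_rtrancl)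
    then have "(u, v) \<in> (?P \<union> ?P\<inverse>)\<^sup>*" using r by blast
    then obtain D where "D \<in> underlying_cycles G" "(u, v) \<in> D"
      using underlying_cycle_through_arc[OF pd] uv by blast
    then show False using cyc uv by blast
  qed
qed

definition circuit_forest :: "'a list \<Rightarrow> 'a set \<Rightarrow> 'a rel \<Rightarrow> 'a pair_pre_digraph" where
  "circuit_forest xs V F = \<lparr>pverts = set xs \<union> V, parcs = circuit_arcs xs \<union> F\<rparr>"

lemma unicircuit_cycleE:
  assumes G: "unicircuit G" and ne: "underlying_cycles G \<noteq> {}"
  obtains xs F Y where "distinct xs" "length xs \<ge> 2" "set xs \<subseteq> pverts G"
    "rooted_forest (set xs) (pverts G - set xs) F Y" "G = circuit_forest xs (pverts G - set xs) F"
proof -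
  have pd: "pair_digraph G" using G by (simp add: unicircuit_def)
  obtain C where C: "C \<in> underlying_cycles G" using ne by blast
  then have "C \<in> directed_circuits G" using G by (auto simp: unicircuit_def)
  then obtain xs where xs: "distinct xs" "length xs \<ge> 2" "set xs \<subseteq> pverts G" "C = circuit_arcs xs" "C \<subseteq> parcs G"
    using directed_circuitE[OF pd] by blast
  have "D = C" if "D \<in> underlying_cycles G" for D
    using G C that unfolding unicircuit_def by blast
  moreover have "set xs \<noteq> {}" using xs(2) by auto
  moreover have "set xs \<times> set xs \<subseteq> (C \<union> C\<inverse>)\<^sup>*"
    using circuit_arcs_connected[of _ xs] xs(4) by auto
  ultimately obtain Y where "rooted_forest (set xs) (pverts G - set xs) (parcs G - C) Y"
    using unicircuit_remove_core[OF G xs(3) _ xs(5)] circuit_arcs_subset[of xs] xs(4) by blast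
  moreover have "G = circuit_forest xs (pverts G - set xs) (parcs G - C)"
    using xs by (cases G) (auto simp: circuit_forest_def)
  ultimately show ?thesis using that xs by blast
qed

lemma unicircuit_treeE:
  assumes G: "unicircuit G" and e: "underlying_cycles G = {}" and r: "r \<in> pverts G"
  obtains Y where "rooted_forest {r} (pverts G - {r}) (parcs G) Y"
  using unicircuit_remove_core[OF G, of "{r}" "{}"] e r by auto

context
  fixes xs :: "'a list" and V F Y
  assumes xs: "distinct xs" "length xs \<ge> 2" and fin: "finite V" and F: "rooted_forest (set xs) V F Y"
begin

lemma circuit_forest_pair_digraph: "pair_digraph (circuit_forest xs V F)"
proof
  have arcs: "F \<subseteq> (set xs \<union> V) \<times> (set xs \<union> V)" using forest_arcs[OF F] by blast
  show "fst e \<in> pverts (circuit_forest xs V F)" "snd e \<in> pverts (circuit_forest xs V F)"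
    if "e \<in> parcs (circuit_forest xs V F)" for e
    using that circuit_arcs_subset[of xs] arcs by (auto simp: circuit_forest_def)
  show "finite (pverts (circuit_forest xs V F))" using fin by (simp add: circuit_forest_def)
  have "finite F" by (rule finite_subset[OF arcs]) (use fin in auto)
  then show "finite (parcs (circuit_forest xs V F))"
    by (simp add: circuit_forest_def circuit_arcs_def)
  show "fst e \<noteq> snd e" if "e \<in> parcs (circuit_forest xs V F)" for e
    using that circuit_arcs_irrefl[OF xs] forest_irrefl[OF F]
    by (cases e) (auto simp: circuit_forest_def)
qed

lemma forest_circuit_disjoint: "F \<inter> circuit_arcs xs = {}"
  using forest_arcs[OF F] circuit_arcs_subset[of xs] by blast

lemma underlying_cycles_circuit_forest: "underlying_cycles (circuit_forest xs V F) = {circuit_arcs xs}"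
proof (intro equalityI subsetI)
  fix C assume "C \<in> underlying_cycles (circuit_forest xs V F)"
  then obtain vs es where C: "C = set es" "underlying_cycle (circuit_forest xs V F) vs es"
    by (auto simp: underlying_cycles_def)
  have sub: "set es \<subseteq> circuit_arcs xs \<union> F" "es \<noteq> []"
    using C(2) by (auto simp: underlying_cycle_def circuit_forest_def)
  note deg = underlying_cycle_degree[OF circuit_forest_pair_digraph C(2)]
  have cv: "v \<in> set xs" if "y \<in> circuit_arcs xs" "v \<in> {fst y, snd y}" for v y
    using that circuit_arcs_subset[of xs] by auto
  have "set es \<inter> F = {}"
  proof (rule forest_acyclic[OF F])
    fix x v assume x: "x \<in> set es \<inter> F" "v \<in> {fst x, snd x}" "v \<in> V"
    then obtain y where y: "y \<in> set es" "y \<noteq> x" "v \<in> {fst y, snd y}" using deg by blast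
    have "v \<notin> set xs" using forest_disjoint[OF F] x(3) by blast
    then have "y \<in> F" using y cv sub(1) by blast
    then show "\<exists>y\<in>set es \<inter> F. y \<noteq> x \<and> v \<in> {fst y, snd y}" using y by blast
  qed simp
  then have "set es \<subseteq> circuit_arcs xs" using sub by blast
  then have "set es = circuit_arcs xs"
    by (rule circuit_arcs_degree[OF xs(1)]) (use sub deg in auto)
  then show "C \<in> {circuit_arcs xs}" using C by simp
next
  fix C assume "C \<in> {circuit_arcs xs}"
  then have C: "C = circuit_arcs xs" by simp
  define es where "es = zip xs (rotate1 xs)"
  have "underlying_cycle (circuit_forest xs V F) xs es"
    unfolding underlying_cycle_def
  proof (intro conjI allI impI)
    show "es \<noteq> []" using xs by (auto simp: es_def)
    show "distinct es" using xs by (simp add: es_def distinct_zipI1)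
    show "set es \<subseteq> parcs (circuit_forest xs V F)" by (auto simp: es_def circuit_forest_def circuit_arcs_def)
    fix i assume "i < length es"
    then show "{fst (es ! i), snd (es ! i)} = {xs ! i, xs ! (Suc i mod length es)}"
      by (simp add: es_def nth_rotate1)
  qed (use xs in \<open>auto simp: es_def circuit_forest_def\<close>)
  then show "C \<in> underlying_cycles (circuit_forest xs V F)"
    unfolding underlying_cycles_def C circuit_arcs_def es_def by blast
qed

lemma unicircuit_circuit_forest: "unicircuit (circuit_forest xs V F)"
proof -
  let ?G = "circuit_forest xs V F" and ?R = "circuit_arcs xs \<union> F \<union> (circuit_arcs xs \<union> F)\<inverse>"
  have ne: "set xs \<noteq> {}" using xs by auto
  have c: "(x, y) \<in> ?R\<^sup>*" if "x \<in> set xs" "y \<in> set xs" for x y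
    using circuit_arcs_connected[OF that] by (rule rtrancl_mono[THEN subsetD, rotated]) auto
  have f: "\<exists>a\<in>set xs. (v, a) \<in> ?R\<^sup>*" if v: "v \<in> set xs \<union> V" for v
  proof (cases "v \<in> V")
    case True
    then obtain a where a: "a \<in> set xs" "(v, a) \<in> (F \<union> F\<inverse>)\<^sup>*" using forest_connected[OF F] by blast
    have "(v, a) \<in> ?R\<^sup>*" using a(2) by (rule rtrancl_mono[THEN subsetD, rotated]) auto
    then show ?thesis using a by blast
  qed (use v in auto)
  have sym: "sym (?R\<^sup>*)" by (intro sym_rtrancl sym_Un_converse)
  have "(u, v) \<in> ?R\<^sup>*" if uv: "u \<in> set xs \<union> V" "v \<in> set xs \<union> V" for u v
  proof -
    obtain a b where ab: "a \<in> set xs" "(u, a) \<in> ?R\<^sup>*" "b \<in> set xs" "(v, b) \<in> ?R\<^sup>*"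
      using f[OF uv(1)] f[OF uv(2)] by blast
    have "(b, v) \<in> ?R\<^sup>*" using ab(4) sym by (rule symD[rotated])
    then show ?thesis using ab(2) c[OF ab(1,3)] by (meson rtrancl_trans)
  qed
  then have "Digraph_Component.connected (with_proj ?G)"
    unfolding weakly_connected_iff[OF circuit_forest_pair_digraph] using ne by (simp add: circuit_forest_def)
  moreover have "circuit_arcs xs \<in> directed_circuits ?G"
    by (rule circuit_arcs_directed) (use xs in \<open>auto simp: circuit_forest_def\<close>)
  ultimately show ?thesis
    unfolding unicircuit_def underlying_cycles_circuit_forest using circuit_forest_pair_digraph by simp
qed

text \<open>The trees act on the circuit only through Y: a kernel restricts to a solution R of the
  cyclic condition, and every R extends over the forest by
  \<open>forest_kernel_extend\<close>.\<close>

lemma kernel_circuit_forest_iff: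
  "(\<exists>K. digraph_kernel (circuit_forest xs V F) K) \<longleftrightarrow>
    (\<exists>R \<subseteq> set xs. \<forall>i<length xs. xs ! i \<in> R \<longleftrightarrow> xs ! (Suc i mod length xs) \<notin> R \<and> xs ! i \<in> Y)"
proof -
  let ?G = "circuit_forest xs V F" and ?k = "length xs"
  have ne: "set xs \<noteq> {}" using xs by auto
  have disj: "set xs \<inter> V = {}" by (rule forest_disjoint[OF F])
  \<comment> \<open>Nonemptiness is automatic: for empty K the equivalence would put every vertex
    into K.\<close>
  have ker: "digraph_kernel ?G K \<longleftrightarrow>
      K \<subseteq> set xs \<union> V \<and> (\<forall>v\<in>set xs \<union> V. v \<in> K \<longleftrightarrow> (\<forall>w\<in>K. (v, w) \<notin> circuit_arcs xs \<union> F))" for K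
  proof -
    have "hd xs \<in> set xs" using xs(2) by (cases xs) auto
    then show ?thesis unfolding digraph_kernel_def circuit_forest_def by auto
  qed
  have V: "(v, w) \<notin> circuit_arcs xs" if "v \<in> V" for v w
    using that disj circuit_arcs_subset[of xs] by blast
  have suc: "xs ! (Suc i mod ?k) \<in> set xs" if "i < ?k" for i
    using that by (intro nth_mem mod_less_divisor) auto
  have core: "(\<forall>w\<in>K. (xs ! i, w) \<notin> circuit_arcs xs \<union> F) \<longleftrightarrow> xs ! (Suc i mod ?k) \<notin> K \<and> xs ! i \<in> Y"
    if "i < ?k" "\<forall>v\<in>V. v \<in> K \<longleftrightarrow> (\<forall>w\<in>K. (v, w) \<notin> F)" for i K
    using forest_kernel_red[OF F that(2), of "xs ! i"] that(1) circuit_arcs_out[OF xs(1) that(1)] by auto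
  show ?thesis
  proof
    assume "\<exists>K. digraph_kernel ?G K"
    then obtain K where K: "K \<subseteq> set xs \<union> V" "\<forall>v\<in>set xs \<union> V. v \<in> K \<longleftrightarrow> (\<forall>w\<in>K. (v, w) \<notin> circuit_arcs xs \<union> F)"
      unfolding ker by blast
    have KV: "\<forall>v\<in>V. v \<in> K \<longleftrightarrow> (\<forall>w\<in>K. (v, w) \<notin> F)" using K(2) V by blast
    show "\<exists>R\<subseteq>set xs. \<forall>i<?k. xs ! i \<in> R \<longleftrightarrow> xs ! (Suc i mod ?k) \<notin> R \<and> xs ! i \<in> Y"
    proof (intro exI[of _ "K \<inter> set xs"] conjI allI impI)
      fix i assume i: "i < ?k"
      have "xs ! i \<in> K \<longleftrightarrow> xs ! (Suc i mod ?k) \<notin> K \<and> xs ! i \<in> Y"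
        using core[OF i KV] K(2) i by (simp add: nth_mem)
      then show "xs ! i \<in> K \<inter> set xs \<longleftrightarrow> xs ! (Suc i mod ?k) \<notin> K \<inter> set xs \<and> xs ! i \<in> Y"
        using i suc[OF i] by simp
    qed simp
  next
    assume "\<exists>R\<subseteq>set xs. \<forall>i<?k. xs ! i \<in> R \<longleftrightarrow> xs ! (Suc i mod ?k) \<notin> R \<and> xs ! i \<in> Y"
    then obtain R where R: "R \<subseteq> set xs" "\<forall>i<?k. xs ! i \<in> R \<longleftrightarrow> xs ! (Suc i mod ?k) \<notin> R \<and> xs ! i \<in> Y" by blast
    obtain K where K: "K \<subseteq> set xs \<union> V" "K \<inter> set xs = R" "\<forall>v\<in>V. v \<in> K \<longleftrightarrow> (\<forall>w\<in>K. (v, w) \<notin> F)"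
      using forest_kernel_extend[OF F R(1)] by blast
    have KR: "x \<in> K \<longleftrightarrow> x \<in> R" if "x \<in> set xs" for x using K(2) that by blast
    have "v \<in> K \<longleftrightarrow> (\<forall>w\<in>K. (v, w) \<notin> circuit_arcs xs \<union> F)" if "v \<in> set xs \<union> V" for v
    proof (cases "v \<in> V")
      case True
      then show ?thesis using K(3) V by blast
    next
      case False
      then have "v \<in> set xs" using that by blast
      then obtain i where i: "i < ?k" "v = xs ! i" by (auto simp: in_set_conv_nth)
      show ?thesis unfolding i(2) core[OF i(1) K(3)] using KR suc[OF i(1)] R(2) i(1) by simp
    qed
    then show "\<exists>K. digraph_kernel ?G K" unfolding ker using K(1) by blast
  qed
qed

end

lemma circular_colouring_odd:
  fixes c :: "nat \<Rightarrow> bool"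
  assumes "odd k" "\<forall>i<k. c i \<longleftrightarrow> \<not> c (Suc i mod k)"
  shows False
proof -
  have "c i \<longleftrightarrow> (c 0 \<longleftrightarrow> even i)" if "i < k" for i
    using that
  proof (induction i)
    case (Suc i)
    then have "c i \<longleftrightarrow> \<not> c (Suc i)" using assms(2) by (metis Suc_lessD mod_less)
    then show ?case using Suc by auto
  qed simp
  moreover have "k - 1 < k" "Suc (k - 1) = k" "even (k - 1)" using assms(1) by (auto elim: oddE)
  ultimately show False using assms(2) by (metis mod_self)
qed

lemma circuit_forest_rotate: "circuit_forest (rotate n xs) V F = circuit_forest xs V F"
  by (simp add: circuit_forest_def circuit_arcs_rotate)

text \<open>The last position is green regardless of its successor, which cuts the cyclic dependence
  open into a recursion.\<close>

lemma backward_colouring: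
  fixes y :: "nat \<Rightarrow> bool"
  assumes "\<not> y (k - 1)" "k > 0"
  obtains c where "\<forall>i<k. c i \<longleftrightarrow> \<not> c (Suc i mod k) \<and> y i"
proof -
  \<comment> \<open>\<open>d j\<close> is the colour of position k - 1 - j, with \<open>True\<close>
    for red.\<close>
  define d where "d = rec_nat False (\<lambda>j b. \<not> b \<and> y (k - 1 - Suc j))"
  have d: "d 0 = False" "\<And>j. d (Suc j) = (\<not> d j \<and> y (k - 1 - Suc j))" by (simp_all add: d_def)
  have "d (k - 1 - i) \<longleftrightarrow> \<not> d (k - 1 - Suc i mod k) \<and> y i" if i: "i < k" for i
  proof (cases "i = k - 1")
    case True
    then show ?thesis using assms d by simp
  next
    case False
    then have "Suc i mod k = Suc i" "k - 1 - i = Suc (k - 1 - Suc i)" "k - 1 - Suc (k - 1 - Suc i) = i"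
      using i by auto
    then show ?thesis using d(2)[of "k - 1 - Suc i"] by simp
  qed
  then show ?thesis using that[of "\<lambda>i. d (k - 1 - i)"] by blast
qed

theorem circuit_forest_kernel:
  assumes xs: "distinct xs" "length xs \<ge> 2" and fin: "finite V" and F: "rooted_forest (set xs) V F Y"
  shows "(\<exists>K. digraph_kernel (circuit_forest xs V F) K) \<longleftrightarrow> \<not> (odd (length xs) \<and> Y = set xs)"
proof (cases "Y = set xs")
  case True
  let ?k = "length xs"
  have k: "?k > 0" using xs by linarith
  have eq: "(\<exists>K. digraph_kernel (circuit_forest xs V F) K) \<longleftrightarrow>
    (\<exists>R \<subseteq> set xs. \<forall>i<?k. xs ! i \<in> R \<longleftrightarrow> xs ! (Suc i mod ?k) \<notin> R)"
    unfolding kernel_circuit_forest_iff[OF xs fin F] using True by (auto simp: nth_mem)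
  show ?thesis
  proof (cases "odd ?k")
    case True
    have "\<not> (\<exists>R \<subseteq> set xs. \<forall>i<?k. xs ! i \<in> R \<longleftrightarrow> xs ! (Suc i mod ?k) \<notin> R)"
      using circular_colouring_odd[OF True, of "\<lambda>i. xs ! i \<in> _"] by blast
    then show ?thesis unfolding eq using True \<open>Y = set xs\<close> by blast
  next
    case False
    define R where "R = {xs ! i | i. i < ?k \<and> even i}"
    have R: "xs ! i \<in> R \<longleftrightarrow> even i" if "i < ?k" for i
      using that xs(1) by (auto simp: R_def nth_eq_iff_index_eq)
    have "xs ! i \<in> R \<longleftrightarrow> xs ! (Suc i mod ?k) \<notin> R" if i: "i < ?k" for i
    proof -
      have "even (Suc i mod ?k) \<longleftrightarrow> odd i"
      proof (cases "Suc i = ?k")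
        case True
        then have "odd i" using False by (metis even_Suc)
        moreover have "Suc i mod ?k = 0" using True by simp
        ultimately show ?thesis by simp
      qed (use i in auto)
      then show ?thesis using R[OF i] R[of "Suc i mod ?k"] k by simp
    qed
    moreover have "R \<subseteq> set xs" by (auto simp: R_def)
    ultimately show ?thesis unfolding eq using False by blast
  qed
next
  case False
  then obtain x where x: "x \<in> set xs" "x \<notin> Y" using forest_red_subset[OF F] by blast
  then obtain i where i: "i < length xs" "xs ! i = x" by (auto simp: in_set_conv_nth)
  \<comment> \<open>The rotation moves x, which is green in its own tree, to the last position,
    where the backward colouring starts.\<close>
  define ys where "ys = rotate (Suc i) xs"
  let ?k = "length ys"
  have ys: "distinct ys" "?k \<ge> 2" "set ys = set xs" "?k > 0" using xs by (auto simp: ys_def)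
  have "ys ! (?k - 1) = x"
  proof -
    have "(Suc i + (?k - 1)) mod ?k = i" using i ys(4) by (simp add: ys_def)
    then show ?thesis using i nth_rotate[of "?k - 1" xs "Suc i"] ys(4) by (simp add: ys_def)
  qed
  then have "\<not> ys ! (?k - 1) \<in> Y" using x(2) by simp
  then obtain c where c: "\<forall>i<?k. c i \<longleftrightarrow> \<not> c (Suc i mod ?k) \<and> ys ! i \<in> Y"
    by (rule backward_colouring[of "\<lambda>i. ys ! i \<in> Y", OF _ ys(4)])
  define R where "R = {ys ! i | i. i < ?k \<and> c i}"
  have R: "ys ! i \<in> R \<longleftrightarrow> c i" if "i < ?k" for i
    using that ys(1) by (auto simp: R_def nth_eq_iff_index_eq)
  have "ys ! i \<in> R \<longleftrightarrow> ys ! (Suc i mod ?k) \<notin> R \<and> ys ! i \<in> Y" if i: "i < ?k" for i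
  proof -
    have "Suc i mod ?k < ?k" using ys(4) by (rule mod_less_divisor)
    then show ?thesis using R[OF i] R[of "Suc i mod ?k"] c[rule_format, OF i] by blast
  qed
  moreover have "R \<subseteq> set ys" by (auto simp: R_def)
  moreover have "rooted_forest (set ys) V F Y" using F ys(3) by simp
  ultimately have "\<exists>K. digraph_kernel (circuit_forest ys V F) K"
    using kernel_circuit_forest_iff[OF ys(1,2) fin] by blast
  then show ?thesis using False unfolding ys_def circuit_forest_rotate by blast
qed

section \<open>Counting unicircuit digraphs\<close>

text \<open>Circuits are lists, hence carry a distinguished start. The flag \<open>b\<close> demands
  that all roots be red, so that one count serves both for all digraphs with a circuit and for those
  without a kernel.\<close>

definition circuit_data :: "bool \<Rightarrow> nat \<Rightarrow> nat \<Rightarrow> (nat list \<times> nat rel \<times> nat set) set" where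
  "circuit_data b n k = (SIGMA xs:{xs. length xs = k \<and> distinct xs \<and> set xs \<subseteq> {1..n}}.
     forests_red (if b then set xs else {}) (set xs) ({1..n} - set xs))"

definition circuit_egf :: "bool \<Rightarrow> real fps" where
  "circuit_egf b = (if b then red_egf else tree_egf)"

text \<open>There are n! / (n - k)! lists, and each admits (n - k)! times the coefficient many
  forests; the factor x^k in the power accounts for the k circuit vertices.\<close>

lemma card_circuit_data:
  assumes "k \<le> n"
  shows "real (card (circuit_data b n k)) = fact n * (circuit_egf b ^ k) $ n"
proof -
  define U' where "U' = (if b then red_egf' else tree_egf')"
  have U: "circuit_egf b = fps_X * U'"
    using red_egf_shift tree_egf_shift by (simp add: circuit_egf_def U'_def)
  let ?L = "{xs. length xs = k \<and> distinct xs \<and> set xs \<subseteq> {1..n}}"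
  have fL: "finite ?L" by (rule finite_subset[OF _ finite_lists_length_eq[of "{1..n}" k]]) auto
  have ff: "finite (forests_red X (set xs) ({1..n} - set xs))" for X xs
    unfolding forests_red_def using finite_forests[of "set xs" "{1..n} - set xs"] by simp
  have c: "real (card (forests_red (if b then set xs else {}) (set xs) ({1..n} - set xs))) = fact (n - k) * (circuit_egf b ^ k) $ n"
    if "xs \<in> ?L" for xs
  proof -
    have xs: "card (set xs) = k" "set xs \<subseteq> {1..n}" using that by (auto simp: distinct_card)
    then have V: "card ({1..n} - set xs) = n - k" by (simp add: card_Diff_subset)
    have "real (card (forests_red (if b then set xs else {}) (set xs) ({1..n} - set xs))) = fact (n - k) * (U' ^ k) $ (n - k)"
      by (subst card_forests_red) (use xs V in \<open>auto simp: U'_def\<close>)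
    also have "(U' ^ k) $ (n - k) = (circuit_egf b ^ k) $ n"
      using assms unfolding U power_mult_distrib fps_X_power_mult_nth by simp
    finally show ?thesis .
  qed
  have "real (card (circuit_data b n k)) = (\<Sum>xs\<in>?L. real (card (forests_red (if b then set xs else {}) (set xs) ({1..n} - set xs))))"
    unfolding circuit_data_def by (subst card_SigmaI) (use fL ff in auto)
  also have "\<dots> = (\<Sum>xs\<in>?L. fact (n - k) * (circuit_egf b ^ k) $ n)"
    by (intro sum.cong refl c)
  also have "\<dots> = real (card ?L) * fact (n - k) * (circuit_egf b ^ k) $ n"
    by (simp only: sum_constant mult.assoc)
  also have "real (card ?L) * fact (n - k) = fact n"
  proof -
    have "card ?L = \<Prod>{n - k + 1..n}"
      using card_lists_distinct_length_eq[of "{1..n}" k] assms by simp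
    also have "\<dots> = fact n div fact (n - k)"
      using fact_div_fact[of "n - k" n] by simp
    finally have "card ?L * fact (n - k) = fact n" by (simp add: fact_dvd)
    then have "real (card ?L * fact (n - k)) = real (fact n)" by (simp only:)
    then show ?thesis by (simp only: of_nat_mult of_nat_fact)
  qed
  finally show ?thesis .
qed

definition circuit_digraph :: "nat \<Rightarrow> nat list \<times> nat rel \<times> nat set \<Rightarrow> nat pair_pre_digraph" where
  "circuit_digraph n = (\<lambda>(xs, F, Y). circuit_forest xs ({1..n} - set xs) F)"

definition circuit_digraphs :: "bool \<Rightarrow> nat \<Rightarrow> nat \<Rightarrow> nat pair_pre_digraph set" where
  "circuit_digraphs b n k = circuit_digraph n ` circuit_data b n k"

text \<open>Every vertex of a circuit is the tail of one of its arcs, so first components suffice.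
  The set recovers the circuit length from the digraph alone.\<close>

definition circuit_vertices :: "'a pair_pre_digraph \<Rightarrow> 'a set" where
  "circuit_vertices G = fst ` \<Union> (underlying_cycles G)"

lemma circuit_dataD:
  assumes "(xs, F, Y) \<in> circuit_data b n k"
  shows "length xs = k" "distinct xs" "set xs \<subseteq> {1..n}" "rooted_forest (set xs) ({1..n} - set xs) F Y"
    "b \<Longrightarrow> Y = set xs"
proof -
  show 1: "length xs = k" "distinct xs" "set xs \<subseteq> {1..n}" "rooted_forest (set xs) ({1..n} - set xs) F Y"
    using assms by (auto simp: circuit_data_def forests_red_def forests_def)
  show "b \<Longrightarrow> Y = set xs"
    using assms forest_red_subset[OF 1(4)] by (auto simp: circuit_data_def forests_red_def)
qed

lemma circuit_dataI:
  assumes "length xs = k" "distinct xs" "set xs \<subseteq> {1..n}" "rooted_forest (set xs) ({1..n} - set xs) F Y"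
    "b \<Longrightarrow> Y = set xs"
  shows "(xs, F, Y) \<in> circuit_data b n k"
  using assms by (auto simp: circuit_data_def forests_red_def forests_def)

lemma circuit_digraph_facts:
  assumes "(xs, F, Y) \<in> circuit_data b n k" "k \<ge> 2"
  shows "circuit_digraph n (xs, F, Y) \<in> unicircuits n"
    and "underlying_cycles (circuit_digraph n (xs, F, Y)) = {circuit_arcs xs}"
    and "circuit_vertices (circuit_digraph n (xs, F, Y)) = set xs"
    and "F = parcs (circuit_digraph n (xs, F, Y)) - circuit_arcs xs"
    and "(\<exists>K. digraph_kernel (circuit_digraph n (xs, F, Y)) K) \<longleftrightarrow> \<not> (odd k \<and> Y = set xs)"
proof -
  note D = circuit_dataD[OF assms(1)]
  have l: "2 \<le> length xs" using D assms by simp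
  have fin: "finite ({1..n} - set xs)" by simp
  show "circuit_digraph n (xs, F, Y) \<in> unicircuits n"
    using unicircuit_circuit_forest[OF D(2) l fin D(4)] D(3)
    by (auto simp: unicircuits_def circuit_digraph_def circuit_forest_def)
  show u: "underlying_cycles (circuit_digraph n (xs, F, Y)) = {circuit_arcs xs}"
    using underlying_cycles_circuit_forest[OF D(2) l fin D(4)] by (simp add: circuit_digraph_def)
  show "circuit_vertices (circuit_digraph n (xs, F, Y)) = set xs"
    unfolding circuit_vertices_def u by (simp add: Domain_circuit_arcs)
  show "F = parcs (circuit_digraph n (xs, F, Y)) - circuit_arcs xs"
    using forest_circuit_disjoint[OF D(2) l fin D(4)] by (auto simp: circuit_digraph_def circuit_forest_def)
  show "(\<exists>K. digraph_kernel (circuit_digraph n (xs, F, Y)) K) \<longleftrightarrow> \<not> (odd k \<and> Y = set xs)"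
    using circuit_forest_kernel[OF D(2) l fin D(4)] D(1) by (simp add: circuit_digraph_def)
qed

text \<open>
  Pairs of a digraph and a vertex on its circuit correspond to lists starting at that vertex, so
  the \<open>k\<close> rotations of a circuit need not be divided out by hand.
\<close>

lemma card_circuit_digraphs:
  assumes k: "2 \<le> k" "k \<le> n"
  shows "finite (circuit_digraphs b n k)"
    and "real (card (circuit_digraphs b n k)) = fact n * (circuit_egf b ^ k) $ n / real k"
proof -
  let ?D = "circuit_data b n k"
  have fD: "finite ?D"
  proof -
    have "finite {xs. length xs = k \<and> distinct xs \<and> set xs \<subseteq> {1..n}}"
      by (rule finite_subset[OF _ finite_lists_length_eq[of "{1..n}" k]]) auto
    moreover have "finite (forests_red X (set xs) ({1..n} - set xs))" for X xs
      unfolding forests_red_def using finite_forests[of "set xs" "{1..n} - set xs"] by simp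
    ultimately show ?thesis unfolding circuit_data_def by (intro finite_SigmaI)
  qed
  then show fin: "finite (circuit_digraphs b n k)" by (simp add: circuit_digraphs_def)
  define \<phi> where "\<phi> = (\<lambda>d. (circuit_digraph n d, hd (fst d)))"
  have "bij_betw \<phi> ?D (SIGMA G:circuit_digraphs b n k. circuit_vertices G)"
    unfolding bij_betw_def
  proof
    show "inj_on \<phi> ?D"
    proof (rule inj_onI)
      fix p q assume p: "p \<in> ?D" and q: "q \<in> ?D" and eq: "\<phi> p = \<phi> q"
      obtain xs F Y where P: "p = (xs, F, Y)" by (cases p)
      obtain ys E Z where Q: "q = (ys, E, Z)" by (cases q)
      note p' = p[unfolded P] and q' = q[unfolded Q]
      have G: "circuit_digraph n (xs, F, Y) = circuit_digraph n (ys, E, Z)" "hd xs = hd ys"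
        using eq by (auto simp: \<phi>_def P Q)
      have "circuit_arcs xs = circuit_arcs ys"
        using circuit_digraph_facts(2)[OF p' k(1)] circuit_digraph_facts(2)[OF q' k(1)] G by simp
      then have "xs = ys"
        using circuit_arcs_inject circuit_dataD(2)[OF p'] circuit_dataD(2)[OF q'] G(2) by blast
      moreover from this have "F = E"
        using circuit_digraph_facts(4)[OF p' k(1)] circuit_digraph_facts(4)[OF q' k(1)] G by metis
      moreover from calculation have "Z = Y"
        using forest_unique[OF circuit_dataD(4)[OF p']] circuit_dataD(4)[OF q'] by simp
      ultimately show "p = q" by (simp add: P Q)
    qed
    show "\<phi> ` ?D = (SIGMA G:circuit_digraphs b n k. circuit_vertices G)"
    proof (intro equalityI subsetI)
      fix t assume "t \<in> \<phi> ` ?D"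
      then obtain xs F Y where t: "t = \<phi> (xs, F, Y)" and d: "(xs, F, Y) \<in> ?D" by auto
      have "hd xs \<in> set xs" using circuit_dataD(1)[OF d] k by (cases xs) auto
      then show "t \<in> (SIGMA G:circuit_digraphs b n k. circuit_vertices G)"
        using circuit_digraph_facts(3)[OF d k(1)] d by (auto simp: t \<phi>_def circuit_digraphs_def)
    next
      fix t assume "t \<in> (SIGMA G:circuit_digraphs b n k. circuit_vertices G)"
      then obtain xs F Y v where t: "t = (circuit_digraph n (xs, F, Y), v)" and d: "(xs, F, Y) \<in> ?D"
        and v: "v \<in> circuit_vertices (circuit_digraph n (xs, F, Y))"
        by (auto simp: circuit_digraphs_def)
      have "v \<in> set xs" using v circuit_digraph_facts(3)[OF d k(1)] by simp
      then obtain i where i: "i < length xs" "v = xs ! i" by (auto simp: in_set_conv_nth)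
      define ys where "ys = rotate i xs"
      have "hd ys = v" using i hd_rotate_conv_nth[of xs i] by (cases "xs = []") (simp_all add: ys_def)
      moreover have "(ys, F, Y) \<in> ?D"
        by (rule circuit_dataI) (use circuit_dataD[OF d] in \<open>simp_all add: ys_def\<close>)
      moreover have "circuit_digraph n (ys, F, Y) = circuit_digraph n (xs, F, Y)"
        by (simp add: circuit_digraph_def ys_def circuit_forest_rotate)
      ultimately show "t \<in> \<phi> ` ?D" 
        unfolding t \<phi>_def by (intro image_eqI[of _ _ "(ys, F, Y)"]) simp_all
    qed
  qed
  then have "card ?D = card (SIGMA G:circuit_digraphs b n k. circuit_vertices G)"
    by (rule bij_betw_same_card)
  also have "\<dots> = (\<Sum>G\<in>circuit_digraphs b n k. card (circuit_vertices G))"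
  proof (rule card_SigmaI[OF fin], rule ballI)
    fix G assume "G \<in> circuit_digraphs b n k"
    then obtain xs F Y where "(xs, F, Y) \<in> ?D" "G = circuit_digraph n (xs, F, Y)"
      by (auto simp: circuit_digraphs_def)
    then show "finite (circuit_vertices G)" using circuit_digraph_facts(3) k(1) by simp
  qed
  also have "\<dots> = (\<Sum>G\<in>circuit_digraphs b n k. k)"
  proof (rule sum.cong)
    fix G assume "G \<in> circuit_digraphs b n k"
    then obtain xs F Y where d: "(xs, F, Y) \<in> ?D" "G = circuit_digraph n (xs, F, Y)"
      by (auto simp: circuit_digraphs_def)
    then show "card (circuit_vertices G) = k"
      using circuit_digraph_facts(3)[OF d(1) k(1)] circuit_dataD[OF d(1)] distinct_card by metis
  qed simp
  finally have "real (card ?D) = real (card (circuit_digraphs b n k)) * real k" by simp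
  then show "real (card (circuit_digraphs b n k)) = fact n * (circuit_egf b ^ k) $ n / real k"
    unfolding card_circuit_data[OF k(2)] using k by (simp add: field_simps)
qed

section \<open>Digraphs without a circuit, and the two decompositions\<close>

definition tree_digraphs :: "nat \<Rightarrow> nat pair_pre_digraph set" where
  "tree_digraphs n = {G \<in> unicircuits n. underlying_cycles G = {}}"

lemma tree_digraph_forest:
  assumes "G \<in> tree_digraphs n"
  obtains Y where "1 \<in> pverts G" "rooted_forest {1} ({1..n} - {1}) (parcs G) Y"
proof -
  have G: "unicircuit G" "underlying_cycles G = {}" "pverts G = {1..n}"
    using assms by (auto simp: tree_digraphs_def unicircuits_def)
  then have "pverts G \<noteq> {}" using weakly_connected_iff unfolding unicircuit_def by blast
  then have 1: "1 \<in> pverts G" using G(3) by (cases n) auto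
  then show ?thesis using unicircuit_treeE[OF G(1,2) 1] that G(3) by auto
qed

lemma tree_digraph_kernel:
  assumes "G \<in> tree_digraphs n"
  shows "\<exists>K. digraph_kernel G K"
proof -
  obtain Y where 1: "1 \<in> pverts G" and Y: "rooted_forest {1} ({1..n} - {1}) (parcs G) Y"
    using tree_digraph_forest[OF assms] by blast
  have V: "pverts G = insert 1 ({1..n} - {1})"
    using assms 1 by (auto simp: tree_digraphs_def unicircuits_def)
  \<comment> \<open>Prescribing Y itself on the root makes the root consistent as well, because its
    arcs avoid the kernel exactly when it lies in Y.\<close>
  have "Y \<subseteq> {1}" by (rule forest_red_subset[OF Y])
  then obtain K where K: "K \<subseteq> {1} \<union> ({1..n} - {1})" "K \<inter> {1} = Y"
    "\<forall>v\<in>{1..n} - {1}. v \<in> K \<longleftrightarrow> (\<forall>w\<in>K. (v, w) \<notin> parcs G)"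
    using forest_kernel_extend[OF Y] by blast
  have "1 \<in> K \<longleftrightarrow> (\<forall>w\<in>K. (1, w) \<notin> parcs G)"
    using forest_kernel_red[OF Y K(3), of 1] K(2) by auto
  then have all: "\<forall>v\<in>pverts G. v \<in> K \<longleftrightarrow> (\<forall>w\<in>K. (v, w) \<notin> parcs G)"
    using K(3) unfolding V by blast
  moreover have "K \<noteq> {}" using all 1 by blast
  moreover have "K \<subseteq> pverts G" using K(1) V by blast
  ultimately have "digraph_kernel G K" unfolding digraph_kernel_def by blast
  then show ?thesis by blast
qed

text \<open>The root is fixed as 1 instead of being chosen among n vertices; so the bound is smaller
  than the normaliser n! [x^n] T by a factor n, which makes these digraphs negligible.\<close>

lemma card_tree_digraphs:
  assumes "n \<ge> 1"
  shows "finite (tree_digraphs n)" and "real (card (tree_digraphs n)) \<le> fact (n - 1) * tree_egf $ n"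
proof -
  let ?V = "{1..n} - {1}" and ?g = "\<lambda>p. \<lparr>pverts = {1..n}, parcs = fst p\<rparr>"
  have c: "real (card (forests_red {} {1} ?V)) = fact (n - 1) * tree_egf $ n"
    using card_forests_red[of ?V "{1}" "{}"] assms by (simp add: tree_egf_shift)
  have fin: "finite (forests_red {} {1} ?V)"
    unfolding forests_red_def using finite_forests[of "{1}" ?V] by simp
  have sub: "tree_digraphs n \<subseteq> ?g ` forests_red {} {1} ?V"
  proof
    fix G assume G: "G \<in> tree_digraphs n"
    obtain Y where "rooted_forest {1} ?V (parcs G) Y" using tree_digraph_forest[OF G] by blast
    then have "(parcs G, Y) \<in> forests_red {} {1} ?V" by (simp add: forests_red_def forests_def)
    moreover have "G = ?g (parcs G, Y)" using G by (cases G) (simp add: tree_digraphs_def unicircuits_def)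
    ultimately show "G \<in> ?g ` forests_red {} {1} ?V" by blast
  qed
  then show "finite (tree_digraphs n)" using fin finite_subset by blast
  have "card (tree_digraphs n) \<le> card (forests_red {} {1} ?V)"
    using card_mono[OF finite_imageI[OF fin] sub] card_image_le[OF fin, of ?g] by linarith
  then show "real (card (tree_digraphs n)) \<le> fact (n - 1) * tree_egf $ n"
    unfolding c[symmetric] by simp
qed

lemma unicircuits_decomp:
  "unicircuits n = tree_digraphs n \<union> (\<Union>k\<in>{2..n}. circuit_digraphs False n k)"
proof (intro equalityI subsetI)
  fix G assume G: "G \<in> unicircuits n"
  show "G \<in> tree_digraphs n \<union> (\<Union>k\<in>{2..n}. circuit_digraphs False n k)"
  proof (cases "underlying_cycles G = {}")
    case True
    then show ?thesis using G by (simp add: tree_digraphs_def)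
  next
    case False
    have u: "unicircuit G" "pverts G = {1..n}" using G by (auto simp: unicircuits_def)
    obtain xs F Y where xs: "distinct xs" "length xs \<ge> 2" "set xs \<subseteq> pverts G"
      "rooted_forest (set xs) (pverts G - set xs) F Y" "G = circuit_forest xs (pverts G - set xs) F"
      using unicircuit_cycleE[OF u(1) False] by blast
    have "length xs \<le> n" using xs(1,3) u(2) by (metis card_atLeastAtMost card_mono diff_Suc_1 distinct_card finite_atLeastAtMost)
    moreover have "(xs, F, Y) \<in> circuit_data False n (length xs)"
      using xs u(2) by (intro circuit_dataI) auto
    moreover have "G = circuit_digraph n (xs, F, Y)" using xs(5) u(2) by (simp add: circuit_digraph_def)
    ultimately show ?thesis using xs(2) by (auto simp: circuit_digraphs_def)
  qed
next
  fix G assume "G \<in> tree_digraphs n \<union> (\<Union>k\<in>{2..n}. circuit_digraphs False n k)"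
  then show "G \<in> unicircuits n"
    using circuit_digraph_facts(1) by (auto simp: tree_digraphs_def circuit_digraphs_def)
qed

lemma no_kernel_decomp:
  "{G \<in> unicircuits n. \<not> (\<exists>K. digraph_kernel G K)} = (\<Union>k\<in>{k\<in>{2..n}. odd k}. circuit_digraphs True n k)"
proof (intro equalityI subsetI)
  fix G assume "G \<in> {G \<in> unicircuits n. \<not> (\<exists>K. digraph_kernel G K)}"
  then have G: "G \<in> unicircuits n" "\<not> (\<exists>K. digraph_kernel G K)" by auto
  then have "G \<notin> tree_digraphs n" using tree_digraph_kernel by blast
  then obtain k xs F Y where k: "k \<in> {2..n}" "(xs, F, Y) \<in> circuit_data False n k" "G = circuit_digraph n (xs, F, Y)"
    using G(1) unfolding unicircuits_decomp circuit_digraphs_def by auto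
  have "odd k \<and> Y = set xs" using circuit_digraph_facts(5)[OF k(2)] k G(2) by auto
  then have "(xs, F, Y) \<in> circuit_data True n k" using circuit_dataD[OF k(2)] by (intro circuit_dataI) auto
  then show "G \<in> (\<Union>k\<in>{k\<in>{2..n}. odd k}. circuit_digraphs True n k)"
    using k \<open>odd k \<and> _\<close> by (auto simp: circuit_digraphs_def)
next
  fix G assume "G \<in> (\<Union>k\<in>{k\<in>{2..n}. odd k}. circuit_digraphs True n k)"
  then obtain k xs F Y where k: "k \<in> {2..n}" "odd k" "(xs, F, Y) \<in> circuit_data True n k" "G = circuit_digraph n (xs, F, Y)"
    unfolding circuit_digraphs_def by auto
  have "Y = set xs" using circuit_dataD(5)[OF k(3)] by simp
  then have "\<not> (\<exists>K. digraph_kernel G K)" using circuit_digraph_facts(5)[OF k(3)] k by auto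
  moreover have "G \<in> unicircuits n" using circuit_digraph_facts(1)[OF k(3)] k by auto
  ultimately show "G \<in> {G \<in> unicircuits n. \<not> (\<exists>K. digraph_kernel G K)}" by blast
qed

lemma circuit_digraphs_vertices:
  assumes "G \<in> circuit_digraphs b n k" "k \<ge> 2"
  shows "card (circuit_vertices G) = k" "underlying_cycles G \<noteq> {}"
proof -
  obtain xs F Y where d: "(xs, F, Y) \<in> circuit_data b n k" "G = circuit_digraph n (xs, F, Y)"
    using assms(1) by (auto simp: circuit_digraphs_def)
  show "card (circuit_vertices G) = k"
    unfolding d(2) circuit_digraph_facts(3)[OF d(1) assms(2)]
    using circuit_dataD(1,2)[OF d(1)] by (simp add: distinct_card)
  show "underlying_cycles G \<noteq> {}"
    unfolding d(2) circuit_digraph_facts(2)[OF d(1) assms(2)] by simp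
qed

lemma card_Union_circuit_digraphs:
  assumes "I \<subseteq> {2..n}"
  shows "real (card (\<Union>k\<in>I. circuit_digraphs b n k)) = (\<Sum>k\<in>I. fact n * (circuit_egf b ^ k) $ n / real k)"
proof -
  have fI: "finite I" using assms finite_subset by blast
  have "card (\<Union>k\<in>I. circuit_digraphs b n k) = (\<Sum>k\<in>I. card (circuit_digraphs b n k))"
  proof (rule card_UN_disjoint[OF fI])
    show "\<forall>k\<in>I. finite (circuit_digraphs b n k)" using card_circuit_digraphs(1) assms by auto
    show "\<forall>i\<in>I. \<forall>j\<in>I. i \<noteq> j \<longrightarrow> circuit_digraphs b n i \<inter> circuit_digraphs b n j = {}"
    proof (intro ballI impI)
      fix i j assume "i \<in> I" "j \<in> I" "i \<noteq> j"
      then have "i \<ge> 2" "j \<ge> 2" "i \<noteq> j" using assms by auto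
      then show "circuit_digraphs b n i \<inter> circuit_digraphs b n j = {}"
        using circuit_digraphs_vertices(1) by blast
    qed
  qed
  then have "real (card (\<Union>k\<in>I. circuit_digraphs b n k)) = (\<Sum>k\<in>I. real (card (circuit_digraphs b n k)))" by simp
  also have "\<dots> = (\<Sum>k\<in>I. fact n * (circuit_egf b ^ k) $ n / real k)"
    by (intro sum.cong refl card_circuit_digraphs(2)) (use assms in auto)
  finally show ?thesis .
qed

lemma finite_unicircuits: "n \<ge> 1 \<Longrightarrow> finite (unicircuits n)"
  unfolding unicircuits_decomp using card_tree_digraphs(1) card_circuit_digraphs(1) by auto

lemma num_unicircuit_eq:
  assumes "n \<ge> 1"
  shows "real (num_unicircuit n) = real (card (tree_digraphs n)) + (\<Sum>k\<in>{2..n}. fact n * (tree_egf ^ k) $ n / real k)"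
proof -
  have "tree_digraphs n \<inter> (\<Union>k\<in>{2..n}. circuit_digraphs False n k) = {}"
    using circuit_digraphs_vertices(2) by (fastforce simp: tree_digraphs_def)
  then have "card (unicircuits n) = card (tree_digraphs n) + card (\<Union>k\<in>{2..n}. circuit_digraphs False n k)"
    unfolding unicircuits_decomp
    using card_tree_digraphs(1)[OF assms] card_circuit_digraphs(1) by (intro card_Un_disjoint) auto
  then show ?thesis
    using card_Union_circuit_digraphs[of "{2..n}" n False] by (simp add: num_unicircuit_def circuit_egf_def)
qed

lemma num_unicircuit_kernel_eq:
  assumes "n \<ge> 1"
  shows "real (num_unicircuit_kernel n) = real (num_unicircuit n)
    - (\<Sum>k\<in>{k\<in>{2..n}. odd k}. fact n * (red_egf ^ k) $ n / real k)"
proof -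
  let ?K = "{G \<in> unicircuits n. \<exists>K. digraph_kernel G K}" and ?N = "{G \<in> unicircuits n. \<not> (\<exists>K. digraph_kernel G K)}"
  have "unicircuits n = ?K \<union> ?N" by blast
  moreover have "card (?K \<union> ?N) = card ?K + card ?N"
    using finite_unicircuits[OF assms] by (intro card_Un_disjoint) auto
  ultimately have "real (num_unicircuit n) = real (num_unicircuit_kernel n) + real (card ?N)"
    by (simp add: num_unicircuit_def num_unicircuit_kernel_def)
  moreover have "real (card ?N) = (\<Sum>k\<in>{k\<in>{2..n}. odd k}. fact n * (red_egf ^ k) $ n / real k)"
  proof -
    have "{k\<in>{2..n}. odd k} \<subseteq> {2..n}" by blast
    from card_Union_circuit_digraphs[OF this, of True] show ?thesis
      unfolding no_kernel_decomp by (simp add: circuit_egf_def)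
  qed
  ultimately show ?thesis by simp
qed

lemma sum_cycle_lengths:
  fixes U B :: "real fps"
  assumes U: "U $ 0 = 0" and B: "\<And>i. B $ i = (if Suc i \<in> I then 1 else 0)" and I: "0 \<notin> I" "1 \<notin> I"
  shows "(\<Sum>i\<le>n. B $ i * (real n * (U ^ Suc i) $ n / real (Suc i)))
    = real n / fact n * (\<Sum>k\<in>{k\<in>{2..n}. k \<in> I}. fact n * (U ^ k) $ n / real k)"
proof -
  define g where "g k = (if k \<in> I then real n * (U ^ k) $ n / real k else 0)" for k
  have "(\<Sum>i\<le>n. B $ i * (real n * (U ^ Suc i) $ n / real (Suc i))) = (\<Sum>i<Suc n. g (Suc i))"
    unfolding lessThan_Suc_atMost by (intro sum.cong refl) (simp add: B g_def)
  also have "\<dots> = sum g {1..Suc n}" unfolding One_nat_def by (rule sum.atLeast1_atMost_eq[symmetric])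
  \<comment> \<open>The surplus term k = n + 1 vanishes because U has no constant term, and k = 1 is
    excluded by I.\<close>
  also have "\<dots> = sum g {k\<in>{2..n}. k \<in> I}"
  proof (rule sum.mono_neutral_right)
    show "\<forall>i\<in>{1..Suc n} - {k\<in>{2..n}. k \<in> I}. g i = 0"
    proof
      fix i assume i: "i \<in> {1..Suc n} - {k\<in>{2..n}. k \<in> I}"
      show "g i = 0"
      proof (cases "i \<in> I")
        case True
        then have "i \<noteq> 1" using I by auto
        then have "n < i" using i True by auto
        then show ?thesis using fps_power_nth_eq_0[OF U] by (simp add: g_def)
      qed (simp add: g_def)
    qed
  qed auto
  also have "\<dots> = real n / fact n * (\<Sum>k\<in>{k\<in>{2..n}. k \<in> I}. fact n * (U ^ k) $ n / real k)"
    unfolding sum_distrib_left by (intro sum.cong refl) (simp add: g_def)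
  finally show ?thesis .
qed

section \<open>Limits of the normalised counts\<close>

lemma num_unicircuit_tendsto: "(\<lambda>n. real (num_unicircuit n) / (fact n * tree_egf $ n)) \<longlonglongrightarrow> 1"
proof -
  have t: "(\<lambda>n. real (card (tree_digraphs n)) / (fact n * tree_egf $ n)) \<longlonglongrightarrow> 0"
  proof (rule Lim_null_comparison)
    show "(\<lambda>n. 1 / real n) \<longlonglongrightarrow> 0" by (rule lim_1_over_n)
    show "eventually (\<lambda>n. norm (real (card (tree_digraphs n)) / (fact n * tree_egf $ n)) \<le> 1 / real n) sequentially"
      using eventually_ge_at_top[of 1]
    proof eventually_elim
      case (elim n)
      have f: "fact n = real n * fact (n - 1)" using elim by (simp add: fact_reduce)
      have p: "0 < tree_egf $ n" by (rule tree_egf_pos[OF elim])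
      have "real (card (tree_digraphs n)) / (fact n * tree_egf $ n) \<le> (fact (n - 1) * tree_egf $ n) / (fact n * tree_egf $ n)"
        using card_tree_digraphs(2)[OF elim] p by (intro divide_right_mono) auto
      also have "\<dots> = 1 / real n" using p elim by (simp add: f)
      finally show ?case using p by simp
    qed
  qed
  have s: "(\<lambda>n. (real n / fact n * (\<Sum>k\<in>{k\<in>{2..n}. k \<in> {2..}}. fact n * (tree_egf ^ k) $ n / real k)) / (real n * tree_egf $ n)) \<longlonglongrightarrow> 1"
    using tree_cycles_tendsto
    by (subst sum_cycle_lengths[symmetric, where B = geometric_fps]) (auto simp: geometric_fps_def)
  have "eventually (\<lambda>n. real (card (tree_digraphs n)) / (fact n * tree_egf $ n) +
      (real n / fact n * (\<Sum>k\<in>{k\<in>{2..n}. k \<in> {2..}}. fact n * (tree_egf ^ k) $ n / real k)) / (real n * tree_egf $ n)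
      = real (num_unicircuit n) / (fact n * tree_egf $ n)) sequentially"
    using eventually_ge_at_top[of 1]
  proof eventually_elim
    case (elim n)
    have "{k\<in>{2..n}. k \<in> {2..}} = {2..n}" by auto
    then show ?case using elim unfolding num_unicircuit_eq[OF elim] by (simp add: add_divide_distrib)
  qed
  then show ?thesis using Lim_transform_eventually[OF tendsto_add[OF t s]] by simp
qed

lemma no_kernel_tendsto:
  assumes "2 * l = exp (- l)" "\<And>x. 2 * x = exp (- x) \<Longrightarrow> x = l" "0 < l" "l < 1"
  shows "(\<lambda>n. (\<Sum>k\<in>{k\<in>{2..n}. odd k}. fact n * (red_egf ^ k) $ n / real k) / (fact n * tree_egf $ n))
    \<longlonglongrightarrow> 2 * l ^ 3 / ((1 + l) ^ 2 * (1 - l))"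
proof -
  have s: "(\<lambda>n. (real n / fact n * (\<Sum>k\<in>{k\<in>{2..n}. k \<in> {k. odd k \<and> k \<ge> 3}}. fact n * (red_egf ^ k) $ n / real k)) / (real n * tree_egf $ n))
      \<longlonglongrightarrow> 2 * l ^ 3 / ((1 + l) ^ 2 * (1 - l))"
    using red_cycles_tendsto[OF red_egf_bounds assms]
    by (subst sum_cycle_lengths[symmetric, where B = even_fps]) (auto simp: even_fps_def)
  have "eventually (\<lambda>n. (real n / fact n * (\<Sum>k\<in>{k\<in>{2..n}. k \<in> {k. odd k \<and> k \<ge> 3}}. fact n * (red_egf ^ k) $ n / real k)) / (real n * tree_egf $ n)
      = (\<Sum>k\<in>{k\<in>{2..n}. odd k}. fact n * (red_egf ^ k) $ n / real k) / (fact n * tree_egf $ n)) sequentially"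
    using eventually_ge_at_top[of 1]
  proof eventually_elim
    case (elim n)
    have "k \<ge> 3" if "k \<ge> 2" "odd k" for k :: nat using that by (cases "k = 2") auto
    then have "{k\<in>{2..n}. k \<in> {k. odd k \<and> k \<ge> 3}} = {k\<in>{2..n}. odd k}" by auto
    then show ?case using elim by simp
  qed
  then show ?thesis using Lim_transform_eventually[OF s] by simp
qed

lemma kernel_iff_well_colouring:
  assumes "G \<in> unicircuits n"
  shows "(\<exists>K. digraph_kernel G K) \<longleftrightarrow> (\<exists>c. well_colouring G c)"
proof
  assume "\<exists>K. digraph_kernel G K"
  then obtain K where K: "digraph_kernel G K" by blast
  have "well_colouring G (\<lambda>v. if v \<in> K then Red else Green)"
  proof -
    have "\<exists>v\<in>pverts G. (u, v) \<in> parcs G \<and> v \<in> K" if "u \<in> pverts G" "u \<notin> K" for u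
      using K that unfolding digraph_kernel_def by blast
    moreover have "\<not> (\<exists>v\<in>pverts G. (u, v) \<in> parcs G \<and> v \<in> K)" if "u \<in> K" for u
      using K that unfolding digraph_kernel_def by blast
    ultimately show ?thesis unfolding well_colouring_def by simp blast
  qed
  then show "\<exists>c. well_colouring G c" by blast
next
  assume "\<exists>c. well_colouring G c"
  then obtain c where c: "well_colouring G c" by blast
  have "pverts G \<noteq> {}"
    using assms weakly_connected_iff unfolding unicircuits_def unicircuit_def by blast
  then obtain v where v: "v \<in> pverts G" by blast
  let ?K = "{v \<in> pverts G. c v = Red}"
  have c_cases: "c u = Green" if "c u \<noteq> Red" for u using that by (cases "c u") auto
  \<comment> \<open>A green vertex has a red out-neighbour, so any vertex at all yields a red one;
    connectedness provides a vertex.\<close>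
  have "?K \<noteq> {}" using c v c_cases unfolding well_colouring_def by blast
  then have "digraph_kernel G ?K"
    using c c_cases unfolding digraph_kernel_def well_colouring_def by blast
  then show "\<exists>K. digraph_kernel G K" by blast
qed

theorem theorem7:
  shows "(\<forall>n. \<forall>G \<in> unicircuits n. (\<exists>K. digraph_kernel G K) \<longleftrightarrow> (\<exists>c. well_colouring G c)) \<and>
    (\<exists>l::real. (\<forall>x::real. 2 * x = exp (- x) \<longleftrightarrow> x = l) \<and>
       \<bar>l - 0.351733\<bar> < 1 / 10 ^ 6 \<and>
       \<bar>(3 * l ^ 3 + l ^ 2 - l - 1) / ((1 + l) ^ 2 * (l - 1)) - 0.9265\<bar> < 5 / 10 ^ 5 \<and>
       (\<lambda>n. real (num_unicircuit_kernel n) / real (num_unicircuit n))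
         \<longlonglongrightarrow> (3 * l ^ 3 + l ^ 2 - l - 1) / ((1 + l) ^ 2 * (l - 1)))"
proof -
  obtain l :: real where l: "2 * l = exp (- l)" "\<And>x. 2 * x = exp (- x) \<Longrightarrow> x = l"
    "351732/1000000 < l" "l < 351734/1000000"
    using lambda_exists by blast
  define L where "L = 2 * l ^ 3 / ((1 + l) ^ 2 * (1 - l))"
  \<comment> \<open>Normaliser, total, and number of digraphs without a kernel for n \<ge> 1; the
    desired ratio is (u - s) / u, with both parts divided by d.\<close>
  define d u s where "d n = fact n * tree_egf $ n" and "u n = real (num_unicircuit n)"
    and "s n = (\<Sum>k\<in>{k\<in>{2..n}. odd k}. fact n * (red_egf ^ k) $ n / real k)" for n
  have l': "0 < l" "l < 1" using l(3,4) by auto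
  have "(\<lambda>n. s n / d n) \<longlonglongrightarrow> L"
    unfolding s_def d_def L_def by (rule no_kernel_tendsto[OF l(1,2) l'])
  moreover have u1: "(\<lambda>n. u n / d n) \<longlonglongrightarrow> 1"
    unfolding u_def d_def by (rule num_unicircuit_tendsto)
  ultimately have "(\<lambda>n. (u n / d n - s n / d n) / (u n / d n)) \<longlonglongrightarrow> (1 - L) / 1"
    by (intro tendsto_intros) auto
  moreover have "eventually (\<lambda>n. (u n / d n - s n / d n) / (u n / d n)
      = real (num_unicircuit_kernel n) / real (num_unicircuit n)) sequentially"
    using eventually_ge_at_top[of 1]
  proof eventually_elim
    case (elim n)
    have "d n > 0" using tree_egf_pos[OF elim] by (simp add: d_def)
    moreover have "real (num_unicircuit_kernel n) = u n - s n"
      unfolding u_def s_def by (rule num_unicircuit_kernel_eq[OF elim])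
    ultimately show ?case by (simp add: u_def[symmetric] flip: diff_divide_distrib)
  qed
  ultimately have lim: "(\<lambda>n. real (num_unicircuit_kernel n) / real (num_unicircuit n)) \<longlonglongrightarrow> 1 - L"
    using Lim_transform_eventually by fastforce
  show ?thesis
  proof (intro conjI allI ballI exI[of _ l])
    show "2 * x = exp (- x) \<longleftrightarrow> x = l" for x using l(1,2) by blast
    have "\<bar>l - 351733/1000000\<bar> < 1 / 1000000" unfolding abs_less_iff using l(3,4) by linarith
    then show "\<bar>l - 0.351733\<bar> < 1 / 10 ^ 6" by simp
    show "\<bar>(3 * l ^ 3 + l ^ 2 - l - 1) / ((1 + l) ^ 2 * (l - 1)) - 0.9265\<bar> < 5 / 10 ^ 5"
      by (rule limit_value_bounds(2)[OF l(3,4)])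
    show "(\<lambda>n. real (num_unicircuit_kernel n) / real (num_unicircuit n))
         \<longlonglongrightarrow> (3 * l ^ 3 + l ^ 2 - l - 1) / ((1 + l) ^ 2 * (l - 1))"
      unfolding limit_value_bounds(1)[OF l(3,4)] using lim by (simp add: L_def)
  qed (rule kernel_iff_well_colouring)
qed

end
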